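(* Let $P(p,q,r)$ be a three stranded pretzel knot. (1) Suppose $p,q$ and $r$ are all odd. Then a non-trivial tricoloring on $P(p,q,r)$ lifts to a simple $B_3$-coloring if and only if $\pm(p,q,r)\in\{(1,1,1),(3,3,-1),(3,-1,3),(-1,3,3)\}$. (2) Suppose exactly one of $p,q,r$ is even. Then any tricoloring on $P(p,q,r)$ lifts to a simple $B_3$-coloring if and only if the tricoloring is constant on the twist region with an even number of half twists. If we moreover assume that two of $p,q,r$ are odd multiples of $3$ and the third is a multiple of $6$, then exactly one of the four inequivalent tricolorings of $P(p,q,r)$ lifts to a simple $B_3$-coloring.
   Context: The pretzel link $P(q_1,\dots,q_m)$ has the standard diagram with $m$ vertical twist regions side by side, the $i$-th a two-strand twist region with $q_i$ half twists ($q_i\in\mathbb Z$, sign giving the handedness); the top (respectively bottom) right end of the $i$-th region is joined to the top (respectively bottom) left end of the $(i+1)$-st, cyclically in $i$. A tricoloring (simple $S_3$-coloring) of a link $L\subset S^3$ is a homomorphism $\pi_1(S^3\setminus L)\to S_3$ sending meridians to transpositions; equivalently a labelling of the strands of a diagram by transpositions in $S_3$ satisfying the Wirtinger relations. It is trivial if constant. Tricolorings are equivalent if they are conjugate in $S_3$; "the four inequivalent tricolorings" are the non-trivial ones up to conjugation. A tricoloring is constant on a twist region if all strands there carry the same transposition. A simple $B_3$-coloring is a homomorphism $\pi_1(S^3\setminus L)\to B_3$ sending meridians to conjugates of $\sigma_1^{\pm1}$, where $B_3$ is the three strand braid group with Artin generators $\sigma_1,\sigma_2$; it lifts the tricoloring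 obtained by composing with the natural map $B_3\to S_3$. (Homomorphisms may be replaced throughout by antihomomorphisms, depending on multiplication conventions.)
   Formalization: p,q,r are assumed non-zero (P(3,3,0) violates part 2), and "only if constant on the even twist region" is claimed except when the even entry is 2e, e=±1, and both odd entries are ≡ -e mod 6, where it fails (P(-2,1,1) is a trefoil). *)

theory Defs
  imports "HOL-Algebra.Sym_Groups" "HOL-Number_Theory.Cong"
begin

section \<open>Groups given by generators and relations\<close>

text \<open>The letter (x, True) stands for the generator x and (x, False) for its formal inverse.
  A relation is a pair of words that are to become equal.\<close>

type_synonym 'g word = "('g \<times> bool) list"

definition words :: "'g set \<Rightarrow> 'g word set" where
  "words S = lists (S \<times> UNIV)"

inductive_set word_equiv :: "'g set \<Rightarrow> ('g word \<times> 'g word) set \<Rightarrow> ('g word \<times> 'g word) set"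
  for S :: "'g set" and R :: "('g word \<times> 'g word) set" where
  refl: "w \<in> words S \<Longrightarrow> (w, w) \<in> word_equiv S R"
| sym: "(v, w) \<in> word_equiv S R \<Longrightarrow> (w, v) \<in> word_equiv S R"
| trans: "(u, v) \<in> word_equiv S R \<Longrightarrow> (v, w) \<in> word_equiv S R \<Longrightarrow> (u, w) \<in> word_equiv S R"
| cancel: "u \<in> words S \<Longrightarrow> v \<in> words S \<Longrightarrow> x \<in> S \<Longrightarrow>
    (u @ [(x, b), (x, \<not> b)] @ v, u @ v) \<in> word_equiv S R"
| relation: "u \<in> words S \<Longrightarrow> v \<in> words S \<Longrightarrow> (l, r) \<in> R \<Longrightarrow> l \<in> words S \<Longrightarrow> r \<in> words S \<Longrightarrow>
    (u @ l @ v, u @ r @ v) \<in> word_equiv S R"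

definition presented_group :: "'g set \<Rightarrow> ('g word \<times> 'g word) set \<Rightarrow> 'g word set monoid" where
  "presented_group S R =
    \<lparr> carrier = words S // word_equiv S R,
      mult = (\<lambda>A B. \<Union>u\<in>A. \<Union>v\<in>B. word_equiv S R `` {u @ v}),
      one = word_equiv S R `` {[]} \<rparr>"

definition generator :: "'g set \<Rightarrow> ('g word \<times> 'g word) set \<Rightarrow> 'g \<Rightarrow> 'g word set" where
  "generator S R x = word_equiv S R `` {[(x, True)]}"

fun eval_word :: "('b, 'c) monoid_scheme \<Rightarrow> ('g \<Rightarrow> 'b) \<Rightarrow> 'g word \<Rightarrow> 'b" where
  "eval_word G f [] = \<one>\<^bsub>G\<^esub>"
| "eval_word G f ((x, b) # w) = (if b then f x else inv\<^bsub>G\<^esub> (f x)) \<otimes>\<^bsub>G\<^esub> eval_word G f w"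

lemma words_append [simp]: "u @ v \<in> words S \<longleftrightarrow> u \<in> words S \<and> v \<in> words S"
  by (auto simp: words_def)

lemma words_Nil [simp]: "[] \<in> words S"
  by (simp add: words_def)

lemma words_Cons [simp]: "(x, b) # w \<in> words S \<longleftrightarrow> x \<in> S \<and> w \<in> words S"
  by (auto simp: words_def)

lemma word_equiv_words: "(u, v) \<in> word_equiv S R \<Longrightarrow> u \<in> words S \<and> v \<in> words S"
  by (induction rule: word_equiv.induct) auto

lemma equiv_word_equiv: "equiv (words S) (word_equiv S R)"
proof (rule equivI)
  show "word_equiv S R \<subseteq> words S \<times> words S"
    using word_equiv_words by fastforce
  show "refl_on (words S) (word_equiv S R)"
    by (auto simp: refl_on_def intro: word_equiv.refl)
  show "Relation.sym (word_equiv S R)"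
    by (rule symI) (rule word_equiv.sym)
  show "Relation.trans (word_equiv S R)"
    by (rule transI) (rule word_equiv.trans)
qed

lemma word_equiv_context:
  assumes "(u, v) \<in> word_equiv S R" "a \<in> words S" "c \<in> words S"
  shows "(a @ u @ c, a @ v @ c) \<in> word_equiv S R"
  using assms
proof (induction rule: word_equiv.induct)
  case (refl w)
  then show ?case by (simp add: word_equiv.refl)
next
  case (sym v w)
  then show ?case by (simp add: word_equiv.sym)
next
  case (trans u v w)
  then show ?case by (blast intro: word_equiv.trans)
next
  case (cancel u v x b)
  then show ?case using word_equiv.cancel[of "a @ u" S "v @ c" x b R] by simp
next
  case (relation u v l r)
  then show ?case using word_equiv.relation[of "a @ u" S "v @ c" l r R] by simp
qed

lemma word_equiv_append:
  assumes "(u, u') \<in> word_equiv S R" "(v, v') \<in> word_equiv S R"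
  shows "(u @ v, u' @ v') \<in> word_equiv S R"
proof -
  have "(u @ v, u' @ v) \<in> word_equiv S R"
    using word_equiv_context[OF assms(1), of "[]" v] word_equiv_words[OF assms(2)] by simp
  moreover have "(u' @ v, u' @ v') \<in> word_equiv S R"
    using word_equiv_context[OF assms(2), of u' "[]"] word_equiv_words[OF assms(1)] by simp
  ultimately show ?thesis by (rule word_equiv.trans)
qed

lemma presented_group_mult_class:
  assumes "u \<in> words S" "v \<in> words S"
  shows "word_equiv S R `` {u} \<otimes>\<^bsub>presented_group S R\<^esub> word_equiv S R `` {v} = word_equiv S R `` {u @ v}"
proof -
  have eq: "word_equiv S R `` {u' @ v'} = word_equiv S R `` {u @ v}"
    if "u' \<in> word_equiv S R `` {u}" "v' \<in> word_equiv S R `` {v}" for u' v'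
    using that equiv_class_eq[OF equiv_word_equiv, of "u @ v" "u' @ v'" S R] word_equiv_append[of u u' S R v v']
    by simp
  have "u \<in> word_equiv S R `` {u}" "v \<in> word_equiv S R `` {v}"
    using assms by (auto intro: word_equiv.refl)
  then have "(\<Union>u'\<in>word_equiv S R `` {u}. \<Union>v'\<in>word_equiv S R `` {v}. word_equiv S R `` {u' @ v'})
      = word_equiv S R `` {u @ v}"
    using eq by blast
  then show ?thesis by (simp add: presented_group_def)
qed

lemma word_equiv_left_inverse:
  "w \<in> words S \<Longrightarrow> (rev (map (\<lambda>(x, b). (x, \<not> b)) w) @ w, []) \<in> word_equiv S R"
proof (induction w)
  case Nil
  then show ?case by (simp add: word_equiv.refl)
next
  case (Cons a w)
  obtain x b where a: "a = (x, b)" by (cases a)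
  let ?i = "rev (map (\<lambda>(x, b). (x, \<not> b)) w)"
  have w: "x \<in> S" "w \<in> words S" using Cons.prems a by auto
  then have i: "?i \<in> words S" by (auto simp: words_def)
  show ?case
    using word_equiv.trans[OF word_equiv.cancel[of ?i S w x "\<not> b" R] Cons.IH] w i a by simp
qed

lemma group_presented_group: "group (presented_group S R)"
proof (rule groupI)
  let ?G = "presented_group S R" and ?c = "\<lambda>w. word_equiv S R `` {w}"
  have carr: "\<exists>w\<in>words S. x = ?c w" if "x \<in> carrier ?G" for x
    using that by (auto simp: presented_group_def elim!: quotientE)
  have inC: "?c w \<in> carrier ?G" if "w \<in> words S" for w
    using that by (auto simp: presented_group_def intro: quotientI)
  have one: "\<one>\<^bsub>?G\<^esub> = ?c []" by (simp add: presented_group_def)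
  show "\<one>\<^bsub>?G\<^esub> \<in> carrier ?G" using inC one by simp
  show "x \<otimes>\<^bsub>?G\<^esub> y \<in> carrier ?G" if "x \<in> carrier ?G" "y \<in> carrier ?G" for x y
    using carr[OF that(1)] carr[OF that(2)] inC by (auto simp: presented_group_mult_class)
  show "x \<otimes>\<^bsub>?G\<^esub> y \<otimes>\<^bsub>?G\<^esub> z = x \<otimes>\<^bsub>?G\<^esub> (y \<otimes>\<^bsub>?G\<^esub> z)"
    if "x \<in> carrier ?G" "y \<in> carrier ?G" "z \<in> carrier ?G" for x y z
    using carr[OF that(1)] carr[OF that(2)] carr[OF that(3)] by (auto simp: presented_group_mult_class)
  show "\<one>\<^bsub>?G\<^esub> \<otimes>\<^bsub>?G\<^esub> x = x" if "x \<in> carrier ?G" for x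
    using carr[OF that] one presented_group_mult_class[of "[]" S _ R] by auto
  show "\<exists>y\<in>carrier ?G. y \<otimes>\<^bsub>?G\<^esub> x = \<one>\<^bsub>?G\<^esub>" if "x \<in> carrier ?G" for x
  proof -
    obtain w where w: "w \<in> words S" "x = ?c w" using carr[OF \<open>x \<in> carrier ?G\<close>] by blast
    let ?i = "rev (map (\<lambda>(x, b). (x, \<not> b)) w)"
    have i: "?i \<in> words S" using w(1) by (auto simp: words_def)
    have "?c (?i @ w) = ?c []"
      using equiv_class_eq[OF equiv_word_equiv word_equiv_left_inverse[OF w(1)]] .
    then show ?thesis
      using inC[OF i] presented_group_mult_class[OF i w(1), of R] w(2) one by metis
  qed
qed


section \<open>Pretzel links and their groups\<close>

text \<open>The twist region with \<open>q\<close> half twists is drawn vertically; its crossings are stacked below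
  each other. The segment \<open>(i, k, s)\<close> is the one on side \<open>s\<close> of the \<open>i\<close>-th region (counted from 0)
  between the \<open>k\<close>-th and the \<open>k+1\<close>-st crossing, so \<open>k = 0\<close> is the top and \<open>k = \<bar>q\<bar>\<close> the bottom of
  the region.\<close>

datatype side = L | R

type_synonym segment = "nat \<times> nat \<times> side"

definition segments :: "int list \<Rightarrow> segment set" where
  "segments qs = {(i, k, s). i < length qs \<and> k \<le> nat \<bar>qs ! i\<bar>}"

text \<open>Wirtinger generators are taken with respect to the local orientation of every segment from top
  to bottom, so that no orientation of the link has to be chosen. The over strand of a crossing runs
  from the upper left to the lower right if \<open>q > 0\<close> and from the upper right to the lower left if
  \<open>q < 0\<close>. Along the arcs that join neighbouring regions the local orientation is reversed,
  so the two end segments of such an arc have mutually inverse meridians.\<close>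

definition crossing_relations :: "int list \<Rightarrow> nat \<Rightarrow> nat \<Rightarrow> (segment word \<times> segment word) set" where
  "crossing_relations qs i k =
    (if qs ! i > 0 then
      {([((i, Suc k, R), True)], [((i, k, L), True)]),
       ([((i, Suc k, L), True)], [((i, k, L), True), ((i, k, R), True), ((i, k, L), False)])}
     else
      {([((i, Suc k, L), True)], [((i, k, R), True)]),
       ([((i, Suc k, R), True)], [((i, k, R), False), ((i, k, L), True), ((i, k, R), True)])})"

definition joining_relations :: "int list \<Rightarrow> nat \<Rightarrow> (segment word \<times> segment word) set" where
  "joining_relations qs i =
    (let j = Suc i mod length qs in
      {([((i, 0, R), True)], [((j, 0, L), False)]),
       ([((i, nat \<bar>qs ! i\<bar>, R), True)], [((j, nat \<bar>qs ! j\<bar>, L), False)])})"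

definition pretzel_relations :: "int list \<Rightarrow> (segment word \<times> segment word) set" where
  "pretzel_relations qs =
    (\<Union>i<length qs. (\<Union>k<nat \<bar>qs ! i\<bar>. crossing_relations qs i k) \<union> joining_relations qs i)"

definition pretzel_group :: "int list \<Rightarrow> segment word set monoid" where
  "pretzel_group qs = presented_group (segments qs) (pretzel_relations qs)"

definition segment_meridian :: "int list \<Rightarrow> segment \<Rightarrow> segment word set" where
  "segment_meridian qs = generator (segments qs) (pretzel_relations qs)"

definition conjugates_pm :: "('a, 'b) monoid_scheme \<Rightarrow> 'a \<Rightarrow> 'a set" where
  "conjugates_pm G x =
    {g \<otimes>\<^bsub>G\<^esub> y \<otimes>\<^bsub>G\<^esub> inv\<^bsub>G\<^esub> g | g y. g \<in> carrier G \<and> y \<in> {x, inv\<^bsub>G\<^esub> x}}"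

definition meridians :: "int list \<Rightarrow> segment word set set" where
  "meridians qs = (\<Union>s\<in>segments qs. conjugates_pm (pretzel_group qs) (segment_meridian qs s))"


section \<open>Tricolorings\<close>

abbreviation S3 :: "(nat \<Rightarrow> nat) monoid" where
  "S3 \<equiv> sym_group 3"

definition transpositions3 :: "(nat \<Rightarrow> nat) set" where
  "transpositions3 = {transpose a b | a b. a \<in> {1..3} \<and> b \<in> {1..3} \<and> a \<noteq> b}"

definition tricolorings :: "int list \<Rightarrow> (segment word set \<Rightarrow> nat \<Rightarrow> nat) set" where
  "tricolorings qs = {\<phi> \<in> hom (pretzel_group qs) S3. \<forall>m\<in>meridians qs. \<phi> m \<in> transpositions3}"

definition trivial_tricoloring :: "int list \<Rightarrow> (segment word set \<Rightarrow> nat \<Rightarrow> nat) \<Rightarrow> bool" where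
  "trivial_tricoloring qs \<phi> \<longleftrightarrow> (\<exists>t. \<forall>s\<in>segments qs. \<phi> (segment_meridian qs s) = t)"

definition nontrivial_tricolorings :: "int list \<Rightarrow> (segment word set \<Rightarrow> nat \<Rightarrow> nat) set" where
  "nontrivial_tricolorings qs = {\<phi> \<in> tricolorings qs. \<not> trivial_tricoloring qs \<phi>}"

definition constant_on_region ::
    "int list \<Rightarrow> nat \<Rightarrow> (segment word set \<Rightarrow> nat \<Rightarrow> nat) \<Rightarrow> bool" where
  "constant_on_region qs i \<phi> \<longleftrightarrow>
    (\<exists>t. \<forall>k s. (i, k, s) \<in> segments qs \<longrightarrow> \<phi> (segment_meridian qs (i, k, s)) = t)"

text \<open>Homomorphisms are only compared on the carrier, since their values elsewhere are arbitrary.\<close>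

definition tricoloring_equiv ::
    "int list \<Rightarrow> ((segment word set \<Rightarrow> nat \<Rightarrow> nat) \<times> (segment word set \<Rightarrow> nat \<Rightarrow> nat)) set" where
  "tricoloring_equiv qs =
    {(\<phi>, \<psi>). \<phi> \<in> tricolorings qs \<and> \<psi> \<in> tricolorings qs \<and>
      (\<exists>g\<in>carrier S3. \<forall>x\<in>carrier (pretzel_group qs). \<psi> x = g \<otimes>\<^bsub>S3\<^esub> \<phi> x \<otimes>\<^bsub>S3\<^esub> inv\<^bsub>S3\<^esub> g)}"

definition nontrivial_tricoloring_classes ::
    "int list \<Rightarrow> (segment word set \<Rightarrow> nat \<Rightarrow> nat) set set" where
  "nontrivial_tricoloring_classes qs = nontrivial_tricolorings qs // tricoloring_equiv qs"


section \<open>The braid group on three strands and liftings\<close>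

definition braid_relations3 :: "(nat word \<times> nat word) set" where
  "braid_relations3 =
    {([(1, True), (2, True), (1, True)], [(2, True), (1, True), (2, True)])}"

definition B3 :: "nat word set monoid" where
  "B3 = presented_group {1, 2} braid_relations3"

definition artin_generator :: "nat \<Rightarrow> nat word set" where
  "artin_generator = generator {1, 2} braid_relations3"

text \<open>The natural map to the symmetric group, sending the \<open>i\<close>-th Artin generator to the
  transposition of \<open>i\<close> and \<open>i + 1\<close>; all words in a class have the same image.\<close>

definition braid_permutation :: "nat word set \<Rightarrow> nat \<Rightarrow> nat" where
  "braid_permutation C = the_elem (eval_word S3 (\<lambda>i. transpose i (i + 1)) ` C)"

definition simple_B3_colorings :: "int list \<Rightarrow> (segment word set \<Rightarrow> nat word set) set" where
  "simple_B3_colorings qs =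
    {\<rho> \<in> hom (pretzel_group qs) B3.
      \<forall>m\<in>meridians qs. \<rho> m \<in> conjugates_pm B3 (artin_generator 1)}"

definition lifts_to_B3 :: "int list \<Rightarrow> (segment word set \<Rightarrow> nat \<Rightarrow> nat) \<Rightarrow> bool" where
  "lifts_to_B3 qs \<phi> \<longleftrightarrow>
    (\<exists>\<rho>\<in>simple_B3_colorings qs.
      \<forall>x\<in>carrier (pretzel_group qs). braid_permutation (\<rho> x) = \<phi> x)"

end

theory Submission
  imports Defs
begin

text \<open>A coloring of a pretzel link by a group \<open>G\<close> is determined by the meridians \<open>x 0, x 1, \<dots>\<close> at the upper
left ends of its regions. Inside a region the product of the two meridians at a level does not change
from level to level, so the meridians form a sequence \<open>twist\<close> that is periodic up to conjugation by
that product, and all Wirtinger relations together say that these sequences fit at the bottom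
(\<open>hom_closes_up\<close>, \<open>closes_up_hom_exists\<close>). For \<open>S3\<close> the transpositions are the reflections of a triangle,
labelled by integers modulo 3, and fitting at the bottom means that the numbers \<open>q i * (c i - c (i + 1))\<close>
agree modulo 3 for all regions \<open>i\<close>, where \<open>c i\<close> is the label at the top left of region \<open>i\<close>
(\<open>joins_reflections\<close>).

Lifts are written down by hand. If the two labels at an even region agree, give the left top
meridians of this region and of the next one the same value \<open>a\<close> and the third one the value
\<open>inv b\<close>, where \<open>a = b\<close>, or \<open>a\<close> and \<open>b\<close> satisfy the braid relation; in the second case the sequence of the two odd regions has period 3 already
in the braid group (\<open>twist_braided_period\<close>), exactly as in \<open>S3\<close>. The trefoil and the knots (3, 3, -1) are
colored by explicit conjugates of a braided pair.

For the converse let \<open>B3\<close> act on the integral plane through \<open>SL2Z\<close>. The conjugates of the Artin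
generators and of their inverses become transvections \<open>transvection e v\<close> with \<open>e = 1\<close> or \<open>e = -1\<close>, and reducing
\<open>v\<close> modulo 2 recovers the transposition (\<open>simple_braid_images\<close>). A lift is therefore a triple of vectors
that closes up; let \<open>k1, k2, k3\<close> be the areas spanned by consecutive vectors. If a tricoloring is not
constant on region \<open>i\<close>, then \<open>ki\<close> is odd. By the theorem of Cayley and Hamilton the vectors in
a region are combinations of the two top ones whose coefficients are Chebyshev numbers, and pairing the closing equations with
the vectors themselves shows that \<open>Ai * ki\<close> has the same absolute value \<open>C\<close> for all three regions, where
\<open>Ai\<close> is the coefficient on the diagonal; the remaining equations determine the other coefficients.
Since Chebyshev numbers satisfy a Pell equation (\<open>cheb_cassini\<close>), only one equation in \<open>k1, k2, k3\<close> and \<open>C\<close>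
is left. When all regions are odd it is

  \<open>C^2 * (k1^4 + k2^4 + k3^4 - 2 * k1^2 * k2^2 - 2 * k2^2 * k3^2 - 2 * k3^2 * k1^2) = (k1 * k2 * k3)^2 * (C^2 - 4)\<close>,

where the second factor on the left is minus sixteen times the square of the area of a triangle with
sides \<open>\<bar>ki\<bar>\<close>; when one region is even, some signs change. Both equations are solved by comparing
sizes, because up to sign \<open>Ai\<close> is 1 or at least about \<open>ki^2\<close> in an odd region, and \<open>ki\<close> or at least
about \<open>ki^3\<close> in an even one (\<open>odd_diophantine\<close>, \<open>even_diophantine\<close>). What remains are
areas of absolute value at most 2, and the lengths of the regions are read off from the small
Chebyshev numbers.

For the count, two tricolorings are conjugate if and only if the same pairs of labels agree, since all
affine maps modulo 3 are conjugations by elements of \<open>S3\<close>.\<close>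

section \<open>Homomorphisms out of a presented group\<close>

context group
begin

lemma eval_word_closed:
  assumes f: "f \<in> S \<rightarrow> carrier G" and "w \<in> words S"
  shows "eval_word G f w \<in> carrier G"
  using assms(2) by (induction w) (use f in \<open>auto simp: Pi_iff\<close>)

lemma eval_word_append:
  assumes f: "f \<in> S \<rightarrow> carrier G" and "u \<in> words S" "v \<in> words S"
  shows "eval_word G f (u @ v) = eval_word G f u \<otimes> eval_word G f v"
  using assms(2)
proof (induction u)
  case Nil
  then show ?case using eval_word_closed[OF f assms(3)] by simp
next
  case (Cons a u)
  then show ?case using f eval_word_closed[OF f] assms(3) by (cases a) (auto simp: m_assoc Pi_iff)
qed

lemma eval_word_word_equiv:
  assumes f: "f \<in> S \<rightarrow> carrier G"
    and rel: "\<And>l r. (l, r) \<in> E \<Longrightarrow> l \<in> words S \<Longrightarrow> r \<in> words S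
      \<Longrightarrow> eval_word G f l = eval_word G f r"
    and "(u, v) \<in> word_equiv S E"
  shows "eval_word G f u = eval_word G f v"
  using assms(3)
proof (induction rule: word_equiv.induct)
  case (cancel u v x b)
  have "eval_word G f ([(x, b), (x, \<not> b)] @ v) = eval_word G f v"
    using cancel f eval_word_closed[OF f, of v] by (auto simp: m_assoc[symmetric] Pi_iff)
  then show ?case
    using cancel eval_word_append[OF f] by (metis words_append words_Cons words_Nil)
next
  case (relation u v l r)
  then show ?case by (simp add: eval_word_append[OF f] rel)
qed auto

text \<open>Von Dyck's theorem, with the induced homomorphism written in the same form as \<open>braid_permutation\<close>, so
that the latter is an instance.\<close>

lemma presented_hom_eval:
  assumes f: "f \<in> S \<rightarrow> carrier G"
    and rel: "\<And>l r. (l, r) \<in> E \<Longrightarrow> l \<in> words S \<Longrightarrow> r \<in> words S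
      \<Longrightarrow> eval_word G f l = eval_word G f r"
    and w: "w \<in> words S"
  shows "the_elem (eval_word G f ` (word_equiv S E `` {w})) = eval_word G f w"
proof -
  have "eval_word G f v = eval_word G f w" if "v \<in> word_equiv S E `` {w}" for v
    using eval_word_word_equiv[OF f rel, of E w v] that by simp
  moreover have "w \<in> word_equiv S E `` {w}" using word_equiv.refl[OF w] by simp
  ultimately have "eval_word G f ` (word_equiv S E `` {w}) = {eval_word G f w}" by blast
  then show ?thesis by simp
qed

lemma presented_hom:
  assumes f: "f \<in> S \<rightarrow> carrier G"
    and rel: "\<And>l r. (l, r) \<in> E \<Longrightarrow> l \<in> words S \<Longrightarrow> r \<in> words S
      \<Longrightarrow> eval_word G f l = eval_word G f r"
  shows "(\<lambda>C. the_elem (eval_word G f ` C)) \<in> hom (presented_group S E) G"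
proof (rule homI)
  have carr: "\<exists>w\<in>words S. C = word_equiv S E `` {w}" if "C \<in> carrier (presented_group S E)" for C
    using that by (auto simp: presented_group_def elim!: quotientE)
  have eval: "the_elem (eval_word G f ` (word_equiv S E `` {w})) = eval_word G f w"
    if "w \<in> words S" for w by (rule presented_hom_eval[OF f rel that])
  show "the_elem (eval_word G f ` C) \<in> carrier G" if "C \<in> carrier (presented_group S E)" for C
    using carr[OF that] eval_word_closed[OF f] by (auto simp: eval)
  show "the_elem (eval_word G f ` (C \<otimes>\<^bsub>presented_group S E\<^esub> D)) =
      the_elem (eval_word G f ` C) \<otimes> the_elem (eval_word G f ` D)"
    if "C \<in> carrier (presented_group S E)" "D \<in> carrier (presented_group S E)" for C D
    using carr[OF that(1)] carr[OF that(2)] eval_word_append[OF f]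
    by (auto simp: presented_group_mult_class eval)
qed

end

lemma class_in_carrier: "w \<in> words S \<Longrightarrow> word_equiv S E `` {w} \<in> carrier (presented_group S E)"
  by (auto simp: presented_group_def intro: quotientI)

lemma generator_in_carrier: "x \<in> S \<Longrightarrow> generator S E x \<in> carrier (presented_group S E)"
  by (simp add: generator_def class_in_carrier)

lemma class_inverse_letter:
  assumes "x \<in> S"
  shows "word_equiv S E `` {[(x, False)]} = inv\<^bsub>presented_group S E\<^esub> generator S E x"
proof -
  interpret P: group "presented_group S E" by (rule group_presented_group)
  have "word_equiv S E `` {[(x, False), (x, True)]} = word_equiv S E `` {[]}"
    using word_equiv.cancel[of "[]" S "[]" x False E] assms
    by (intro equiv_class_eq[OF equiv_word_equiv]) auto
  then have "word_equiv S E `` {[(x, False)]} \<otimes>\<^bsub>presented_group S E\<^esub> generator S E x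
      = \<one>\<^bsub>presented_group S E\<^esub>"
    using assms by (simp add: generator_def presented_group_mult_class)
      (simp add: presented_group_def)
  then show ?thesis
    using assms P.inv_equality by (simp add: class_in_carrier generator_in_carrier)
qed

lemma hom_class_eq_eval_word:
  assumes G: "group G" and h: "h \<in> hom (presented_group S E) G" and "w \<in> words S"
  shows "h (word_equiv S E `` {w}) = eval_word G (\<lambda>x. h (generator S E x)) w"
proof -
  interpret P: group "presented_group S E" by (rule group_presented_group)
  interpret h: group_hom "presented_group S E" G h
    using G h by (simp add: group_hom_def group_hom_axioms_def P.group_axioms)
  show ?thesis using assms(3)
  proof (induction w)
    case Nil
    have "word_equiv S E `` {[]} = \<one>\<^bsub>presented_group S E\<^esub>" by (simp add: presented_group_def)
    then show ?case using h.hom_one by simp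
  next
    case (Cons a w)
    obtain x b where a: "a = (x, b)" by (cases a)
    then have xw: "x \<in> S" "w \<in> words S" using Cons.prems by auto
    have "word_equiv S E `` {a # w} =
        word_equiv S E `` {[a]} \<otimes>\<^bsub>presented_group S E\<^esub> word_equiv S E `` {w}"
      using xw a by (simp add: presented_group_mult_class)
    moreover have "h (word_equiv S E `` {[a]}) =
        (if b then h (generator S E x) else inv\<^bsub>G\<^esub> h (generator S E x))"
      using a xw class_inverse_letter[OF xw(1), of E] h.hom_inv[OF generator_in_carrier[OF xw(1)]]
      by (cases b) (auto simp: generator_def)
    ultimately show ?case
      using Cons xw a by (simp add: class_in_carrier)
  qed
qed

lemma hom_satisfies_relation:
  assumes "group G" "h \<in> hom (presented_group S E) G"
    and "(l, r) \<in> E" "l \<in> words S" "r \<in> words S"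
  shows "eval_word G (\<lambda>x. h (generator S E x)) l = eval_word G (\<lambda>x. h (generator S E x)) r"
proof -
  have "(l, r) \<in> word_equiv S E"
    using word_equiv.relation[of "[]" S "[]" l r E] assms by simp
  then show ?thesis
    using hom_class_eq_eval_word assms equiv_class_eq[OF equiv_word_equiv] by metis
qed

lemma presented_homs_eqI:
  assumes G: "group G" and h: "h \<in> hom (presented_group S E) G" "h' \<in> hom (presented_group S E) G"
    and eq: "\<And>x. x \<in> S \<Longrightarrow> h (generator S E x) = h' (generator S E x)"
    and C: "C \<in> carrier (presented_group S E)"
  shows "h C = h' C"
proof -
  obtain w where w: "w \<in> words S" "C = word_equiv S E `` {w}"
    using C by (auto simp: presented_group_def elim!: quotientE)
  have "eval_word G (\<lambda>x. h (generator S E x)) w = eval_word G (\<lambda>x. h' (generator S E x)) w"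
    using w(1) by (induction w) (auto simp: eq)
  then show ?thesis
    using hom_class_eq_eval_word[OF G h(1) w(1)] hom_class_eq_eval_word[OF G h(2) w(1)] w(2) by simp
qed


section \<open>Colorings of a twist region\<close>

text \<open>The meridians that occur in a twist region with top meridians \<open>l\<close> and \<open>r\<close>, arranged in a sequence that is
infinite in both directions: place 0 is the right and place 1 the left top segment, a positive crossing
moves both sides one place up and a negative one moves them one place down. Since adjacent members
have the constant product \<open>l \<otimes> r\<close>, members at distance 2 are conjugate by it, which gives this closed form.\<close>

definition twist :: "('a, 'b) monoid_scheme \<Rightarrow> 'a \<Rightarrow> 'a \<Rightarrow> int \<Rightarrow> 'a" where
  "twist G l r n = (let c = (l \<otimes>\<^bsub>G\<^esub> r) [^]\<^bsub>G\<^esub> (n div 2)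
    in c \<otimes>\<^bsub>G\<^esub> (if even n then r else l) \<otimes>\<^bsub>G\<^esub> inv\<^bsub>G\<^esub> c)"

context group
begin

lemma cancel_left [simp]:
  assumes "x \<in> carrier G" "y \<in> carrier G"
  shows "x \<otimes> (inv x \<otimes> y) = y" "inv x \<otimes> (x \<otimes> y) = y"
  using assms by (simp_all add: m_assoc[symmetric])

lemma twist_closed [simp]:
  "l \<in> carrier G \<Longrightarrow> r \<in> carrier G \<Longrightarrow> twist G l r n \<in> carrier G"
  by (simp add: twist_def Let_def)

lemma twist_0 [simp]: "l \<in> carrier G \<Longrightarrow> r \<in> carrier G \<Longrightarrow> twist G l r 0 = r"
  by (simp add: twist_def)

lemma twist_1 [simp]: "l \<in> carrier G \<Longrightarrow> r \<in> carrier G \<Longrightarrow> twist G l r 1 = l"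
  by (simp add: twist_def)

lemma twist_product:
  assumes [simp]: "l \<in> carrier G" "r \<in> carrier G"
  shows "twist G l r (n + 1) \<otimes> twist G l r n = l \<otimes> r"
proof -
  define d where "d = l \<otimes> r"
  define c where "c = d [^] (n div 2)"
  have [simp]: "c \<in> carrier G" "d \<in> carrier G" by (simp_all add: c_def d_def)
  have cd: "c \<otimes> d = d \<otimes> c" "c \<otimes> (d \<otimes> inv c) = d"
  proof -
    show *: "c \<otimes> d = d \<otimes> c"
      unfolding c_def by (metis \<open>d \<in> carrier G\<close> add.commute int_pow_1 int_pow_mult)
    then show "c \<otimes> (d \<otimes> inv c) = d"
      by (simp add: m_assoc[symmetric]) (simp add: m_assoc)
  qed
  show ?thesis
  proof (cases "even n")
    case True
    then have "(n + 1) div 2 = n div 2" by presburger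
    then have "twist G l r (n + 1) \<otimes> twist G l r n = (c \<otimes> l \<otimes> inv c) \<otimes> (c \<otimes> r \<otimes> inv c)"
      using True by (simp add: twist_def Let_def c_def d_def)
    also have "\<dots> = c \<otimes> (d \<otimes> inv c)" by (simp add: m_assoc d_def)
    finally show ?thesis using cd by (simp add: d_def)
  next
    case False
    then have "(n + 1) div 2 = n div 2 + 1" by presburger
    then have "d [^] ((n + 1) div 2) = c \<otimes> d"
      by (simp add: c_def int_pow_mult)
    then have "twist G l r (n + 1) \<otimes> twist G l r n =
        ((c \<otimes> d) \<otimes> r \<otimes> inv (c \<otimes> d)) \<otimes> (c \<otimes> l \<otimes> inv c)"
      using False by (simp add: twist_def Let_def c_def d_def)
    also have "\<dots> = c \<otimes> (d \<otimes> inv c)" by (simp add: m_assoc d_def inv_mult_group)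
    finally show ?thesis using cd by (simp add: d_def)
  qed
qed

lemma twist_next:
  assumes "l \<in> carrier G" "r \<in> carrier G"
  shows "twist G l r (n + 1) = twist G l r n \<otimes> twist G l r (n - 1) \<otimes> inv twist G l r n"
  using twist_product[OF assms, of n] twist_product[OF assms, of "n - 1"] assms
  by (simp add: inv_solve_right)

lemma twist_prev:
  assumes "l \<in> carrier G" "r \<in> carrier G"
  shows "twist G l r (n - 1) = inv twist G l r n \<otimes> twist G l r (n + 1) \<otimes> twist G l r n"
  using twist_product[OF assms, of n] twist_product[OF assms, of "n - 1"] assms
  by (simp add: inv_solve_left m_assoc)

text \<open>The constant product of adjacent members determines the whole sequence from its members 0 and 1. All
explicit computations of \<open>twist\<close> below verify a guess with this rule.\<close>

lemma twist_eqI: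
  assumes [simp]: "l \<in> carrier G" "r \<in> carrier G" "\<And>n. f n \<in> carrier G"
    and f: "f 0 = r" "f 1 = l" "\<And>n. f (n + 1) \<otimes> f n = l \<otimes> r"
  shows "twist G l r n = f n"
proof (induction n rule: int_induct[where k = 0])
  case base
  then show ?case by (simp add: f)
next
  case (step1 i)
  have "twist G l r (i + 1) \<otimes> f i = f (i + 1) \<otimes> f i"
    using twist_product[of l r i] f(3)[of i] step1 by simp
  then show ?case by simp
next
  case (step2 i)
  have "f i \<otimes> twist G l r (i - 1) = f i \<otimes> f (i - 1)"
    using twist_product[of l r "i - 1"] f(3)[of "i - 1"] step2 by simp
  then show ?case by simp
qed

lemma hom_twist:
  assumes "group H" "h \<in> hom G H" "l \<in> carrier G" "r \<in> carrier G"
  shows "h (twist G l r n) = twist H (h l) (h r) n"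
proof -
  interpret H: group H by fact
  interpret h: group_hom G H h
    using assms by (simp add: group_hom_def group_hom_axioms_def group_axioms)
  have "h (twist G l r (n + 1)) \<otimes>\<^bsub>H\<^esub> h (twist G l r n) = h l \<otimes>\<^bsub>H\<^esub> h r" for n
    using twist_product[OF assms(3,4), of n] assms by (metis h.hom_mult twist_closed)
  then show ?thesis using H.twist_eqI[of "h l" "h r" "\<lambda>n. h (twist G l r n)" n] assms by simp
qed

end

section \<open>Homomorphisms out of a pretzel group\<close>

definition pretzel_arc :: "('a, 'b) monoid_scheme \<Rightarrow> int list \<Rightarrow> (nat \<Rightarrow> 'a) \<Rightarrow> nat \<Rightarrow> int \<Rightarrow> 'a" where
  "pretzel_arc G qs x i = twist G (x i) (inv\<^bsub>G\<^esub> x (Suc i mod length qs))"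

text \<open>The relations of the arcs at the bottom. Those of the arcs at the top are built into \<open>pretzel_arc\<close>,
where the right top meridian of a region is the inverse of the left one of the next region.\<close>

definition closes_up :: "('a, 'b) monoid_scheme \<Rightarrow> int list \<Rightarrow> (nat \<Rightarrow> 'a) \<Rightarrow> bool" where
  "closes_up G qs x \<longleftrightarrow> (\<forall>i<length qs. x i \<in> carrier G \<and>
    pretzel_arc G qs x i (qs ! i) =
      inv\<^bsub>G\<^esub> pretzel_arc G qs x (Suc i mod length qs) (qs ! (Suc i mod length qs) + 1))"

definition top_values :: "int list \<Rightarrow> (segment word set \<Rightarrow> 'a) \<Rightarrow> nat \<Rightarrow> 'a" where
  "top_values qs h i = h (segment_meridian qs (i, 0, L))"

text \<open>The place of a segment in the sequence \<open>twist\<close> of its region; at the bottom it is the signed number of half twists,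
plus 1 on the left.\<close>

definition segment_index :: "int list \<Rightarrow> segment \<Rightarrow> int" where
  "segment_index qs = (\<lambda>(i, k, s). sgn (qs ! i) * int k + (if s = L then 1 else 0))"

lemma segment_meridian_in_carrier:
  "s \<in> segments qs \<Longrightarrow> segment_meridian qs s \<in> carrier (pretzel_group qs)"
  by (simp add: segment_meridian_def pretzel_group_def generator_in_carrier)

lemma group_pretzel_group: "group (pretzel_group qs)"
  by (simp add: pretzel_group_def group_presented_group)

lemma hom_crossing_relation:
  assumes "group G" "h \<in> hom (pretzel_group qs) G" "i < length qs" "k < nat \<bar>qs ! i\<bar>"
    and "(u, v) \<in> crossing_relations qs i k"
  shows "eval_word G (\<lambda>s. h (segment_meridian qs s)) u = eval_word G (\<lambda>s. h (segment_meridian qs s)) v"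
  unfolding segment_meridian_def
proof (rule hom_satisfies_relation)
  show "(u, v) \<in> pretzel_relations qs" using assms by (auto simp: pretzel_relations_def)
qed (use assms in \<open>auto simp: pretzel_group_def crossing_relations_def segments_def split: if_splits\<close>)

lemma hom_joining_relation:
  assumes "group G" "h \<in> hom (pretzel_group qs) G" "i < length qs"
    and "(u, v) \<in> joining_relations qs i"
  shows "eval_word G (\<lambda>s. h (segment_meridian qs s)) u = eval_word G (\<lambda>s. h (segment_meridian qs s)) v"
  unfolding segment_meridian_def
proof (rule hom_satisfies_relation)
  show "(u, v) \<in> pretzel_relations qs" using assms by (auto simp: pretzel_relations_def)
  have "Suc i mod length qs < length qs" using assms by (intro mod_less_divisor) auto
  then show "u \<in> words (segments qs)" "v \<in> words (segments qs)"
    using assms by (auto simp: joining_relations_def Let_def segments_def)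
qed (use assms in \<open>auto simp: pretzel_group_def\<close>)

lemma hom_segment_meridian:
  assumes G: "group G" and h: "h \<in> hom (pretzel_group qs) G" and s: "(i, k, s) \<in> segments qs"
  shows "h (segment_meridian qs (i, k, s)) =
    pretzel_arc G qs (top_values qs h) i (segment_index qs (i, k, s))"
proof -
  interpret G: group G by fact
  define m where "m = (\<lambda>s. h (segment_meridian qs s))"
  define j where "j = Suc i mod length qs"
  define t where "t = pretzel_arc G qs (top_values qs h) i"
  have i: "i < length qs" using s by (simp add: segments_def)
  then have j: "j < length qs" unfolding j_def by (intro mod_less_divisor) auto
  have m [simp]: "m s \<in> carrier G" if "s \<in> segments qs" for s
    using segment_meridian_in_carrier[OF that] h by (auto simp: m_def hom_def)
  have top: "m (i, 0, L) \<in> carrier G" "m (j, 0, L) \<in> carrier G"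
    using i j by (simp_all add: segments_def)
  have tdef: "t = twist G (m (i, 0, L)) (inv\<^bsub>G\<^esub> m (j, 0, L))"
    by (simp add: t_def pretzel_arc_def top_values_def m_def j_def fun_eq_iff)
  have t [simp]: "t n \<in> carrier G" for n using top by (simp add: tdef)
  have "m (i, 0, R) = inv\<^bsub>G\<^esub> m (j, 0, L)"
    using hom_joining_relation[OF G h i, of "[((i, 0, R), True)]" "[((j, 0, L), False)]"] i j
    by (simp add: joining_relations_def Let_def segments_def m_def[symmetric] j_def)
  have "k \<le> nat \<bar>qs ! i\<bar> \<Longrightarrow> m (i, k, R) = t (sgn (qs ! i) * int k) \<and>
      m (i, k, L) = t (sgn (qs ! i) * int k + 1)"
  proof (induction k)
    case 0
    then show ?case using \<open>m (i, 0, R) = _\<close> top by (simp add: tdef)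
  next
    case (Suc k)
    have seg: "(i, k, s) \<in> segments qs" "(i, Suc k, s) \<in> segments qs" for s
      using Suc.prems i by (auto simp: segments_def)
    have IH: "m (i, k, R) = t (sgn (qs ! i) * int k)" "m (i, k, L) = t (sgn (qs ! i) * int k + 1)"
      using Suc by auto
    note rel = hom_crossing_relation[OF G h i, of k, folded m_def]
    show ?case
    proof (cases "qs ! i > 0")
      case True
      have "m (i, Suc k, R) = m (i, k, L)"
        using rel[of "[((i, Suc k, R), True)]" "[((i, k, L), True)]"] Suc.prems True seg
        by (simp add: crossing_relations_def)
      moreover have "m (i, Suc k, L) = m (i, k, L) \<otimes>\<^bsub>G\<^esub> m (i, k, R) \<otimes>\<^bsub>G\<^esub> inv\<^bsub>G\<^esub> m (i, k, L)"
        using rel[of "[((i, Suc k, L), True)]"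
            "[((i, k, L), True), ((i, k, R), True), ((i, k, L), False)]"] Suc.prems True seg
        by (simp add: crossing_relations_def G.m_assoc)
      ultimately show ?thesis
        using G.twist_next[of "m (i, 0, L)" "inv\<^bsub>G\<^esub> m (j, 0, L)" "int k + 1"] True IH top
        by (simp add: tdef algebra_simps)
    next
      case False
      have neg: "qs ! i < 0" using False Suc.prems by linarith
      have "m (i, Suc k, L) = m (i, k, R)"
        using rel[of "[((i, Suc k, L), True)]" "[((i, k, R), True)]"] Suc.prems False seg
        by (simp add: crossing_relations_def)
      moreover have "m (i, Suc k, R) = inv\<^bsub>G\<^esub> m (i, k, R) \<otimes>\<^bsub>G\<^esub> m (i, k, L) \<otimes>\<^bsub>G\<^esub> m (i, k, R)"
        using rel[of "[((i, Suc k, R), True)]"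
            "[((i, k, R), False), ((i, k, L), True), ((i, k, R), True)]"] Suc.prems False seg
        by (simp add: crossing_relations_def G.m_assoc)
      ultimately show ?thesis
        using G.twist_prev[of "m (i, 0, L)" "inv\<^bsub>G\<^esub> m (j, 0, L)" "- int k"] neg IH top
        by (simp add: tdef algebra_simps minus_diff_commute[of 1 "int k"])
    qed
  qed
  then show ?thesis using s by (cases s) (auto simp: segments_def m_def t_def segment_index_def)
qed

lemma hom_closes_up:
  assumes G: "group G" and h: "h \<in> hom (pretzel_group qs) G"
  shows "closes_up G qs (top_values qs h)"
  unfolding closes_up_def
proof (intro allI impI conjI)
  fix i assume i: "i < length qs"
  define j where "j = Suc i mod length qs"
  have j: "j < length qs" using i unfolding j_def by (intro mod_less_divisor) auto
  show "top_values qs h i \<in> carrier G"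
    using segment_meridian_in_carrier[of "(i, 0, L)" qs] h i
    by (auto simp: top_values_def hom_def segments_def)
  interpret G: group G by fact
  have m: "h (segment_meridian qs (k, nat \<bar>qs ! k\<bar>, s)) \<in> carrier G" if "k < length qs" for k s
    using that segment_meridian_in_carrier[of "(k, nat \<bar>qs ! k\<bar>, s)" qs] h
    by (auto simp: hom_def segments_def)
  have "h (segment_meridian qs (i, nat \<bar>qs ! i\<bar>, R)) =
      inv\<^bsub>G\<^esub> h (segment_meridian qs (j, nat \<bar>qs ! j\<bar>, L))"
    using hom_joining_relation[OF G h i,
        of "[((i, nat \<bar>qs ! i\<bar>, R), True)]" "[((j, nat \<bar>qs ! j\<bar>, L), False)]"] m i j
    by (simp add: joining_relations_def Let_def j_def)
  then show "pretzel_arc G qs (top_values qs h) i (qs ! i) =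
      inv\<^bsub>G\<^esub> pretzel_arc G qs (top_values qs h) (Suc i mod length qs) (qs ! (Suc i mod length qs) + 1)"
    using hom_segment_meridian[OF G h, of i "nat \<bar>qs ! i\<bar>" R]
      hom_segment_meridian[OF G h, of j "nat \<bar>qs ! j\<bar>" L] i j
    by (simp add: segments_def segment_index_def sgn_mult_abs flip: j_def)
qed

text \<open>Converse to \<open>hom_closes_up\<close>: colorings of a pretzel link are the same thing as solutions of the
bottom relations.\<close>

lemma closes_up_hom_exists:
  assumes G: "group G" and x: "closes_up G qs x"
  shows "\<exists>h\<in>hom (pretzel_group qs) G. \<forall>i<length qs. top_values qs h i = x i"
proof -
  interpret G: group G by fact
  define f where "f = (\<lambda>s. pretzel_arc G qs x (fst s) (segment_index qs s))"
  have next_less: "Suc i mod length qs < length qs" if "i < length qs" for i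
    using that by (intro mod_less_divisor) auto
  have x_carr [simp]: "x i \<in> carrier G" if "i < length qs" for i
    using x that by (auto simp: closes_up_def)
  have arc: "pretzel_arc G qs x i n \<in> carrier G" if "i < length qs" for i n
    using that next_less by (simp add: pretzel_arc_def)
  have f: "f \<in> segments qs \<rightarrow> carrier G"
    using arc by (auto simp: f_def segments_def)
  have rel: "eval_word G f u = eval_word G f v"
    if uv: "(u, v) \<in> pretzel_relations qs"
      and w: "u \<in> words (segments qs)" "v \<in> words (segments qs)" for u v
  proof -
    obtain i where i: "i < length qs"
      and cases: "(\<exists>k<nat \<bar>qs ! i\<bar>. (u, v) \<in> crossing_relations qs i k) \<or> (u, v) \<in> joining_relations qs i"
      using uv by (auto simp: pretzel_relations_def)
    define j where "j = Suc i mod length qs"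
    have j: "j < length qs" "Suc j mod length qs < length qs" using next_less i by (auto simp: j_def)
    define t where "t = twist G (x i) (inv\<^bsub>G\<^esub> x j)"
    have t [simp]: "t n \<in> carrier G" for n using i j by (simp add: t_def)
    have fi: "f (i, k, s) = t (segment_index qs (i, k, s))" for k s
      by (simp add: f_def pretzel_arc_def t_def j_def)
    note t_next = G.twist_next[of "x i" "inv\<^bsub>G\<^esub> x j", folded t_def]
    note t_prev = G.twist_prev[of "x i" "inv\<^bsub>G\<^esub> x j", folded t_def]
    from cases show ?thesis
    proof (elim disjE exE conjE)
      fix k assume k: "k < nat \<bar>qs ! i\<bar>" "(u, v) \<in> crossing_relations qs i k"
      show ?thesis
      proof (cases "qs ! i > 0")
        case True
        then show ?thesis using k t_next[of "int k + 1"] i j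
          by (auto simp: crossing_relations_def fi segment_index_def G.m_assoc algebra_simps)
      next
        case False
        then have "qs ! i < 0" using k by linarith
        then show ?thesis using k t_prev[of "- int k"] i j
          by (auto simp: crossing_relations_def fi segment_index_def G.m_assoc algebra_simps
              minus_diff_commute[of 1 "int k"])
      qed
    next
      assume "(u, v) \<in> joining_relations qs i"
      then consider "u = [((i, 0, R), True)]" "v = [((j, 0, L), False)]"
        | "u = [((i, nat \<bar>qs ! i\<bar>, R), True)]" "v = [((j, nat \<bar>qs ! j\<bar>, L), False)]"
        by (auto simp: joining_relations_def Let_def j_def)
      then show ?thesis
      proof cases
        case 1
        then show ?thesis using i j by (simp add: f_def segment_index_def pretzel_arc_def flip: j_def)
      next
        case 2
        then show ?thesis using x i j arc
          by (simp add: f_def segment_index_def closes_up_def sgn_mult_abs flip: j_def)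
      qed
    qed
  qed
  define h where "h = (\<lambda>C. the_elem (eval_word G f ` C))"
  have "h \<in> hom (pretzel_group qs) G"
    unfolding h_def pretzel_group_def by (rule G.presented_hom[OF f rel])
  moreover have "top_values qs h i = x i" if i: "i < length qs" for i
  proof -
    have "top_values qs h i = eval_word G f [((i, 0, L), True)]"
      unfolding top_values_def h_def segment_meridian_def generator_def
      by (rule G.presented_hom_eval[OF f rel]) (use i in \<open>auto simp: segments_def\<close>)
    then show ?thesis
      using i next_less[OF i] by (simp add: f_def pretzel_arc_def segment_index_def)
  qed
  ultimately show ?thesis by blast
qed

lemma pretzel_homs_eqI:
  assumes G: "group G" and h: "h \<in> hom (pretzel_group qs) G" "h' \<in> hom (pretzel_group qs) G"
    and eq: "\<And>i. i < length qs \<Longrightarrow> top_values qs h i = top_values qs h' i"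
    and C: "C \<in> carrier (pretzel_group qs)"
  shows "h C = h' C"
proof (rule presented_homs_eqI[OF G])
  fix s :: segment assume s: "s \<in> segments qs"
  obtain i k d where ikd: "s = (i, k, d)" by (cases s)
  then have i: "i < length qs" using s by (simp add: segments_def)
  then have "Suc i mod length qs < length qs" by (intro mod_less_divisor) auto
  then have "pretzel_arc G qs (top_values qs h) i = pretzel_arc G qs (top_values qs h') i"
    using eq i by (simp add: pretzel_arc_def)
  then show "h (generator (segments qs) (pretzel_relations qs) s) =
      h' (generator (segments qs) (pretzel_relations qs) s)"
    using hom_segment_meridian[OF G h(1)] hom_segment_meridian[OF G h(2)] s
    by (simp add: ikd flip: segment_meridian_def)
qed (use h C in \<open>simp_all add: pretzel_group_def\<close>)

text \<open>All members of a sequence \<open>twist\<close> are conjugate to one of its top members, so a condition on meridians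
that is invariant under conjugation and inversion only has to be checked at the top.\<close>

lemma hom_meridian_in_normal_set:
  assumes G: "group G" and h: "h \<in> hom (pretzel_group qs) G"
    and V: "V \<subseteq> carrier G" "\<And>v. v \<in> V \<Longrightarrow> inv\<^bsub>G\<^esub> v \<in> V"
      "\<And>g v. g \<in> carrier G \<Longrightarrow> v \<in> V \<Longrightarrow> g \<otimes>\<^bsub>G\<^esub> v \<otimes>\<^bsub>G\<^esub> inv\<^bsub>G\<^esub> g \<in> V"
    and x: "\<And>i. i < length qs \<Longrightarrow> top_values qs h i \<in> V"
    and m: "m \<in> meridians qs"
  shows "h m \<in> V"
proof -
  interpret G: group G by fact
  interpret P: group "pretzel_group qs" by (rule group_pretzel_group)
  interpret h: group_hom "pretzel_group qs" G h
    using G h by (simp add: group_hom_def group_hom_axioms_def P.group_axioms)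
  obtain s g y where s: "s \<in> segments qs" and g: "g \<in> carrier (pretzel_group qs)"
    and y: "y \<in> {segment_meridian qs s, inv\<^bsub>pretzel_group qs\<^esub> segment_meridian qs s}"
    and m: "m = g \<otimes>\<^bsub>pretzel_group qs\<^esub> y \<otimes>\<^bsub>pretzel_group qs\<^esub> inv\<^bsub>pretzel_group qs\<^esub> g"
    using m unfolding meridians_def conjugates_pm_def by blast
  obtain i k d where ikd: "s = (i, k, d)" by (cases s)
  then have i: "i < length qs" using s by (simp add: segments_def)
  then have j: "Suc i mod length qs < length qs" by (intro mod_less_divisor) auto
  have tw: "twist G u v n \<in> V" if "u \<in> V" "v \<in> V" for u v n
    using that V by (auto simp: twist_def Let_def subset_iff)
  have sm: "segment_meridian qs s \<in> carrier (pretzel_group qs)"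
    using s by (rule segment_meridian_in_carrier)
  have "h (segment_meridian qs s) \<in> V"
    using hom_segment_meridian[OF G h, of i k d] s ikd tw x i j V by (simp add: pretzel_arc_def)
  then have "h y \<in> V" and "y \<in> carrier (pretzel_group qs)" using y V sm by auto
  then show ?thesis using V(3)[of "h g" "h y"] g by (simp add: m)
qed

section \<open>Two Diophantine equations\<close>

text \<open>If \<open>a / b + b / a\<close> or \<open>a / b - b / a\<close> is an integer, then the coprime parts of \<open>a\<close> and \<open>b\<close> divide each
other's squares.\<close>

lemma dvd_sum_or_diff_squares_imp_eq:
  fixes a b :: int
  assumes pos: "a > 0" "b > 0" and "a * b dvd a\<^sup>2 + b\<^sup>2 \<or> a * b dvd a\<^sup>2 - b\<^sup>2"
  shows "a = b"
proof -
  define g where "g = gcd a b"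
  obtain a' b' where ab: "a = a' * g" "b = b' * g" "coprime a' b'"
    using gcd_coprime_exists[of a b] pos g_def by (metis gcd_eq_0_iff less_irrefl)
  have g: "g > 0" unfolding g_def using pos by (simp add: gcd_pos_int)
  have pos': "a' > 0" "b' > 0" using pos ab g by (simp_all add: zero_less_mult_iff)
  have "a' * b' dvd a'\<^sup>2 + b'\<^sup>2 \<or> a' * b' dvd a'\<^sup>2 - b'\<^sup>2"
  proof -
    have "a * b = g\<^sup>2 * (a' * b')" "a\<^sup>2 + b\<^sup>2 = g\<^sup>2 * (a'\<^sup>2 + b'\<^sup>2)" "a\<^sup>2 - b\<^sup>2 = g\<^sup>2 * (a'\<^sup>2 - b'\<^sup>2)"
      by (simp_all add: ab power2_eq_square algebra_simps)
    then show ?thesis using assms(3) g by simp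
  qed
  then have "a' dvd b'\<^sup>2 \<and> b' dvd a'\<^sup>2"
  proof
    assume "a' * b' dvd a'\<^sup>2 + b'\<^sup>2"
    then have "a' dvd a'\<^sup>2 + b'\<^sup>2" "b' dvd a'\<^sup>2 + b'\<^sup>2" by (auto dest: dvd_mult_left dvd_mult_right)
    then show ?thesis by (simp add: dvd_add_right_iff dvd_add_left_iff power2_eq_square)
  next
    assume "a' * b' dvd a'\<^sup>2 - b'\<^sup>2"
    then have "a' dvd a'\<^sup>2 - b'\<^sup>2" "b' dvd a'\<^sup>2 - b'\<^sup>2" by (auto dest: dvd_mult_left dvd_mult_right)
    then show ?thesis by (simp add: dvd_diff_right_iff dvd_diff_left_iff power2_eq_square)
  qed
  then have "is_unit a'" "is_unit b'"
    using ab(3) by (metis coprime_power_right_iff coprime_absorb_left coprime_commute)+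
  then show ?thesis using ab pos' by simp
qed

text \<open>By Heron's formula the second factor on the left of \<open>eq\<close> is negative for the sides of a proper triangle,
so for \<open>C \<ge> 2\<close> there is no such triangle and \<open>c \<ge> a + b\<close>. Cancelling \<open>c^2\<close> leaves \<open>D^2 * E = (2 * a * b)^2\<close>
with a positive integer \<open>E\<close>, whereas \<open>D > c^2 \<ge> 4 * a * b\<close> unless \<open>D = 1\<close>. In that case \<open>eq\<close> becomes the
equation \<open>c^2 = a^2 + b^2 + a * b * c\<close> of Markov type, and since \<open>a\<close> and \<open>b\<close> divide \<open>c\<close> it has a single solution.\<close>

lemma odd_diophantine_max:
  fixes a b c A B D C :: int
  assumes pos: "a > 0" "b > 0" "c > 0" "A > 0" "B > 0" "D > 0"
    and C: "C = a * A" "C = b * B" "C = c * D"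
    and D: "D = 1 \<or> D \<ge> c\<^sup>2 + 1"
    and eq: "C\<^sup>2 * ((a\<^sup>2 + b\<^sup>2 - c\<^sup>2)\<^sup>2 - 4 * a\<^sup>2 * b\<^sup>2) = (a * b * c)\<^sup>2 * (C\<^sup>2 - 4)"
    and max: "a \<le> c" "b \<le> c"
  shows "(a = 1 \<and> b = 1 \<and> c = 1 \<and> C = 1) \<or> (a = 1 \<and> b = 1 \<and> c = 2 \<and> C = 2)"
proof (cases "C = 1")
  case True
  then show ?thesis using C pos by (metis pos_zmult_eq_1_iff)
next
  case False
  have C2: "C \<ge> 2" using False C(1) pos by (metis int_one_le_iff_zero_less zero_less_mult_iff
        add1_zle_eq le_less one_add_one)
  define E where "E = (a * b * c)\<^sup>2 - ((a\<^sup>2 + b\<^sup>2 - c\<^sup>2)\<^sup>2 - 4 * a\<^sup>2 * b\<^sup>2)"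
  have "C\<^sup>2 * E = 4 * (a * b * c)\<^sup>2" using eq unfolding E_def by (simp add: algebra_simps)
  then have "c\<^sup>2 * (D\<^sup>2 * E) = c\<^sup>2 * (4 * a\<^sup>2 * b\<^sup>2)"
    unfolding C(3) by (simp add: power_mult_distrib algebra_simps)
  then have E: "D\<^sup>2 * E = 4 * a\<^sup>2 * b\<^sup>2" using pos by simp
  have "c \<ge> a + b"
  proof (rule ccontr)
    assume "\<not> c \<ge> a + b"
    then have "0 < (a + b + c) * (b + c - a) * (a + c - b) * (a + b - c)"
      using pos max by simp
    also have "\<dots> = - ((a\<^sup>2 + b\<^sup>2 - c\<^sup>2)\<^sup>2 - 4 * a\<^sup>2 * b\<^sup>2)"
      by (simp add: power2_eq_square algebra_simps)
    finally have "C\<^sup>2 * ((a\<^sup>2 + b\<^sup>2 - c\<^sup>2)\<^sup>2 - 4 * a\<^sup>2 * b\<^sup>2) < 0"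
      using C2 by (simp add: mult_less_0_iff)
    moreover have "C\<^sup>2 \<ge> 4" using power_mono[of 2 C 2] C2 by simp
    ultimately show False using eq by (simp add: mult_less_0_iff) 
  qed
  then have c2: "c\<^sup>2 \<ge> (a + b)\<^sup>2" using pos by (intro power_mono) auto
  \<comment> \<open>Otherwise \<open>D\<close> is too large for its square to divide \<open>(2 * a * b)^2\<close>.\<close>
  have "D = 1"
  proof (rule ccontr)
    assume "D \<noteq> 1"
    then have "D \<ge> (a + b)\<^sup>2 + 1" using D c2 by linarith
    moreover have "(a + b)\<^sup>2 \<ge> 4 * (a * b)"
      using zero_le_power2[of "a - b"] by (simp add: power2_eq_square algebra_simps)
    moreover have "a * b > 0" using pos by simp
    ultimately have "D > 2 * (a * b)" by linarith
    then have "D\<^sup>2 > (2 * (a * b))\<^sup>2" using pos by (intro power_strict_mono) auto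
    then have lt: "D\<^sup>2 > 4 * a\<^sup>2 * b\<^sup>2" by (simp add: power_mult_distrib)
    have "D\<^sup>2 * E > 0" unfolding E using pos by simp
    then have "E \<ge> 1" using pos by (simp add: zero_less_mult_iff)
    then have "D\<^sup>2 * E \<ge> D\<^sup>2" using mult_left_mono[of 1 E "D\<^sup>2"] by simp
    then show False using lt E by linarith
  qed
  then have "(c\<^sup>2 - a\<^sup>2 - b\<^sup>2)\<^sup>2 = (a * b * c)\<^sup>2"
    using E unfolding E_def by (simp add: power2_eq_square algebra_simps)
  moreover have "c\<^sup>2 - a\<^sup>2 - b\<^sup>2 \<ge> 0"
  proof -
    have "(a + b)\<^sup>2 = a\<^sup>2 + b\<^sup>2 + 2 * (a * b)" by (simp add: power2_sum)
    moreover have "a * b > 0" using pos by simp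
    ultimately show ?thesis using c2 by linarith
  qed
  ultimately have "c\<^sup>2 - a\<^sup>2 - b\<^sup>2 = a * b * c" using pos by (simp add: power2_eq_iff_nonneg)
  then have vieta: "c\<^sup>2 = a\<^sup>2 + b\<^sup>2 + a * b * c" by simp
  have cAB: "c = a * A" "c = b * B" using C \<open>D = 1\<close> by simp_all
  \<comment> \<open>The equation multiplied by \<open>(A * B)^2\<close>, rewritten with \<open>a * A = b * B = c\<close>.\<close>
  have "c\<^sup>2 * (A\<^sup>2 * B\<^sup>2) = c\<^sup>2 * (B\<^sup>2 + A\<^sup>2 + c * (A * B))"
  proof -
    have a2: "a\<^sup>2 * (A\<^sup>2 * B\<^sup>2) = c\<^sup>2 * B\<^sup>2" by (simp add: cAB(1) power_mult_distrib)
    have b2: "b\<^sup>2 * (A\<^sup>2 * B\<^sup>2) = c\<^sup>2 * A\<^sup>2" by (simp add: cAB(2) power_mult_distrib)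
    have "a * b * (A\<^sup>2 * B\<^sup>2) = (a * A) * (b * B) * (A * B)"
      by (simp add: power2_eq_square)
    then have ab: "a * b * (A\<^sup>2 * B\<^sup>2) = c\<^sup>2 * (A * B)"
      by (simp add: cAB[symmetric] power2_eq_square)
    have exp: "c\<^sup>2 * (A\<^sup>2 * B\<^sup>2) = a\<^sup>2 * (A\<^sup>2 * B\<^sup>2) + b\<^sup>2 * (A\<^sup>2 * B\<^sup>2) + c * (a * b * (A\<^sup>2 * B\<^sup>2))"
      by (subst vieta) (simp add: algebra_simps)
    show ?thesis unfolding exp a2 b2 ab by (simp add: algebra_simps)
  qed
  then have AB: "A\<^sup>2 * B\<^sup>2 = B\<^sup>2 + A\<^sup>2 + c * (A * B)" using pos by simp
  then have "A\<^sup>2 + B\<^sup>2 = (A * B) * (A * B - c)" by (simp add: power2_eq_square algebra_simps)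
  then have "A = B" by (intro dvd_sum_or_diff_squares_imp_eq pos) (metis dvd_triv_left)
  then have "A * A * (A * A) = A * A * (2 + c)" using AB by (simp add: power2_eq_square algebra_simps)
  then have "A * A = 2 + a * A" using pos cAB by simp
  then have "A * (A - a) = 2" by (simp add: algebra_simps)
  then have "A dvd 2" by (metis dvd_triv_left)
  then have "A \<le> 2" by (simp add: zdvd_imp_le)
  then have "A = 1 \<or> A = 2" using pos by linarith
  then have "A = 2 \<and> a = 1" using \<open>A * (A - a) = 2\<close> pos by auto
  then show ?thesis using cAB \<open>A = B\<close> C \<open>D = 1\<close> by auto
qed

lemma odd_diophantine:
  fixes a b c A B D C :: int
  assumes pos: "a > 0" "b > 0" "c > 0" "A > 0" "B > 0" "D > 0"
    and C: "C = a * A" "C = b * B" "C = c * D"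
    and AD: "A = 1 \<or> A \<ge> a\<^sup>2 + 1" "B = 1 \<or> B \<ge> b\<^sup>2 + 1" "D = 1 \<or> D \<ge> c\<^sup>2 + 1"
    and eq: "C\<^sup>2 * ((a\<^sup>2 + b\<^sup>2 - c\<^sup>2)\<^sup>2 - 4 * a\<^sup>2 * b\<^sup>2) = (a * b * c)\<^sup>2 * (C\<^sup>2 - 4)"
  shows "(C = 1 \<and> (a, b, c) = (1, 1, 1)) \<or> (C = 2 \<and> (a, b, c) \<in> {(1, 1, 2), (1, 2, 1), (2, 1, 1)})"
proof -
  have eqs: "C\<^sup>2 * ((a\<^sup>2 + c\<^sup>2 - b\<^sup>2)\<^sup>2 - 4 * a\<^sup>2 * c\<^sup>2) = (a * c * b)\<^sup>2 * (C\<^sup>2 - 4)"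
    "C\<^sup>2 * ((b\<^sup>2 + c\<^sup>2 - a\<^sup>2)\<^sup>2 - 4 * b\<^sup>2 * c\<^sup>2) = (b * c * a)\<^sup>2 * (C\<^sup>2 - 4)"
    using eq by (simp_all add: power2_eq_square algebra_simps)
  consider "a \<le> c" "b \<le> c" | "a \<le> b" "c \<le> b" | "b \<le> a" "c \<le> a" by linarith
  then show ?thesis
  proof cases
    case 1
    then show ?thesis using odd_diophantine_max[OF pos C AD(3) eq] by auto
  next
    case 2
    then show ?thesis
      using odd_diophantine_max[of a c b A D B C, OF pos(1,3,2,4,6,5) C(1,3,2) AD(2) eqs(1)] by auto
  next
    case 3
    then show ?thesis
      using odd_diophantine_max[of b c a B D A C, OF pos(2,3,1,5,6,4) C(2,3,1) AD(1) eqs(2)] by auto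
  qed
qed

text \<open>Again \<open>C^2 * E = 4 * (a * b * c)^2\<close> with a positive integer \<open>E\<close>, which bounds \<open>A\<close> by \<open>2 * b * c\<close> and \<open>c^2\<close>
by about \<open>2 * a * b\<close>. If \<open>A = a\<close>, then \<open>b * c = a * f\<close> with \<open>f\<close> odd and \<open>E = 4 * f^2\<close>; \<open>f = 1\<close> contradicts the
equation at once, and for \<open>f \<ge> 3\<close> the term \<open>X * Y * Z\<close> is too large. Otherwise \<open>a^3 \<le> 2 * b * c\<close> keeps \<open>a\<close> so
small that again \<open>X * Y * Z\<close> dominates, except for a few values that are excluded one by one.\<close>

lemma even_diophantine_no_unit:
  fixes a b c A B D C :: int
  assumes pos: "a > 0" "b \<ge> 2" "c \<ge> 2" "A > 0" "B > 0" "D > 0"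
    and C: "C = a * A" "C = b * B" "C = c * D"
    and A: "A = a \<or> A \<ge> a * (a\<^sup>2 + 2)" and "odd a"
    and BD: "B \<ge> b\<^sup>2 - 1" "D \<ge> c\<^sup>2 - 1" "even c \<Longrightarrow> odd D"
    and eq: "C\<^sup>2 * ((a\<^sup>2 + b\<^sup>2 + c\<^sup>2)\<^sup>2 - 4 * b\<^sup>2 * c\<^sup>2 - (a * b * c)\<^sup>2) = 4 * (a * b * c)\<^sup>2"
    and le: "b \<le> c"
  shows False
proof -
  define E where "E = (a\<^sup>2 + b\<^sup>2 + c\<^sup>2)\<^sup>2 - 4 * b\<^sup>2 * c\<^sup>2 - (a * b * c)\<^sup>2"
  define X Y Z where "X = a\<^sup>2" and "Y = b\<^sup>2" and "Z = c\<^sup>2"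
  have XYZ: "X > 0" "Y \<ge> 4" "Z \<ge> 4" "Y \<le> Z"
    using pos power_mono[of 2 b 2] power_mono[of 2 c 2] power_mono[of b c 2] le
    by (simp_all add: X_def Y_def Z_def)
  have Eeq: "X * X + 2 * X * (Y + Z) + (Z - Y)\<^sup>2 = X * Y * Z + E"
    by (simp add: E_def X_def Y_def Z_def power2_eq_square algebra_simps)
  have CE: "C\<^sup>2 * E = 4 * (a * b * c)\<^sup>2" using eq E_def by simp
  then have "c\<^sup>2 * (D\<^sup>2 * E) = c\<^sup>2 * (2 * (a * b))\<^sup>2"
    unfolding C(3) by (simp add: power_mult_distrib algebra_simps)
  then have ED: "D\<^sup>2 * E = (2 * (a * b))\<^sup>2" using pos by simp
  have "a\<^sup>2 * (A\<^sup>2 * E) = a\<^sup>2 * (2 * (b * c))\<^sup>2"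
    using CE unfolding C(1) by (simp add: power_mult_distrib algebra_simps)
  then have EA: "A\<^sup>2 * E = (2 * (b * c))\<^sup>2" using pos by simp
  have "D\<^sup>2 * E > 0" unfolding ED using pos by simp
  then have E1: "E \<ge> 1" using pos by (simp add: zero_less_mult_iff)
  have "D\<^sup>2 \<le> (2 * (a * b))\<^sup>2" unfolding ED[symmetric] using mult_left_mono[OF E1, of "D\<^sup>2"] by simp
  then have "D \<le> 2 * (a * b)" by (rule power2_le_imp_le) (use pos in simp)
  then have Zle: "Z \<le> 2 * (a * b) + 1" using BD(2) by (simp add: Z_def)
  have "A\<^sup>2 \<le> (2 * (b * c))\<^sup>2" unfolding EA[symmetric] using mult_left_mono[OF E1, of "A\<^sup>2"] by simp
  then have Ale: "A \<le> 2 * (b * c)" by (rule power2_le_imp_le) (use pos in simp)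
  show False
  proof (cases "A = a")
    case True
    \<comment> \<open>With \<open>a\<close> odd, \<open>A = a\<close> makes all three numbers odd, so \<open>f = 2\<close> does not occur.\<close>
    have "a\<^sup>2 dvd (2 * (b * c))\<^sup>2" using EA True by (metis dvd_triv_left)
    then have "a dvd 2 * (b * c)" by (rule iffD1[OF pow_divides_pow_iff, rotated]) simp
    then have "a dvd b * c" using \<open>odd a\<close> by (simp add: coprime_dvd_mult_right_iff)
    then obtain f where f: "b * c = a * f" by blast
    have "odd (a * a)" using \<open>odd a\<close> by simp
    then have odd_bc: "odd b" "odd c" using C True by (metis even_mult_iff)+
    then have bc3: "b \<ge> 3" "c \<ge> 3" using pos by presburger+
    have "odd f" using f odd_bc by (metis even_mult_iff)
    have "f > 0" using f pos by (smt (verit) mult_pos_pos zero_less_mult_iff)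
    have "a\<^sup>2 * E = a\<^sup>2 * (4 * f\<^sup>2)" using EA unfolding f True by (simp add: power_mult_distrib)
    then have Ef: "E = 4 * f\<^sup>2" using pos by simp
    have YZ: "Y * Z = X * f\<^sup>2"
      using f by (simp add: X_def Y_def Z_def power_mult_distrib[symmetric])
    have "Y \<ge> 9" "Z \<ge> 9" using bc3 power_mono[of 3 b 2] power_mono[of 3 c 2] by (simp_all add: Y_def Z_def)
    show False
    proof (cases "f = 1")
      case True
      then have "2 * (X * (Y + Z)) + (Z - Y)\<^sup>2 = 4" using Eeq YZ Ef by (simp add: algebra_simps)
      then have "X * (Y + Z) \<le> 2" using zero_le_power2[of "Z - Y"] by linarith
      moreover have "1 * (Y + Z) \<le> X * (Y + Z)" using XYZ by (intro mult_right_mono) auto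
      ultimately have "Y + Z \<le> 2" by simp
      then show False using XYZ by linarith
    next
      case False
      then have "f \<ge> 3" using \<open>f > 0\<close> \<open>odd f\<close> by presburger
      then have "f\<^sup>2 \<ge> 9" using power_mono[of 3 f 2] by simp
      then have X9: "9 * X \<le> Y * Z" using YZ mult_left_mono[of 9 "f\<^sup>2" X] XYZ by simp
      have "X = c * D" using C True by (simp add: X_def power2_eq_square)
      then have "X \<ge> c * (Z - 1)" using BD(2) pos by (simp add: Z_def mult_left_mono)
      moreover have "3 * (c * (Z - 1)) \<ge> 8 * Z"
      proof -
        have "c * ((c - 3) * (3 * c + 1)) \<ge> 0" using bc3 by simp
        then show ?thesis by (simp add: Z_def power2_eq_square algebra_simps)
      qed
      ultimately have X8: "3 * X \<ge> 8 * Z" by linarith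
      have "(Z - Y)\<^sup>2 \<le> Z * Z" using XYZ by (simp add: power2_eq_square mult_mono)
      then have "8 * (Z - Y)\<^sup>2 \<le> 3 * X * Z" using mult_right_mono[OF X8, of Z] XYZ by linarith
      have "u + v = w + E \<Longrightarrow> 8 * v \<le> x \<Longrightarrow> 8 * w \<le> 8 * u + x" for u v w x :: int
        using E1 by linarith
      from this[OF Eeq \<open>8 * (Z - Y)\<^sup>2 \<le> 3 * X * Z\<close>]
      have "8 * (X * X + 2 * X * (Y + Z)) + 3 * X * Z \<ge> 8 * (X * Y * Z)" .
      then have "X * (8 * (Y * Z)) \<le> X * (8 * X + 16 * Y + 19 * Z)" by (simp add: algebra_simps)
      then have a: "8 * (Y * Z) \<le> 8 * X + 16 * Y + 19 * Z" using XYZ(1) by (rule mult_left_le_imp_le)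
      have b: "9 * Z \<le> Y * Z" using \<open>Y \<ge> 9\<close> XYZ by (intro mult_right_mono) auto
      have "8 * w \<le> 8 * X + 16 * Y + 19 * Z \<Longrightarrow> 9 * Z \<le> w \<Longrightarrow> 9 * X \<le> w \<Longrightarrow> False" for w
        using XYZ(3,4) by linarith
      from this[OF a b X9] show False .
    qed
  next
    case False
    then have "a * (a\<^sup>2 + 2) \<le> 2 * (b * c)" using A Ale by linarith
    then have a3: "a * X + 2 * a \<le> 2 * (b * c)" by (simp add: X_def algebra_simps)
    have bcZ: "b * c \<le> Z" using le pos by (simp add: Z_def power2_eq_square mult_right_mono)
    show False
    proof (cases "a = 1")
      case True
      then have "c * c \<le> 2 * c + 1" using Zle le by (simp add: Z_def power2_eq_square)
      moreover have "c \<ge> 3 \<Longrightarrow> c * c \<ge> 3 * c" by (intro mult_right_mono) auto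
      ultimately have "c < 3" by linarith
      then have "b = 2" "c = 2" using pos le by auto
      then have "E = 1" using True by (simp add: E_def)
      then have "D\<^sup>2 = 4\<^sup>2" using ED True \<open>b = 2\<close> by simp
      then have "D = 4" by (rule power2_eq_imp_eq) (use pos in simp_all)
      then show False using BD(3) \<open>c = 2\<close> by simp
    next
      case False
      then have "a \<ge> 3" using \<open>odd a\<close> pos by presburger
      then have aX: "a * X \<ge> 3 * X" "X \<ge> 9"
        using XYZ power_mono[of 3 a 2] by (simp_all add: X_def mult_right_mono)
      have "Z - Y \<le> 2 * (a * b)" using Zle XYZ by linarith
      then have "(Z - Y)\<^sup>2 \<le> (2 * (a * b))\<^sup>2" using XYZ by (intro power_mono) auto
      then have "(Z - Y)\<^sup>2 \<le> 4 * X * Y" by (simp add: X_def Y_def power_mult_distrib)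
      then have "X * (Y * Z) \<le> X * (X + 6 * Y + 2 * Z)" using Eeq E1 by (simp add: algebra_simps)
      then have "Y * Z \<le> X + 6 * Y + 2 * Z" using XYZ(1) by (rule mult_left_le_imp_le)
      moreover have "3 * X \<le> 2 * Z" using aX a3 bcZ \<open>a \<ge> 3\<close> by linarith
      ultimately have main: "3 * (Y * Z) \<le> 8 * Z + 18 * Y" by linarith
      show False
      proof (cases "b = 2")
        case True
        then have "Y = 4" by (simp add: Y_def)
        then have "Z \<le> 18" using main by simp
        then have "c < 5" using power_mono[of 5 c 2] by (force simp: Z_def)
        moreover have "a * X + 2 * a \<le> 2 * (2 * c)" using a3 unfolding True .
        ultimately show False using aX \<open>a \<ge> 3\<close> by linarith
      next
        case False
        then have "Y \<ge> 9" using pos power_mono[of 3 b 2] by (simp add: Y_def)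
        then have "Y * Z \<ge> 9 * Z" using XYZ by (intro mult_right_mono) auto
        then show False using main XYZ by linarith
      qed
    qed
  qed
qed

text \<open>Here \<open>C = c\<close> turns the equation into \<open>a^2 + c^2 - b^2 = a * b * c\<close> with \<open>a\<close> and \<open>b\<close> dividing \<open>c\<close>, which forces
\<open>a = b\<close> and \<open>c = b^2\<close>, so that \<open>B = b\<close> is smaller than allowed.\<close>

lemma even_diophantine_one_unit:
  fixes a b c A B C :: int
  assumes pos: "a > 0" "b \<ge> 2" "c > 0" "A > 0" "B > 0"
    and C: "C = a * A" "C = b * B" "C = c"
    and B: "B \<ge> b\<^sup>2 - 1"
    and eq: "C\<^sup>2 * ((a\<^sup>2 + b\<^sup>2 + c\<^sup>2)\<^sup>2 - 4 * b\<^sup>2 * c\<^sup>2 - (a * b * c)\<^sup>2) = 4 * (a * b * c)\<^sup>2"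
  shows False
proof -
  have cA: "c = a * A" "c = b * B" using C by simp_all
  have "c\<^sup>2 * ((a\<^sup>2 + b\<^sup>2 + c\<^sup>2)\<^sup>2 - 4 * b\<^sup>2 * c\<^sup>2 - (a * b * c)\<^sup>2) = c\<^sup>2 * (4 * a\<^sup>2 * b\<^sup>2)"
    using eq C(3) by (simp add: power_mult_distrib mult.assoc)
  then have "(a\<^sup>2 + b\<^sup>2 + c\<^sup>2)\<^sup>2 - 4 * b\<^sup>2 * c\<^sup>2 - (a * b * c)\<^sup>2 = 4 * a\<^sup>2 * b\<^sup>2" using pos by simp
  then have "(a\<^sup>2 + c\<^sup>2 - b\<^sup>2)\<^sup>2 = (a * b * c)\<^sup>2" by (simp add: power2_eq_square algebra_simps)
  moreover have "b \<le> c" using cA(2) pos mult_left_mono[of 1 B b] by simp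
  then have "b\<^sup>2 \<le> c\<^sup>2" using pos by (intro power_mono) auto
  then have "0 \<le> a\<^sup>2 + c\<^sup>2 - b\<^sup>2" using zero_le_power2[of a] by linarith
  ultimately have "a\<^sup>2 + c\<^sup>2 - b\<^sup>2 = a * b * c" by (rule power2_eq_imp_eq) (use pos in simp)
  then have vieta: "c\<^sup>2 = a * b * c - a\<^sup>2 + b\<^sup>2" by simp
  have "c\<^sup>2 * (A\<^sup>2 * B\<^sup>2) = c\<^sup>2 * (c * (A * B) - B\<^sup>2 + A\<^sup>2)"
  proof -
    have a2: "a\<^sup>2 * (A\<^sup>2 * B\<^sup>2) = c\<^sup>2 * B\<^sup>2" by (simp add: cA(1) power_mult_distrib)
    have b2: "b\<^sup>2 * (A\<^sup>2 * B\<^sup>2) = c\<^sup>2 * A\<^sup>2" by (simp add: cA(2) power_mult_distrib)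
    have "a * b * (A\<^sup>2 * B\<^sup>2) = (a * A) * (b * B) * (A * B)"
      by (simp add: power2_eq_square)
    then have ab: "a * b * (A\<^sup>2 * B\<^sup>2) = c\<^sup>2 * (A * B)"
      by (simp add: cA[symmetric] power2_eq_square)
    have exp: "c\<^sup>2 * (A\<^sup>2 * B\<^sup>2) = c * (a * b * (A\<^sup>2 * B\<^sup>2)) - a\<^sup>2 * (A\<^sup>2 * B\<^sup>2) + b\<^sup>2 * (A\<^sup>2 * B\<^sup>2)"
      by (subst vieta) (simp add: algebra_simps)
    show ?thesis unfolding exp a2 b2 ab by (simp add: algebra_simps)
  qed
  then have AB: "A\<^sup>2 * B\<^sup>2 = c * (A * B) - B\<^sup>2 + A\<^sup>2" using pos by simp
  then have "A\<^sup>2 - B\<^sup>2 = (A * B) * (A * B - c)" by (simp add: power2_eq_square algebra_simps)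
  then have "A = B" by (intro dvd_sum_or_diff_squares_imp_eq pos) (metis dvd_triv_left)
  then have "A * A * (A * A) = A * A * c" using AB by (simp add: power2_eq_square algebra_simps)
  then have "A * A = c" using pos by simp
  then have "b = B" using cA \<open>A = B\<close> pos by simp
  then have "b * b - 1 \<le> b" using B by (simp add: power2_eq_square)
  moreover have "b * b \<ge> 2 * b" using pos by (intro mult_right_mono) auto
  ultimately show False using pos by linarith
qed

lemma even_diophantine:
  fixes a b c A B D C :: int
  assumes pos: "a > 0" "b > 0" "c > 0" "A > 0" "B > 0" "D > 0"
    and C: "C = a * A" "C = b * B" "C = c * D"
    and A: "A = a \<or> A \<ge> a * (a\<^sup>2 + 2)" and "odd a"
    and B: "b = 1 \<Longrightarrow> B = 1" "b \<ge> 2 \<Longrightarrow> B = 1 \<or> B \<ge> b\<^sup>2 - 1" "even b \<Longrightarrow> odd B"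
    and D: "c = 1 \<Longrightarrow> D = 1" "c \<ge> 2 \<Longrightarrow> D = 1 \<or> D \<ge> c\<^sup>2 - 1" "even c \<Longrightarrow> odd D"
    and eq: "C\<^sup>2 * ((a\<^sup>2 + b\<^sup>2 + c\<^sup>2)\<^sup>2 - 4 * b\<^sup>2 * c\<^sup>2 - (a * b * c)\<^sup>2) = 4 * (a * b * c)\<^sup>2"
  shows "a = 1 \<and> b = 1 \<and> c = 1 \<and> C = 1"
proof (cases "b = 1 \<or> c = 1")
  case True
  then have "C = 1" using B(1) D(1) C by auto
  then show ?thesis using C pos by (metis pos_zmult_eq_1_iff)
next
  case False
  then have bc: "b \<ge> 2" "c \<ge> 2" using pos by auto
  have eq': "C\<^sup>2 * ((a\<^sup>2 + c\<^sup>2 + b\<^sup>2)\<^sup>2 - 4 * c\<^sup>2 * b\<^sup>2 - (a * c * b)\<^sup>2) = 4 * (a * c * b)\<^sup>2"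
    using eq by (simp add: power2_eq_square algebra_simps)
  consider "B = 1" "D = 1" | "B \<ge> b\<^sup>2 - 1" "D = 1" | "B = 1" "D \<ge> c\<^sup>2 - 1"
    | "B \<ge> b\<^sup>2 - 1" "D \<ge> c\<^sup>2 - 1" using B(2) D(2) bc by blast
  then have False
  proof cases
    case 1
    then have Cbc: "C = b" "c = b" using C by simp_all
    have "(b\<^sup>2 * a\<^sup>2) * a\<^sup>2 = (b\<^sup>2 * a\<^sup>2) * (b\<^sup>2)\<^sup>2"
      using eq by (simp add: Cbc power2_eq_square algebra_simps)
    then have "a\<^sup>2 = (b\<^sup>2)\<^sup>2" using pos by simp
    then have "a = b\<^sup>2" by (rule power2_eq_imp_eq) (use pos in simp_all)
    moreover have "a * 1 \<le> a * A" using pos by (intro mult_left_mono) auto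
    moreover have "b * 2 \<le> b * b" using bc by (intro mult_left_mono) auto
    ultimately show False using C Cbc pos by (simp add: power2_eq_square)
  next
    case 2
    then show False using even_diophantine_one_unit[of a b c A B C] pos bc C eq by simp
  next
    case 3
    then show False using even_diophantine_one_unit[of a c b A D C] pos bc C eq' by simp
  next
    case 4
    then show False
    proof (cases "b \<le> c")
      case True
      then show False
        using even_diophantine_no_unit[of a b c A B D C] pos bc C A \<open>odd a\<close> 4 D(3) eq by simp
    next
      case False
      then show False
        using even_diophantine_no_unit[of a c b A D B C] pos bc C A \<open>odd a\<close> 4 B(3) eq' by simp
    qed
  qed
  then show ?thesis ..
qed

section \<open>Chebyshev numbers\<close>

text \<open>The value at \<open>t / 2\<close> of the Chebyshev polynomial of the second kind of degree \<open>n - 1\<close>. These numbers are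
the coefficients of the powers of a matrix of determinant 1 and trace \<open>t\<close>. For \<open>t = k^2 + 2\<close> the numbers
\<open>k * cheb t m\<close> and \<open>cheb_diff t m\<close> are the Fibonacci polynomials in \<open>k\<close> of index \<open>2 * m\<close> and \<open>2 * m + 1\<close>.\<close>

fun cheb_nat :: "int \<Rightarrow> nat \<Rightarrow> int" where
  "cheb_nat t 0 = 0"
| "cheb_nat t (Suc 0) = 1"
| "cheb_nat t (Suc (Suc n)) = t * cheb_nat t (Suc n) - cheb_nat t n"

definition cheb :: "int \<Rightarrow> int \<Rightarrow> int" where
  "cheb t m = (if m \<ge> 0 then cheb_nat t (nat m) else - cheb_nat t (nat (- m)))"

lemma cheb_0 [simp]: "cheb t 0 = 0" and cheb_1 [simp]: "cheb t 1 = 1"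
  by (simp_all add: cheb_def)

lemma cheb_minus: "cheb t (- m) = - cheb t m"
  by (simp add: cheb_def)

lemma cheb_reflect: "cheb t (- m - 1) = - cheb t (m + 1)"
  using cheb_minus[of t "m + 1"] by simp

lemma cheb_rec: "cheb t (m + 1) = t * cheb t m - cheb t (m - 1)"
proof -
  have nonneg: "cheb t (m + 1) = t * cheb t m - cheb t (m - 1)" if "m \<ge> 0" for m
  proof (cases "m = 0")
    case True
    then show ?thesis by (simp add: cheb_def)
  next
    case False
    define n where "n = nat (m - 1)"
    have "nat m = Suc n" "nat (m + 1) = Suc (Suc n)" "nat (m - 1) = n"
      using False that by (auto simp: n_def)
    then show ?thesis using that False by (simp add: cheb_def)
  qed
  show ?thesis
  proof (cases "m \<ge> 0")
    case False
    then show ?thesis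
      using nonneg[of "- m"] cheb_minus[of t m] cheb_reflect[of t m] cheb_minus[of t "m - 1"]
      by simp
  qed (rule nonneg)
qed

lemma cheb_cassini: "(cheb t (m + 1))\<^sup>2 - t * cheb t (m + 1) * cheb t m + (cheb t m)\<^sup>2 = 1"
proof (induction m rule: int_induct[where k = 0])
  case (step1 i)
  have "cheb t (i + 1 + 1) = t * cheb t (i + 1) - cheb t i" using cheb_rec[of t "i + 1"] by simp
  then show ?case using step1(2) by (simp only:) (simp add: power2_eq_square algebra_simps)
next
  case (step2 i)
  have "cheb t (i - 1) = t * cheb t i - cheb t (i + 1)" using cheb_rec[of t i] by simp
  moreover have "cheb t (i - 1 + 1) = cheb t i" by simp
  ultimately show ?case using step2(2) by (simp only:) (simp add: power2_eq_square algebra_simps)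
qed simp

definition cheb_diff :: "int \<Rightarrow> int \<Rightarrow> int" where
  "cheb_diff t m = cheb t (m + 1) - cheb t m"

lemma cheb_diff_reflect: "cheb_diff t (- 1 - m) = cheb_diff t m"
  using cheb_minus[of t m] cheb_minus[of t "m + 1"] by (simp add: cheb_diff_def algebra_simps)

lemma cheb_diff_cassini:
  "(cheb_diff t m)\<^sup>2 = 1 + (t - 2) * cheb t m * cheb t (m + 1)"
  using cheb_cassini[of t m] by (simp add: cheb_diff_def power2_eq_square algebra_simps)

lemma cheb_nat_growth:
  assumes "t \<ge> 2"
  shows "cheb_nat t n \<ge> 0 \<and> cheb_nat t (Suc n) \<ge> cheb_nat t n + 1"
proof (induction n)
  case (Suc n)
  have "t * cheb_nat t (Suc n) \<ge> 2 * cheb_nat t (Suc n)"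
    using Suc assms by (intro mult_right_mono) auto
  then have "t * cheb_nat t (Suc n) - cheb_nat t n \<ge> cheb_nat t (Suc n) + 1" using Suc by linarith
  then show ?case using Suc by auto
qed simp

lemma cheb_growth:
  assumes "t \<ge> 2" "m \<ge> 0"
  shows "cheb t m \<ge> 0" "cheb t (m + 1) \<ge> cheb t m + 1"
  using cheb_nat_growth[OF assms(1), of "nat m"] assms(2) by (simp_all add: cheb_def nat_add_distrib)

lemma cheb_growth_from_2:
  assumes t: "t \<ge> 2" and "m \<ge> 2"
  shows "cheb t m \<ge> t"
  using assms(2)
proof (induction m rule: int_ge_induct)
  case base
  show ?case using cheb_rec[of t 1] by simp
next
  case (step i)
  then show ?case using cheb_growth[OF t, of i] by simp
qed

lemma abs_cheb_cases:
  assumes t: "t \<ge> 2" and "m \<noteq> 0"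
  shows "(\<bar>cheb t m\<bar> = 1 \<and> (m = 1 \<or> m = - 1)) \<or> \<bar>cheb t m\<bar> \<ge> t"
proof -
  have "\<bar>cheb t m\<bar> = cheb t \<bar>m\<bar>" using cheb_growth(1)[OF t, of "\<bar>m\<bar>"] cheb_minus[of t m] by (auto simp: abs_if)
  moreover have "\<bar>m\<bar> = 1 \<or> \<bar>m\<bar> \<ge> 2" using assms by linarith
  ultimately show ?thesis using cheb_growth_from_2[OF t, of "\<bar>m\<bar>"] by auto
qed

lemma cheb_diff_cases:
  assumes t: "t \<ge> 3"
  shows "(cheb_diff t m = 1 \<and> (m = 0 \<or> m = - 1)) \<or>
    (cheb_diff t m = t - 1 \<and> (m = 1 \<or> m = - 2)) \<or> cheb_diff t m \<ge> t + 2"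
proof -
  have main: "(cheb_diff t m = 1 \<and> m = 0) \<or> (cheb_diff t m = t - 1 \<and> m = 1) \<or>
      cheb_diff t m \<ge> t + 2" if "m \<ge> 0" for m
  proof -
    have mono: "cheb_diff t (i + 1) \<ge> cheb_diff t i" if "i \<ge> 0" for i
    proof -
      have "(t - 2) * cheb t (i + 1) \<ge> 0" using cheb_growth(1)[of t "i + 1"] that t by simp
      then show ?thesis using cheb_rec[of t "i + 1"] by (simp add: cheb_diff_def algebra_simps)
    qed
    have "cheb_diff t i \<ge> cheb_diff t 2" if "i \<ge> 2" for i
      using that
    proof (induction i rule: int_ge_induct)
      case (step i)
      then show ?case using mono[of i] by simp
    qed simp
    moreover have "cheb_diff t 2 \<ge> t + 2"
    proof -
      have "cheb_diff t 2 = (t - 3) * (t + 1) + t + 2"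
        using cheb_rec[of t 1] cheb_rec[of t 2] by (simp add: cheb_diff_def algebra_simps)
      moreover have "(t - 3) * (t + 1) \<ge> 0" using t by simp
      ultimately show ?thesis by linarith
    qed
    moreover have "cheb_diff t 0 = 1" "cheb_diff t 1 = t - 1"
      using cheb_rec[of t 1] by (simp_all add: cheb_diff_def)
    moreover have "m = 0 \<or> m = 1 \<or> m \<ge> 2" using that by linarith
    ultimately show ?thesis by fastforce
  qed
  show ?thesis
  proof (cases "m \<ge> 0")
    case True
    then show ?thesis using main[of m] by auto
  next
    case False
    then show ?thesis using main[of "- 1 - m"] cheb_diff_reflect[of t m] by auto
  qed
qed

lemma cheb_diff_pos: "t \<ge> 2 \<Longrightarrow> cheb_diff t m > 0"
  using cheb_growth[of t m] cheb_growth[of t "- 1 - m"] cheb_diff_reflect[of t m]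
  by (cases "m \<ge> 0") (auto simp: cheb_diff_def)

lemma cheb_sum_sgn:
  assumes t: "t \<ge> 2"
  shows "sgn (cheb t m + cheb t (m + 1)) = sgn (2 * m + 1)"
proof -
  have pos: "cheb t m + cheb t (m + 1) > 0" if "m \<ge> 0" for m
    using cheb_growth[OF t that] by linarith
  show ?thesis
  proof (cases "m \<ge> 0")
    case False
    then have "cheb t m + cheb t (m + 1) < 0"
      using pos[of "- m - 1"] cheb_minus[of t m] cheb_reflect[of t m] by simp
    then show ?thesis using False by (simp add: sgn_if)
  qed (use pos[of m] in \<open>simp add: sgn_if\<close>)
qed

text \<open>Negating the parameter changes the sign of every other Chebyshev number, so differences become sums.\<close>

lemma cheb_neg_parameter: "\<bar>cheb_diff (- t) m\<bar> = \<bar>cheb t m + cheb t (m + 1)\<bar>"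
proof -
  have nat_eq: "cheb_nat (- t) n = (- 1) ^ (n + 1) * cheb_nat t n" for n
    by (induction t n rule: cheb_nat.induct) (simp_all add: algebra_simps)
  have main: "\<bar>cheb_diff (- t) m\<bar> = \<bar>cheb t m + cheb t (m + 1)\<bar>" if "m \<ge> 0" for m
  proof -
    have "cheb_diff (- t) m = (- 1) ^ nat m * (cheb t m + cheb t (m + 1))"
      using that by (simp add: cheb_diff_def cheb_def nat_eq nat_add_distrib algebra_simps)
    then show ?thesis by (simp add: abs_mult power_abs)
  qed
  show ?thesis
    using main[of m] main[of "- 1 - m"] cheb_diff_reflect[of "- t" m]
      cheb_minus[of t m] cheb_minus[of t "m + 1"]
    by (cases "m \<ge> 0") (simp_all add: algebra_simps)
qed

lemma abs_cheb_diff_neg_cases: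
  assumes "t \<ge> 2"
  shows "\<bar>cheb_diff (- t) m\<bar> = 1 \<or> \<bar>cheb_diff (- t) m\<bar> \<ge> t + 1"
proof -
  have main: "cheb t m + cheb t (m + 1) = 1 \<or> cheb t m + cheb t (m + 1) \<ge> t + 1" if "m \<ge> 0" for m
  proof (cases "m \<le> 1")
    case True
    then have "m = 0 \<or> m = 1" using that by linarith
    then show ?thesis using cheb_rec[of t 1] by auto
  next
    case False
    then show ?thesis
      using cheb_growth_from_2[OF assms, of m] cheb_growth[OF assms, of m] assms by linarith
  qed
  show ?thesis
  proof (cases "m \<ge> 0")
    case True
    then show ?thesis using main[of m] cheb_neg_parameter[of t m] assms by auto
  next
    case False
    then have "\<bar>cheb t m + cheb t (m + 1)\<bar> = \<bar>cheb t (- m - 1) + cheb t (- m)\<bar>"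
      using cheb_minus[of t m] cheb_reflect[of t m] by simp
    then show ?thesis using main[of "- m - 1"] cheb_neg_parameter[of t m] assms False by auto
  qed
qed

text \<open>A matrix of determinant 1 and trace 1 has order 6.\<close>

lemma mod_6_cases:
  fixes m :: int
  obtains "m mod 6 = 0" | "m mod 6 = 1" | "m mod 6 = 2" | "m mod 6 = 3" | "m mod 6 = 4" | "m mod 6 = 5"
proof -
  have "m mod 6 \<in> {0..<6}" by simp
  also have "{0..<6::int} = {0, 1, 2, 3, 4, 5}" by auto
  finally show ?thesis using that by auto
qed

lemma mod_6_neighbours:
  fixes m :: int
  shows "(m + 1) mod 6 = (if m mod 6 = 5 then 0 else m mod 6 + 1)"
    "(m - 1) mod 6 = (if m mod 6 = 0 then 5 else m mod 6 - 1)"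
  unfolding mod_add_left_eq[of m 6 1, symmetric] mod_diff_left_eq[of m 6 1, symmetric]
  by (cases m rule: mod_6_cases; simp)+

lemma cheb_one: "cheb 1 m = (if m mod 6 \<in> {1, 2} then 1 else if m mod 6 \<in> {4, 5} then - 1 else 0)"
proof -
  define f :: "int \<Rightarrow> int" where
    "f = (\<lambda>m. if m mod 6 \<in> {1, 2} then 1 else if m mod 6 \<in> {4, 5} then - 1 else 0)"
  have f_rec: "f (m + 1) = f m - f (m - 1)" for m
    unfolding f_def mod_6_neighbours by (cases m rule: mod_6_cases) simp_all
  have "cheb 1 m = f m \<and> cheb 1 (m + 1) = f (m + 1)"
  proof (induction m rule: int_induct[where k = 0])
    case (step1 i)
    then show ?case using cheb_rec[of 1 "i + 1"] f_rec[of "i + 1"] by simp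
  next
    case (step2 i)
    then show ?case using cheb_rec[of 1 i] f_rec[of i] by simp
  qed (simp add: f_def)
  then show ?thesis by (simp add: f_def)
qed

lemma cheb_diff_one:
  "cheb_diff 1 m = (if m mod 6 \<in> {0, 5} then 1 else if m mod 6 \<in> {2, 3} then - 1 else 0)"
  unfolding cheb_diff_def cheb_one mod_6_neighbours by (cases m rule: mod_6_cases) simp_all

section \<open>The closing equations over the integers\<close>

text \<open>Here \<open>k\<close>, \<open>k'\<close>, \<open>k''\<close> are the areas spanned by consecutive top vectors, and \<open>A, B\<close> and \<open>D, A'\<close> the coefficients of
two vectors that agree up to the sign \<open>s\<close> at the bottom of adjacent regions. Eliminating \<open>s\<close> from the
two pairings makes the statement independent of the choice of signs of the vectors.\<close>

lemma closing_identity: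
  fixes s k k' k'' A A' B D :: int
  assumes s: "s \<in> {1, -1}" and "A * k = - s * A' * k'" "B * k = s * (D * k - A' * k'')"
  shows "k * k' * (A * k * B + A' * k' * D) = (A * k)\<^sup>2 * k''"
proof -
  have A: "A' * k' = - s * (A * k)" using assms by auto
  have "A * k * (B * k) = A * k * (s * (D * k - A' * k''))" using assms by simp
  then have "k' * (A * k * (B * k)) = k' * (A * k * (s * (D * k - A' * k'')))" by simp
  then have "k * k' * (A * k * B) = s * (A * k) * (k * k' * D) - s * (A * k) * ((A' * k') * k'')"
    by (simp add: algebra_simps)
  moreover have "k * k' * (A' * k' * D) = - s * (A * k) * (k * k' * D)"
    unfolding A by simp
  moreover have "s * (A * k) * ((A' * k') * k'') = - (s * s * (A * k)\<^sup>2 * k'')"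
    unfolding A by (simp add: power2_eq_square)
  moreover have "s * s = 1" using s by auto
  ultimately show ?thesis by (simp add: distrib_left)
qed

lemma closing_system:
  fixes A1 A2 A3 E1 E2 E3 D1 D2 D3 k1 k2 k3 s1 s2 s3 :: int
  assumes s: "s1 \<in> {1, -1}" "s2 \<in> {1, -1}" "s3 \<in> {1, -1}"
    and A: "A1 * k1 = - s1 * A2 * k2" "A2 * k2 = - s2 * A3 * k3" "A3 * k3 = - s3 * A1 * k1"
    and B: "E1 * k1 = s1 * (D2 * k1 - A2 * k3)" "E2 * k2 = s2 * (D3 * k2 - A3 * k1)"
      "E3 * k3 = s3 * (D1 * k3 - A1 * k2)"
  defines "c \<equiv> (A1 * k1)\<^sup>2" and "K \<equiv> k1 * k2 * k3"
  shows "(A2 * k2)\<^sup>2 = c" "(A3 * k3)\<^sup>2 = c"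
    "K * (A1 * k1 * E1 + A2 * k2 * D2) = c * k3\<^sup>2"
    "K * (A2 * k2 * E2 + A3 * k3 * D3) = c * k1\<^sup>2"
    "K * (A3 * k3 * E3 + A1 * k1 * D1) = c * k2\<^sup>2"
proof -
  show c2: "(A2 * k2)\<^sup>2 = c" and c3: "(A3 * k3)\<^sup>2 = c"
    using A s unfolding c_def by (auto simp: power2_eq_square)
  show "K * (A1 * k1 * E1 + A2 * k2 * D2) = c * k3\<^sup>2"
    using arg_cong[OF closing_identity[OF s(1) A(1) B(1)], of "\<lambda>x. k3 * x"]
    by (simp add: K_def c_def power2_eq_square algebra_simps)
  show "K * (A2 * k2 * E2 + A3 * k3 * D3) = c * k1\<^sup>2"
    using arg_cong[OF closing_identity[OF s(2) A(2) B(2)], of "\<lambda>x. k1 * x"] unfolding c2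
    by (simp add: K_def power2_eq_square algebra_simps)
  show "K * (A3 * k3 * E3 + A1 * k1 * D1) = c * k2\<^sup>2"
    using arg_cong[OF closing_identity[OF s(3) A(3) B(3)], of "\<lambda>x. k2 * x"] unfolding c3
    by (simp add: K_def power2_eq_square algebra_simps)
qed

text \<open>The sums in \<open>closing_system\<close> can be solved for \<open>Ei + Di\<close>, which gives \<open>M\<close>. Squaring one of these equations
and inserting \<open>E3 * D3 = A3^2 - 1\<close> yields the equation of \<open>odd_diophantine\<close>; the signs of the
three equations give the signs of the lengths \<open>2 * mi + 1\<close>, and the values of \<open>Ai\<close> their absolute values.\<close>

lemma odd_closing_system:
  fixes k1 k2 k3 m1 m2 m3 s1 s2 s3 \<epsilon> :: int
  defines "A1 \<equiv> cheb_diff (2 + k1\<^sup>2) m1" and "A2 \<equiv> cheb_diff (2 + k2\<^sup>2) m2"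
    and "A3 \<equiv> cheb_diff (2 + k3\<^sup>2) m3"
    and "E1 \<equiv> \<epsilon> * k1 * cheb (2 + k1\<^sup>2) m1" and "E2 \<equiv> \<epsilon> * k2 * cheb (2 + k2\<^sup>2) m2"
    and "E3 \<equiv> \<epsilon> * k3 * cheb (2 + k3\<^sup>2) m3"
    and "D1 \<equiv> \<epsilon> * k1 * cheb (2 + k1\<^sup>2) (m1 + 1)" and "D2 \<equiv> \<epsilon> * k2 * cheb (2 + k2\<^sup>2) (m2 + 1)"
    and "D3 \<equiv> \<epsilon> * k3 * cheb (2 + k3\<^sup>2) (m3 + 1)"
  assumes \<epsilon>: "\<epsilon> \<in> {1, -1}"
    and s: "s1 \<in> {1, -1}" "s2 \<in> {1, -1}" "s3 \<in> {1, -1}"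
    and A: "A1 * k1 = - s1 * A2 * k2" "A2 * k2 = - s2 * A3 * k3" "A3 * k3 = - s3 * A1 * k1"
    and B: "E1 * k1 = s1 * (D2 * k1 - A2 * k3)" "E2 * k2 = s2 * (D3 * k2 - A3 * k1)"
      "E3 * k3 = s3 * (D1 * k3 - A1 * k2)"
    and nontrivial: "k1 \<noteq> 0 \<or> k2 \<noteq> 0 \<or> k3 \<noteq> 0"
  shows "\<exists>\<sigma>\<in>{1, -1}. (\<sigma> * (2 * m1 + 1), \<sigma> * (2 * m2 + 1), \<sigma> * (2 * m3 + 1)) \<in>
    {(1, 1, 1), (3, 3, -1), (3, -1, 3), (-1, 3, 3)}"
proof -
  have pos: "A1 > 0" "A2 > 0" "A3 > 0"
    unfolding A1_def A2_def A3_def by (auto intro!: cheb_diff_pos)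
  have k: "k1 \<noteq> 0" "k2 \<noteq> 0" "k3 \<noteq> 0" using A s pos nontrivial by auto
  define c where "c = (A1 * k1)\<^sup>2"
  define K where "K = k1 * k2 * k3"
  note sys = closing_system[OF s A B, folded c_def K_def]
  have c: "c > 0" and K: "K \<noteq> 0" using k pos by (simp_all add: c_def K_def)
  have \<epsilon>2: "\<epsilon> * \<epsilon> = 1" using \<epsilon> by auto
  have D: "D1 = E1 + \<epsilon> * k1 * A1" "D2 = E2 + \<epsilon> * k2 * A2" "D3 = E3 + \<epsilon> * k3 * A3"
    by (simp_all add: A1_def A2_def A3_def E1_def E2_def E3_def D1_def D2_def D3_def cheb_diff_def
        algebra_simps)
  have aD: "A1 * k1 * D1 = A1 * k1 * E1 + \<epsilon> * c" "A2 * k2 * D2 = A2 * k2 * E2 + \<epsilon> * c"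
    "A3 * k3 * D3 = A3 * k3 * E3 + \<epsilon> * c"
    subgoal unfolding D c_def by (simp add: power2_eq_square algebra_simps)
    subgoal unfolding D sys(1)[symmetric] by (simp add: power2_eq_square algebra_simps)
    subgoal unfolding D sys(2)[symmetric] by (simp add: power2_eq_square algebra_simps)
    done
  have M: "K * (A1 * k1 * (E1 + D1)) = c * (k2\<^sup>2 + k3\<^sup>2 - k1\<^sup>2)"
    "K * (A2 * k2 * (E2 + D2)) = c * (k1\<^sup>2 + k3\<^sup>2 - k2\<^sup>2)"
    "K * (A3 * k3 * (E3 + D3)) = c * (k1\<^sup>2 + k2\<^sup>2 - k3\<^sup>2)"
    using sys(3-5) unfolding distrib_left aD by (simp_all add: algebra_simps)
  have sgn_eq: "sgn (2 * m + 1) = sgn (K * \<epsilon>) * sgn Q"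
    if "K * (cheb_diff (2 + k\<^sup>2) m * k * (\<epsilon> * k * cheb (2 + k\<^sup>2) m + \<epsilon> * k * cheb (2 + k\<^sup>2) (m + 1))) = c * Q"
      "k \<noteq> 0" for k m Q
  proof -
    have "sgn (c * Q) = sgn (K * \<epsilon> * (cheb_diff (2 + k\<^sup>2) m * k\<^sup>2 *
        (cheb (2 + k\<^sup>2) m + cheb (2 + k\<^sup>2) (m + 1))))"
      unfolding that(1)[symmetric] by (simp add: power2_eq_square algebra_simps)
    also have "(sgn k)\<^sup>2 = 1" using that(2) by (simp add: sgn_if)
    then have "sgn (K * \<epsilon> * (cheb_diff (2 + k\<^sup>2) m * k\<^sup>2 *
        (cheb (2 + k\<^sup>2) m + cheb (2 + k\<^sup>2) (m + 1)))) = sgn (K * \<epsilon>) * sgn (2 * m + 1)"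
      using that(2) cheb_diff_pos[of "2 + k\<^sup>2" m] cheb_sum_sgn[of "2 + k\<^sup>2" m] by (simp add: sgn_mult)
    finally have "sgn Q = sgn (K * \<epsilon>) * sgn (2 * m + 1)" using c by (simp add: sgn_mult)
    moreover have "sgn (K * \<epsilon>) * sgn (K * \<epsilon>) = 1" using K \<epsilon> by (auto simp: sgn_if)
    ultimately show ?thesis by (metis mult.assoc mult.left_neutral)
  qed
  have sgns: "sgn (2 * m1 + 1) = sgn (K * \<epsilon>) * sgn (k2\<^sup>2 + k3\<^sup>2 - k1\<^sup>2)"
    "sgn (2 * m2 + 1) = sgn (K * \<epsilon>) * sgn (k1\<^sup>2 + k3\<^sup>2 - k2\<^sup>2)"
    "sgn (2 * m3 + 1) = sgn (K * \<epsilon>) * sgn (k1\<^sup>2 + k2\<^sup>2 - k3\<^sup>2)"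
    using M k unfolding A1_def A2_def A3_def E1_def E2_def E3_def D1_def D2_def D3_def
    by (auto intro: sgn_eq)
  have "(E3 + D3)\<^sup>2 = c + 4 * A3\<^sup>2 - 4"
  proof -
    have "(E3 + D3)\<^sup>2 = (D3 - E3)\<^sup>2 + 4 * (E3 * D3)" by (simp add: power2_eq_square algebra_simps)
    also have "(D3 - E3)\<^sup>2 = c"
      unfolding D sys(2)[symmetric] using \<epsilon> by (auto simp: power2_eq_square)
    also have "E3 * D3 = A3\<^sup>2 - 1"
      using cheb_diff_cassini[of "2 + k3\<^sup>2" m3] \<epsilon> unfolding A3_def E3_def D3_def
      by (auto simp: power2_eq_square)
    finally show ?thesis by simp
  qed
  moreover have "c * (K\<^sup>2 * (E3 + D3)\<^sup>2) = c * (c * (k1\<^sup>2 + k2\<^sup>2 - k3\<^sup>2)\<^sup>2)"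
  proof -
    have "(A3 * k3)\<^sup>2 * (K\<^sup>2 * (E3 + D3)\<^sup>2) = (K * (A3 * k3 * (E3 + D3)))\<^sup>2"
      by (simp add: power_mult_distrib)
    also have "\<dots> = c * (c * (k1\<^sup>2 + k2\<^sup>2 - k3\<^sup>2)\<^sup>2)"
      unfolding M(3) by (simp add: power2_eq_square)
    finally show ?thesis unfolding sys(2) .
  qed
  ultimately have "c * (K\<^sup>2 * (c + 4 * A3\<^sup>2 - 4)) = c * (c * (k1\<^sup>2 + k2\<^sup>2 - k3\<^sup>2)\<^sup>2)" by simp
  then have "K\<^sup>2 * (c + 4 * A3\<^sup>2 - 4) = c * (k1\<^sup>2 + k2\<^sup>2 - k3\<^sup>2)\<^sup>2" using c by simp
  moreover have "K\<^sup>2 * A3\<^sup>2 = k1\<^sup>2 * k2\<^sup>2 * c"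
    unfolding sys(2)[symmetric] by (simp add: K_def power_mult_distrib)
  ultimately have eq: "c * ((k1\<^sup>2 + k2\<^sup>2 - k3\<^sup>2)\<^sup>2 - 4 * k1\<^sup>2 * k2\<^sup>2) = K\<^sup>2 * (c - 4)"
    by (simp add: algebra_simps)
  define C where "C = \<bar>A1 * k1\<bar>"
  have C: "C = \<bar>k1\<bar> * A1" "C = \<bar>k2\<bar> * A2" "C = \<bar>k3\<bar> * A3"
  proof -
    have "\<bar>A2 * k2\<bar> = C" "\<bar>A3 * k3\<bar> = C"
      using sys(1,2) by (simp_all add: C_def c_def abs_eq_iff power2_eq_iff)
    then show "C = \<bar>k1\<bar> * A1" "C = \<bar>k2\<bar> * A2" "C = \<bar>k3\<bar> * A3"
      using pos by (simp_all add: C_def abs_mult mult.commute)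
  qed
  have "C\<^sup>2 = c" by (simp add: C_def c_def)
  have A_cases: "cheb_diff (2 + k\<^sup>2) m = 1 \<and> (m = 0 \<or> m = - 1) \<or>
      cheb_diff (2 + k\<^sup>2) m = k\<^sup>2 + 1 \<and> (m = 1 \<or> m = - 2) \<or> cheb_diff (2 + k\<^sup>2) m \<ge> k\<^sup>2 + 4"
    if "k \<noteq> 0" for k m
  proof -
    have "k\<^sup>2 > 0" using that by simp
    then have "2 + k\<^sup>2 \<ge> 3" by linarith
    from cheb_diff_cases[OF this, of m] show ?thesis by (auto simp: add.commute)
  qed
  note cases = A_cases[OF k(1), of m1, folded A1_def] A_cases[OF k(2), of m2, folded A2_def]
    A_cases[OF k(3), of m3, folded A3_def]
  have "(C = 1 \<and> (\<bar>k1\<bar>, \<bar>k2\<bar>, \<bar>k3\<bar>) = (1, 1, 1)) \<or>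
      (C = 2 \<and> (\<bar>k1\<bar>, \<bar>k2\<bar>, \<bar>k3\<bar>) \<in> {(1, 1, 2), (1, 2, 1), (2, 1, 1)})"
  proof (rule odd_diophantine[OF _ _ _ pos C])
    show "A1 = 1 \<or> \<bar>k1\<bar>\<^sup>2 + 1 \<le> A1" "A2 = 1 \<or> \<bar>k2\<bar>\<^sup>2 + 1 \<le> A2" "A3 = 1 \<or> \<bar>k3\<bar>\<^sup>2 + 1 \<le> A3"
      using cases by auto
    show "C\<^sup>2 * ((\<bar>k1\<bar>\<^sup>2 + \<bar>k2\<bar>\<^sup>2 - \<bar>k3\<bar>\<^sup>2)\<^sup>2 - 4 * \<bar>k1\<bar>\<^sup>2 * \<bar>k2\<bar>\<^sup>2) =
        (\<bar>k1\<bar> * \<bar>k2\<bar> * \<bar>k3\<bar>)\<^sup>2 * (C\<^sup>2 - 4)"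
      using eq \<open>C\<^sup>2 = c\<close> by (simp add: K_def power_mult_distrib)
  qed (use k in simp_all)
  moreover define \<sigma> where "\<sigma> = sgn (K * \<epsilon>)"
  moreover have \<sigma>: "\<sigma> \<in> {1, -1}" using K \<epsilon> by (auto simp: \<sigma>_def sgn_if)
  have scaled: "\<sigma> * (2 * m + 1) = (if A = 1 then 1 else 3) * sgn Q"
    if "sgn (2 * m + 1) = \<sigma> * sgn Q" "A = 1 \<or> A = k\<^sup>2 + 1" "k \<noteq> 0"
      "A = 1 \<and> (m = 0 \<or> m = - 1) \<or> A = k\<^sup>2 + 1 \<and> (m = 1 \<or> m = - 2) \<or> A \<ge> k\<^sup>2 + 4" for m Q A k :: int
  proof -
    have "k\<^sup>2 > 0" using that by simp
    then have "(A = 1 \<and> (m = 0 \<or> m = - 1)) \<or> (A \<noteq> 1 \<and> (m = 1 \<or> m = - 2))"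
      using that(2,4) by linarith
    then have "2 * m + 1 = (if A = 1 then 1 else 3) * sgn (2 * m + 1)" by auto
    also have "\<sigma> * \<dots> = \<sigma> * \<sigma> * ((if A = 1 then 1 else 3) * sgn Q)" unfolding that(1) by simp
    also have "\<sigma> * \<sigma> = 1" using \<sigma> by auto
    finally show ?thesis by simp
  qed
  note lengths = scaled[OF sgns(1)[folded \<sigma>_def] _ k(1) cases(1)]
    scaled[OF sgns(2)[folded \<sigma>_def] _ k(2) cases(2)] scaled[OF sgns(3)[folded \<sigma>_def] _ k(3) cases(3)]
  have sq: "k1\<^sup>2 = \<bar>k1\<bar>\<^sup>2" "k2\<^sup>2 = \<bar>k2\<bar>\<^sup>2" "k3\<^sup>2 = \<bar>k3\<bar>\<^sup>2" by simp_all
  consider "C = 1" "\<bar>k1\<bar> = 1" "\<bar>k2\<bar> = 1" "\<bar>k3\<bar> = 1"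
    | "C = 2" "\<bar>k1\<bar> = 1" "\<bar>k2\<bar> = 1" "\<bar>k3\<bar> = 2"
    | "C = 2" "\<bar>k1\<bar> = 1" "\<bar>k2\<bar> = 2" "\<bar>k3\<bar> = 1"
    | "C = 2" "\<bar>k1\<bar> = 2" "\<bar>k2\<bar> = 1" "\<bar>k3\<bar> = 1"
    using calculation(1) by auto
  then have "(\<sigma> * (2 * m1 + 1), \<sigma> * (2 * m2 + 1), \<sigma> * (2 * m3 + 1)) \<in>
    {(1, 1, 1), (3, 3, -1), (3, -1, 3), (-1, 3, 3)}"
  proof cases
    case 1
    then have "A1 = 1" "A2 = 1" "A3 = 1" using C by simp_all
    then show ?thesis using lengths unfolding sq 1 by simp
  next
    case 2
    then have "A1 = 2" "A2 = 2" "A3 = 1" using C by simp_all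
    then show ?thesis using lengths unfolding sq 2 by simp
  next
    case 3
    then have "A1 = 2" "A2 = 1" "A3 = 2" using C by simp_all
    then show ?thesis using lengths unfolding sq 3 by simp
  next
    case 4
    then have "A1 = 1" "A2 = 2" "A3 = 2" using C by simp_all
    then show ?thesis using lengths unfolding sq 4 by simp
  qed
  then show ?thesis using \<sigma> by blast
qed

text \<open>In the two odd regions the two top transvections have opposite signs, hence the parameters \<open>2 - k^2\<close>.
Now the sum of all three equations of \<open>closing_system\<close> involves only \<open>E1 + D1\<close>, and squaring it
yields the equation of \<open>even_diophantine\<close>. Once all areas are 1 or -1, the parameters are 3 and 1, and
for parameter 1 the Chebyshev numbers have period 6.\<close>

lemma even_closing_system:
  fixes k1 k2 k3 n m2 m3 s1 s2 s3 \<epsilon> :: int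
  defines "A1 \<equiv> \<epsilon> * k1 * cheb (2 + k1\<^sup>2) n" and "A2 \<equiv> cheb_diff (2 - k2\<^sup>2) m2"
    and "A3 \<equiv> cheb_diff (2 - k3\<^sup>2) m3"
    and "E1 \<equiv> cheb_diff (2 + k1\<^sup>2) (n - 1)" and "E2 \<equiv> - \<epsilon> * k2 * cheb (2 - k2\<^sup>2) m2"
    and "E3 \<equiv> \<epsilon> * k3 * cheb (2 - k3\<^sup>2) m3"
    and "D1 \<equiv> cheb_diff (2 + k1\<^sup>2) n" and "D2 \<equiv> \<epsilon> * k2 * cheb (2 - k2\<^sup>2) (m2 + 1)"
    and "D3 \<equiv> - \<epsilon> * k3 * cheb (2 - k3\<^sup>2) (m3 + 1)"
  assumes \<epsilon>: "\<epsilon> \<in> {1, -1}"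
    and s: "s1 \<in> {1, -1}" "s2 \<in> {1, -1}" "s3 \<in> {1, -1}"
    and A: "A1 * k1 = - s1 * A2 * k2" "A2 * k2 = - s2 * A3 * k3" "A3 * k3 = - s3 * A1 * k1"
    and B: "E1 * k1 = s1 * (D2 * k1 - A2 * k3)" "E2 * k2 = s2 * (D3 * k2 - A3 * k1)"
      "E3 * k3 = s3 * (D1 * k3 - A1 * k2)"
    and "odd k1" and "n \<noteq> 0"
  shows "\<exists>e\<in>{1, -1}. n = e \<and> [2 * m2 + 1 = - e] (mod 6) \<and> [2 * m3 + 1 = - e] (mod 6)"
proof -
  have k1: "k1 \<noteq> 0" using \<open>odd k1\<close> by auto
  then have k1sq: "k1\<^sup>2 > 0" by simp
  have A1_cases: "(\<bar>A1\<bar> = \<bar>k1\<bar> \<and> (n = 1 \<or> n = - 1)) \<or> \<bar>A1\<bar> \<ge> \<bar>k1\<bar> * (k1\<^sup>2 + 2)"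
    using abs_cheb_cases[of "2 + k1\<^sup>2" n] \<open>n \<noteq> 0\<close> \<epsilon> unfolding A1_def
    by (auto simp: abs_mult mult_left_mono add.commute)
  moreover have "\<bar>k1\<bar> * (k1\<^sup>2 + 2) > 0" using k1 k1sq by (intro mult_pos_pos) linarith+
  ultimately have "A1 \<noteq> 0" using k1 by auto
  have k: "A2 \<noteq> 0" "A3 \<noteq> 0" "k2 \<noteq> 0" "k3 \<noteq> 0" using A s \<open>A1 \<noteq> 0\<close> k1 by auto
  define c where "c = (A1 * k1)\<^sup>2"
  define K where "K = k1 * k2 * k3"
  note sys = closing_system[OF s A B, folded c_def K_def]
  have c: "c > 0" and K: "K \<noteq> 0" using k k1 \<open>A1 \<noteq> 0\<close> by (simp_all add: c_def K_def)
  have D: "D1 = E1 + \<epsilon> * k1 * A1" "D2 = - E2 + \<epsilon> * k2 * A2" "D3 = - E3 - \<epsilon> * k3 * A3"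
  proof -
    have "cheb_diff (2 + k1\<^sup>2) n = cheb_diff (2 + k1\<^sup>2) (n - 1) + k1\<^sup>2 * cheb (2 + k1\<^sup>2) n"
      using cheb_rec[of "2 + k1\<^sup>2" n] by (simp add: cheb_diff_def algebra_simps)
    then show "D1 = E1 + \<epsilon> * k1 * A1" unfolding D1_def E1_def A1_def using \<epsilon>
      by (auto simp: power2_eq_square)
  qed (simp_all add: A2_def A3_def E2_def E3_def D2_def D3_def cheb_diff_def algebra_simps)
  have aD: "A1 * k1 * D1 = A1 * k1 * E1 + \<epsilon> * c" "A2 * k2 * D2 = - (A2 * k2 * E2) + \<epsilon> * c"
    "A3 * k3 * D3 = - (A3 * k3 * E3) - \<epsilon> * c"
    subgoal unfolding D c_def by (simp add: power2_eq_square algebra_simps)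
    subgoal unfolding D sys(1)[symmetric] by (simp add: power2_eq_square algebra_simps)
    subgoal unfolding D sys(2)[symmetric] by (simp add: power2_eq_square algebra_simps)
    done
  have M: "K * (A1 * k1 * (E1 + D1)) = c * (k1\<^sup>2 + k2\<^sup>2 + k3\<^sup>2)"
    using sys(3-5) unfolding distrib_left aD by (simp add: algebra_simps)
  have "(E1 + D1)\<^sup>2 = c + 4 * A1\<^sup>2 + 4"
  proof -
    have "(E1 + D1)\<^sup>2 = (D1 - E1)\<^sup>2 + 4 * (E1 * D1)" by (simp add: power2_eq_square algebra_simps)
    also have "(D1 - E1)\<^sup>2 = c"
      unfolding D c_def using \<epsilon> by (auto simp: power2_eq_square)
    also have "E1 * D1 = A1\<^sup>2 + 1"
    proof -
      define e f where "e = cheb (2 + k1\<^sup>2) n" and "f = cheb (2 + k1\<^sup>2) (n - 1)"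
      have "D1 = E1 + k1\<^sup>2 * e" "A1\<^sup>2 = k1\<^sup>2 * e\<^sup>2"
        unfolding D(1) A1_def e_def using \<epsilon> by (auto simp: power2_eq_square)
      moreover have "E1 * E1 = 1 + k1\<^sup>2 * f * e"
        using cheb_diff_cassini[of "2 + k1\<^sup>2" "n - 1"] by (simp add: E1_def e_def f_def power2_eq_square)
      moreover have "E1 = e - f" by (simp add: E1_def cheb_diff_def e_def f_def)
      then have "k1\<^sup>2 * e * E1 = k1\<^sup>2 * e\<^sup>2 - k1\<^sup>2 * f * e"
        by (simp only:) (simp add: power2_eq_square algebra_simps)
      ultimately show ?thesis by (simp add: distrib_left mult.commute mult.left_commute)
    qed
    finally show ?thesis by simp
  qed
  moreover have "c * (K\<^sup>2 * (E1 + D1)\<^sup>2) = c * (c * (k1\<^sup>2 + k2\<^sup>2 + k3\<^sup>2)\<^sup>2)"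
  proof -
    have "(A1 * k1)\<^sup>2 * (K\<^sup>2 * (E1 + D1)\<^sup>2) = (K * (A1 * k1 * (E1 + D1)))\<^sup>2"
      by (simp add: power_mult_distrib)
    also have "\<dots> = c * (c * (k1\<^sup>2 + k2\<^sup>2 + k3\<^sup>2)\<^sup>2)"
      unfolding M by (simp add: power2_eq_square)
    finally show ?thesis unfolding c_def .
  qed
  ultimately have "c * (K\<^sup>2 * (c + 4 * A1\<^sup>2 + 4)) = c * (c * (k1\<^sup>2 + k2\<^sup>2 + k3\<^sup>2)\<^sup>2)" by simp
  then have "K\<^sup>2 * (c + 4 * A1\<^sup>2 + 4) = c * (k1\<^sup>2 + k2\<^sup>2 + k3\<^sup>2)\<^sup>2" using c by simp
  moreover have "K\<^sup>2 * A1\<^sup>2 = k2\<^sup>2 * k3\<^sup>2 * c"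
    unfolding c_def by (simp add: K_def power_mult_distrib)
  ultimately have eq: "c * ((k1\<^sup>2 + k2\<^sup>2 + k3\<^sup>2)\<^sup>2 - 4 * k2\<^sup>2 * k3\<^sup>2 - K\<^sup>2) = 4 * K\<^sup>2"
    by (simp add: algebra_simps)
  define C where "C = \<bar>A1 * k1\<bar>"
  have C: "C = \<bar>k1\<bar> * \<bar>A1\<bar>" "C = \<bar>k2\<bar> * \<bar>A2\<bar>" "C = \<bar>k3\<bar> * \<bar>A3\<bar>"
  proof -
    have "\<bar>A2 * k2\<bar> = C" "\<bar>A3 * k3\<bar> = C"
      using sys(1,2) by (simp_all add: C_def c_def abs_eq_iff power2_eq_iff)
    then show "C = \<bar>k1\<bar> * \<bar>A1\<bar>" "C = \<bar>k2\<bar> * \<bar>A2\<bar>" "C = \<bar>k3\<bar> * \<bar>A3\<bar>"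
      by (simp_all add: C_def abs_mult mult.commute)
  qed
  have "C\<^sup>2 = c" by (simp add: C_def c_def)
  have unit: "\<bar>cheb_diff (2 - k\<^sup>2) m\<bar> = 1" if "\<bar>k\<bar> = 1" "cheb_diff (2 - k\<^sup>2) m \<noteq> 0" for k m
  proof -
    have "k\<^sup>2 = 1" using that(1) by (simp add: power2_eq_1_iff abs_eq_iff')
    then show ?thesis using that(2) by (simp add: cheb_diff_one split: if_splits)
  qed
  have nonunit: "\<bar>cheb_diff (2 - k\<^sup>2) m\<bar> = 1 \<or> \<bar>cheb_diff (2 - k\<^sup>2) m\<bar> \<ge> k\<^sup>2 - 1" if "\<bar>k\<bar> \<ge> 2" for k m
  proof -
    have "k\<^sup>2 \<ge> 4" using power_mono[of 2 "\<bar>k\<bar>" 2] that by simp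
    then show ?thesis using abs_cheb_diff_neg_cases[of "k\<^sup>2 - 2" m] by auto
  qed
  have parity: "odd (cheb_diff (2 - k\<^sup>2) m)" if "even k" for k m
  proof -
    have "odd ((cheb_diff (2 - k\<^sup>2) m)\<^sup>2)" unfolding cheb_diff_cassini using that by simp
    then show ?thesis by simp
  qed
  have "\<bar>k1\<bar> = 1 \<and> \<bar>k2\<bar> = 1 \<and> \<bar>k3\<bar> = 1 \<and> C = 1"
  proof (rule even_diophantine[OF _ _ _ _ _ _ C])
    show "\<bar>A1\<bar> = \<bar>k1\<bar> \<or> \<bar>k1\<bar> * (\<bar>k1\<bar>\<^sup>2 + 2) \<le> \<bar>A1\<bar>" using A1_cases by auto
    show "C\<^sup>2 * ((\<bar>k1\<bar>\<^sup>2 + \<bar>k2\<bar>\<^sup>2 + \<bar>k3\<bar>\<^sup>2)\<^sup>2 - 4 * \<bar>k2\<bar>\<^sup>2 * \<bar>k3\<bar>\<^sup>2 - (\<bar>k1\<bar> * \<bar>k2\<bar> * \<bar>k3\<bar>)\<^sup>2) =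
        4 * (\<bar>k1\<bar> * \<bar>k2\<bar> * \<bar>k3\<bar>)\<^sup>2"
      using eq \<open>C\<^sup>2 = c\<close> by (simp add: K_def power_mult_distrib)
  qed (use k k1 \<open>A1 \<noteq> 0\<close> \<open>odd k1\<close> in \<open>unfold A2_def A3_def, simp_all add: unit nonunit parity\<close>)
  then have abs_k: "\<bar>k1\<bar> = 1" "\<bar>k2\<bar> = 1" "\<bar>k3\<bar> = 1" and C1: "C = 1" by auto
  then have sq: "k1\<^sup>2 = 1" "k2\<^sup>2 = 1" "k3\<^sup>2 = 1" and c1: "c = 1"
    using \<open>C\<^sup>2 = c\<close> by (simp_all add: power2_eq_1_iff abs_eq_iff')
  have "K \<in> {1, -1}" using abs_k by (auto simp: K_def abs_if split: if_splits)
  define b1 b2 b3 where "b1 = A1 * k1 * E1" and "b2 = A2 * k2 * E2" and "b3 = A3 * k3 * E3"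
  have sys1: "K * (b1 - b2 + \<epsilon>) = 1" "K * (b2 - b3 - \<epsilon>) = 1" "K * (b3 + b1 + \<epsilon>) = 1"
    using sys(3-5) unfolding aD c1 sq b1_def b2_def b3_def by (simp_all add: algebra_simps)
  have "\<bar>A1\<bar> = 1" using C(1) C1 abs_k by simp
  then have n: "n = 1 \<or> n = - 1" using A1_cases abs_k sq by auto
  \<comment> \<open>The lengths are recovered from the products \<open>b1\<close>, \<open>b2\<close>, \<open>b3\<close>, whose values \<open>sys1\<close> fixes.\<close>
  have b1: "b1 = \<epsilon> * (cheb 3 n * cheb_diff 3 (n - 1))"
    unfolding b1_def A1_def E1_def sq using sq(1) by (simp add: power2_eq_square)
  have b2: "b2 = - \<epsilon> * (cheb 1 m2 * cheb_diff 1 m2)"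
    unfolding b2_def A2_def E2_def sq using sq(2) by (simp add: power2_eq_square)
  have b3: "b3 = \<epsilon> * (cheb 1 m3 * cheb_diff 1 m3)"
    unfolding b3_def A3_def E3_def sq using sq(3) by (simp add: power2_eq_square)
  have "cheb 3 (- 1) = - 1" "cheb 3 (- 2) = - 3"
    using cheb_minus[of 3 1] cheb_minus[of 3 2] cheb_rec[of 3 1] by simp_all
  then have b1': "b1 = (if n = 1 then \<epsilon> else - 2 * \<epsilon>)" using n b1 by (auto simp: cheb_diff_def)
  have "(n = 1 \<and> b2 = \<epsilon> \<and> b3 = - \<epsilon>) \<or> (n = - 1 \<and> b2 = 0 \<and> b3 = 0)"
    using sys1 b1' n \<epsilon> \<open>K \<in> {1, -1}\<close> by auto
  then have prod: "cheb 1 m2 * cheb_diff 1 m2 = (if n = 1 then - 1 else 0)"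
    "cheb 1 m3 * cheb_diff 1 m3 = (if n = 1 then - 1 else 0)"
    using b2 b3 \<epsilon> by auto
  have last: "[2 * m + 1 = - n] (mod 6)"
    if "cheb 1 m * cheb_diff 1 m = (if n = 1 then - 1 else 0)" "cheb_diff 1 m \<noteq> 0" for m
  proof -
    have "(n = 1 \<and> m mod 3 = 2) \<or> (n = - 1 \<and> m mod 3 = 0)"
      using that n mod_mod_cancel[of 3 6 m] unfolding cheb_diff_one cheb_one
      by (cases m rule: mod_6_cases) auto
    moreover obtain j where "m = 3 * j + m mod 3" by (metis mult_div_mod_eq)
    ultimately have "2 * m + 1 - (- n) = 6 * (j + (if n = 1 then 1 else 0))" by auto
    then show ?thesis unfolding cong_iff_dvd_diff by simp
  qed
  have "cheb_diff 1 m2 \<noteq> 0" "cheb_diff 1 m3 \<noteq> 0" using k sq by (simp_all add: A2_def A3_def)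
  then show ?thesis using n last prod by auto
qed

section \<open>Links with three regions\<close>

context group
begin

lemma twist_eq_one:
  assumes [simp]: "l \<in> carrier G" "r \<in> carrier G" and "twist G l r n = \<one>"
  shows "(if even n then r else l) = \<one>"
proof -
  define c where "c = (l \<otimes> r) [^] (n div 2)"
  define x where "x = (if even n then r else l)"
  have [simp]: "c \<in> carrier G" "x \<in> carrier G" by (simp_all add: c_def x_def)
  have "c \<otimes> x \<otimes> inv c = \<one>" using assms(3) by (simp add: twist_def Let_def c_def x_def)
  then have "c \<otimes> x = c" using inv_solve_right[of "\<one>" "c \<otimes> x" c] by simp
  then show ?thesis using r_cancel_one by (simp add: x_def[symmetric])
qed

end

text \<open>One bottom relation: regions with \<open>p\<close> and \<open>q\<close> half twists stand side by side, and \<open>x\<close>, \<open>y\<close>, \<open>z\<close> are the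
left top meridians of these regions and of the one after them.\<close>

definition joins :: "('a, 'b) monoid_scheme \<Rightarrow> 'a \<Rightarrow> int \<Rightarrow> 'a \<Rightarrow> int \<Rightarrow> 'a \<Rightarrow> bool" where
  "joins G x p y q z \<longleftrightarrow> twist G x (inv\<^bsub>G\<^esub> y) p = inv\<^bsub>G\<^esub> twist G y (inv\<^bsub>G\<^esub> z) (q + 1)"

lemma all_less_3: "(\<forall>i<3. P i) \<longleftrightarrow> P 0 \<and> P 1 \<and> P (2::nat)"
  by (auto simp: less_Suc_eq numeral_3_eq_3 numeral_2_eq_2)

lemma three_cases: "i < 3 \<Longrightarrow> i = 0 \<or> i = 1 \<or> i = (2::nat)"
  by auto

lemma closes_up_three:
  "closes_up G [p, q, r] x \<longleftrightarrow> {x 0, x 1, x 2} \<subseteq> carrier G \<and>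
    joins G (x 0) p (x 1) q (x 2) \<and> joins G (x 1) q (x 2) r (x 0) \<and> joins G (x 2) r (x 0) p (x 1)"
proof -
  have idx: "length [p, q, r] = 3" "Suc 0 mod 3 = 1" "Suc 1 mod 3 = 2" "Suc 2 mod 3 = 0"
    "[p, q, r] ! 0 = p" "[p, q, r] ! 1 = q" "[p, q, r] ! 2 = r"
    by simp_all
  show ?thesis
    unfolding closes_up_def pretzel_arc_def joins_def idx all_less_3 insert_subset by blast
qed

lemma hom_joins:
  assumes "group G" "group H" "h \<in> hom G H" "x \<in> carrier G" "y \<in> carrier G" "z \<in> carrier G"
    and "joins G x p y q z"
  shows "joins H (h x) p (h y) q (h z)"
proof -
  interpret G: group G by fact
  interpret h: group_hom G H h
    using assms by (simp add: group_hom_def group_hom_axioms_def)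
  have "h (twist G x (inv\<^bsub>G\<^esub> y) p) = h (inv\<^bsub>G\<^esub> twist G y (inv\<^bsub>G\<^esub> z) (q + 1))"
    using assms by (simp add: joins_def)
  then show ?thesis using assms by (simp add: joins_def G.hom_twist)
qed

section \<open>Transvections of the integral plane\<close>

type_synonym int_matrix = "int \<times> int \<times> int \<times> int"

definition SL2Z :: "int_matrix monoid" where
  "SL2Z = \<lparr> carrier = {(a, b, c, d). a * d - b * c = 1},
    mult = (\<lambda>(a, b, c, d) (a', b', c', d').
      (a * a' + b * c', a * b' + b * d', c * a' + d * c', c * b' + d * d')),
    one = (1, 0, 0, 1) \<rparr>"

fun act :: "int_matrix \<Rightarrow> int \<times> int \<Rightarrow> int \<times> int" where
  "act (a, b, c, d) (x, y) = (a * x + b * y, c * x + d * y)"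

fun area :: "int \<times> int \<Rightarrow> int \<times> int \<Rightarrow> int" where
  "area (x, y) (x', y') = x * y' - y * x'"

fun comb :: "int \<Rightarrow> int \<times> int \<Rightarrow> int \<Rightarrow> int \<times> int \<Rightarrow> int \<times> int" where
  "comb a (x, y) b (x', y') = (a * x + b * x', a * y + b * y')"

text \<open>The matrix of the map that sends \<open>x\<close> to \<open>x + e * area v x * v\<close>. It depends on \<open>v\<close> only up to sign.\<close>

fun transvection :: "int \<Rightarrow> int \<times> int \<Rightarrow> int_matrix" where
  "transvection e (x, y) = (1 - e * x * y, e * x\<^sup>2, - e * y\<^sup>2, 1 + e * x * y)"

lemma SL2Z_mult [simp]:
  "(a, b, c, d) \<otimes>\<^bsub>SL2Z\<^esub> (a', b', c', d') =
    (a * a' + b * c', a * b' + b * d', c * a' + d * c', c * b' + d * d')"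
  by (simp add: SL2Z_def)

lemma SL2Z_carrier [simp]: "(a, b, c, d) \<in> carrier SL2Z \<longleftrightarrow> a * d - b * c = 1"
  by (simp add: SL2Z_def)

lemma SL2Z_one: "\<one>\<^bsub>SL2Z\<^esub> = (1, 0, 0, 1)"
  by (simp add: SL2Z_def)

lemma group_SL2Z: "group SL2Z"
proof (rule groupI)
  fix x y z
  show "x \<otimes>\<^bsub>SL2Z\<^esub> y \<in> carrier SL2Z" if "x \<in> carrier SL2Z" "y \<in> carrier SL2Z"
  proof -
    obtain a b c d a' b' c' d' where xy: "x = (a, b, c, d)" "y = (a', b', c', d')"
      by (cases x, cases y) auto
    have "(a * a' + b * c') * (c * b' + d * d') - (a * b' + b * d') * (c * a' + d * c') =
        (a * d - b * c) * (a' * d' - b' * c')"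
      by (simp add: algebra_simps)
    then show ?thesis using that by (simp only: xy SL2Z_mult SL2Z_carrier mult_1)
  qed
  show "x \<otimes>\<^bsub>SL2Z\<^esub> y \<otimes>\<^bsub>SL2Z\<^esub> z = x \<otimes>\<^bsub>SL2Z\<^esub> (y \<otimes>\<^bsub>SL2Z\<^esub> z)"
    by (cases x, cases y, cases z) (simp add: algebra_simps)
  show "\<exists>y\<in>carrier SL2Z. y \<otimes>\<^bsub>SL2Z\<^esub> x = \<one>\<^bsub>SL2Z\<^esub>" if "x \<in> carrier SL2Z"
  proof -
    obtain a b c d where x: "x = (a, b, c, d)" by (cases x) auto
    show ?thesis using that unfolding x
      by (intro bexI[of _ "(d, - b, - c, a)"]) (simp_all add: SL2Z_one mult.commute)
  qed
  show "\<one>\<^bsub>SL2Z\<^esub> \<otimes>\<^bsub>SL2Z\<^esub> x = x" by (cases x) (simp add: SL2Z_one)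
qed (simp add: SL2Z_one)

interpretation SL2Z: group SL2Z by (rule group_SL2Z)

lemma SL2Z_inv: "(a, b, c, d) \<in> carrier SL2Z \<Longrightarrow> inv\<^bsub>SL2Z\<^esub> (a, b, c, d) = (d, - b, - c, a)"
  by (rule SL2Z.inv_equality) (simp_all add: SL2Z_one mult.commute)

lemma act_mult: "act (g \<otimes>\<^bsub>SL2Z\<^esub> h) v = act g (act h v)"
  by (cases g, cases h, cases v) (simp add: algebra_simps)

lemma transvection_in_SL2Z [simp]: "transvection e v \<in> carrier SL2Z"
  by (cases v) (simp add: power2_eq_square algebra_simps)

lemma transvection_inv [simp]: "inv\<^bsub>SL2Z\<^esub> transvection e v = transvection (- e) v"
  using SL2Z_inv[of "1 - e * fst v * snd v" "e * (fst v)\<^sup>2" "- e * (snd v)\<^sup>2" "1 + e * fst v * snd v"]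
    transvection_in_SL2Z[of e v]
  by (cases v) simp

lemma conjugate_transvection:
  assumes "g \<in> carrier SL2Z"
  shows "g \<otimes>\<^bsub>SL2Z\<^esub> transvection e v \<otimes>\<^bsub>SL2Z\<^esub> inv\<^bsub>SL2Z\<^esub> g = transvection e (act g v)"
proof -
  obtain a b c d x y where gv: "g = (a, b, c, d)" "v = (x, y)" by (cases g, cases v) auto
  have det: "a * d - b * c = 1" using assms gv by simp
  have "a * (1 - e * x * y) + b * (- e * y\<^sup>2) =
      (1 - e * (a * x + b * y) * (c * x + d * y)) * a + e * (a * x + b * y)\<^sup>2 * c"
    "a * (e * x\<^sup>2) + b * (1 + e * x * y) =
      (1 - e * (a * x + b * y) * (c * x + d * y)) * b + e * (a * x + b * y)\<^sup>2 * d"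
    "c * (1 - e * x * y) + d * (- e * y\<^sup>2) =
      - e * (c * x + d * y)\<^sup>2 * a + (1 + e * (a * x + b * y) * (c * x + d * y)) * c"
    "c * (e * x\<^sup>2) + d * (1 + e * x * y) =
      - e * (c * x + d * y)\<^sup>2 * b + (1 + e * (a * x + b * y) * (c * x + d * y)) * d"
    using det by algebra+
  then have "g \<otimes>\<^bsub>SL2Z\<^esub> transvection e v = transvection e (act g v) \<otimes>\<^bsub>SL2Z\<^esub> g"
    by (simp only: gv transvection.simps act.simps SL2Z_mult)
  then show ?thesis using assms by (simp add: SL2Z.m_assoc)
qed

lemma transvection_eqD:
  assumes "e \<in> {1, -1}" "e' \<in> {1, -1}" and eq: "transvection e v = transvection e' v'"
  shows "\<exists>s\<in>{1, -1}. v = comb s v' 0 v'" and "transvection e v \<noteq> \<one>\<^bsub>SL2Z\<^esub> \<Longrightarrow> e = e'"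
proof -
  obtain x y x' y' where v: "v = (x, y)" "v' = (x', y')" by (cases v, cases v') auto
  have eqs: "e * x\<^sup>2 = e' * x'\<^sup>2" "e * y\<^sup>2 = e' * y'\<^sup>2" "e * x * y = e' * x' * y'"
    using eq by (simp_all add: v)
  show e: "e = e'" if "transvection e v \<noteq> \<one>\<^bsub>SL2Z\<^esub>"
  proof (rule ccontr)
    assume "e \<noteq> e'"
    then have "x\<^sup>2 = - x'\<^sup>2" "y\<^sup>2 = - y'\<^sup>2" using eqs assms by auto
    then have "x\<^sup>2 = 0" "y\<^sup>2 = 0"
      using zero_le_power2[of x'] zero_le_power2[of y'] zero_le_power2[of x] zero_le_power2[of y]
      by linarith+
    then show False using that by (simp add: v SL2Z_one)
  qed
  show "\<exists>s\<in>{1, -1}. v = comb s v' 0 v'"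
  proof (cases "transvection e v = \<one>\<^bsub>SL2Z\<^esub>")
    case True
    then have "e * x\<^sup>2 = 0" "e * y\<^sup>2 = 0" by (simp_all add: v SL2Z_one)
    moreover have "e \<noteq> 0" "e' \<noteq> 0" using assms(1,2) by auto
    ultimately have "x = 0" "y = 0" "x' = 0" "y' = 0" using eqs(1,2) by simp_all
    then show ?thesis by (auto simp: v)
  next
    case False
    then have "x\<^sup>2 = x'\<^sup>2" "y\<^sup>2 = y'\<^sup>2" "x * y = x' * y'" using e eqs assms by auto
    then have "x = x' \<and> y = y' \<or> x = - x' \<and> y = - y'" by (auto simp: power2_eq_iff)
    then show ?thesis by (auto simp: v)
  qed
qed

lemma SL2Z_int_pow:
  fixes n :: int
  assumes "(a, b, c, d) \<in> carrier SL2Z"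
  shows "(a, b, c, d) [^]\<^bsub>SL2Z\<^esub> n =
    (cheb (a + d) n * a - cheb (a + d) (n - 1), cheb (a + d) n * b, cheb (a + d) n * c,
      cheb (a + d) n * d - cheb (a + d) (n - 1))"
    (is "?g [^]\<^bsub>SL2Z\<^esub> n = ?p n")
proof -
  have det: "a * d - b * c = 1" using assms by simp
  have step: "?p (n + 1) = ?p n \<otimes>\<^bsub>SL2Z\<^esub> ?g" for n
  proof -
    define S S' T where "S = cheb (a + d) n" and "S' = cheb (a + d) (n - 1)"
      and "T = cheb (a + d) (n + 1)"
    have "T = (a + d) * S - S'" unfolding T_def S_def S'_def by (rule cheb_rec)
    then have "T * a - S = (S * a - S') * a + S * b * c" "T * b = (S * a - S') * b + S * b * d"
      "T * c = S * c * a + (S * d - S') * c" "T * d - S = S * c * b + (S * d - S') * d"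
      using det by algebra+
    then show ?thesis by (simp add: S_def S'_def T_def)
  qed
  show ?thesis
  proof (induction n rule: int_induct[where k = 0])
    case base
    then show ?case using cheb_minus[of "a + d" 1] by (simp add: SL2Z_one)
  next
    case (step1 i)
    have "?g [^]\<^bsub>SL2Z\<^esub> (i + 1) = ?g [^]\<^bsub>SL2Z\<^esub> i \<otimes>\<^bsub>SL2Z\<^esub> ?g"
      using SL2Z.int_pow_mult[OF assms, of i 1] assms by (simp del: SL2Z_mult)
    then show ?case using step1(2) step[of i] by (simp only:)
  next
    case (step2 i)
    have "?g [^]\<^bsub>SL2Z\<^esub> (i - 1) \<otimes>\<^bsub>SL2Z\<^esub> ?g = ?g [^]\<^bsub>SL2Z\<^esub> i"
      using SL2Z.int_pow_mult[OF assms, of "i - 1" 1] assms by (simp del: SL2Z_mult)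
    also have "\<dots> = ?p (i - 1) \<otimes>\<^bsub>SL2Z\<^esub> ?g" using step2(2) step[of "i - 1"] by simp
    finally have *: "?g [^]\<^bsub>SL2Z\<^esub> (i - 1) \<otimes>\<^bsub>SL2Z\<^esub> ?g = ?p (i - 1) \<otimes>\<^bsub>SL2Z\<^esub> ?g" .
    have "?g [^]\<^bsub>SL2Z\<^esub> (i - 1) = ?p (i - 1)"
    proof -
      have "x = y" if "x \<otimes>\<^bsub>SL2Z\<^esub> ?g = y \<otimes>\<^bsub>SL2Z\<^esub> ?g" for x y
      proof -
        have assoc: "z \<otimes>\<^bsub>SL2Z\<^esub> ?g \<otimes>\<^bsub>SL2Z\<^esub> (d, - b, - c, a) = z" for z
        proof -
          obtain z1 z2 z3 z4 where z: "z = (z1, z2, z3, z4)" by (cases z) auto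
          have "(z1 * a + z2 * c) * d + (z1 * b + z2 * d) * - c = z1"
            "(z1 * a + z2 * c) * - b + (z1 * b + z2 * d) * a = z2"
            "(z3 * a + z4 * c) * d + (z3 * b + z4 * d) * - c = z3"
            "(z3 * a + z4 * c) * - b + (z3 * b + z4 * d) * a = z4"
            using det by algebra+
          then show ?thesis by (simp add: z)
        qed
        show ?thesis using that assoc by metis
      qed
      then show ?thesis using * by blast
    qed
    then show ?case .
  qed
qed

lemma act_int_pow:
  fixes n :: int
  assumes "(a, b, c, d) \<in> carrier SL2Z"
  shows "act ((a, b, c, d) [^]\<^bsub>SL2Z\<^esub> n) v =
    comb (cheb (a + d) n) (act (a, b, c, d) v) (- cheb (a + d) (n - 1)) v"
  by (cases v) (simp add: SL2Z_int_pow[OF assms] algebra_simps)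

lemma act_transvection: "act (transvection e u) v = comb 1 v (e * area u v) u"
  by (cases u, cases v) (simp add: power2_eq_square algebra_simps)

text \<open>The product of the two transvections has trace \<open>t\<close> and preserves the lattice spanned by \<open>u\<close> and \<open>v\<close>, so
the theorem of Cayley and Hamilton (\<open>act_int_pow\<close>) expresses its powers on this lattice.\<close>

lemma act_pair_power:
  fixes e d m :: int and u v :: "int \<times> int"
  assumes "e \<in> {1, -1}" "d \<in> {1, -1}"
  defines "k \<equiv> area u v" and "g \<equiv> transvection e u \<otimes>\<^bsub>SL2Z\<^esub> transvection (- d) v"
  defines "t \<equiv> 2 + e * d * k\<^sup>2"
  shows "act (g [^]\<^bsub>SL2Z\<^esub> m) u = comb (cheb_diff t m) u (d * k * cheb t m) v"
    and "act (g [^]\<^bsub>SL2Z\<^esub> m) v = comb (e * k * cheb t m) u (cheb_diff t (m - 1)) v"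
proof -
  obtain a b c f where g: "g = (a, b, c, f)" by (cases g) auto
  obtain x y x' y' where uv: "u = (x, y)" "v = (x', y')" by (cases u, cases v) auto
  have af: "a = (1 - e * x * y) * (1 - (- d) * x' * y') + e * x\<^sup>2 * (- (- d) * y'\<^sup>2)"
    "f = (- e * y\<^sup>2) * (- d * x'\<^sup>2) + (1 + e * x * y) * (1 + (- d) * x' * y')"
    using g unfolding g_def uv transvection.simps SL2Z_mult prod.inject by blast+
  have tr: "a + f = t"
    unfolding af t_def k_def uv by (simp add: power2_eq_square algebra_simps)
  have g_in: "(a, b, c, f) \<in> carrier SL2Z"
    unfolding g[symmetric] g_def by (intro SL2Z.m_closed transvection_in_SL2Z)
  have gu: "act g u = comb (t - 1) u (d * k) v"
    unfolding g_def act_mult act_transvection t_def k_def uv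
    by (simp add: power2_eq_square algebra_simps)
  have gv: "act g v = comb (e * k) u 1 v"
    unfolding g_def act_mult act_transvection k_def uv
    by (simp add: power2_eq_square algebra_simps)
  have comb: "comb r (comb p u q v) s u = comb (r * p + s) u (r * q) v"
    "comb r (comb p u q v) s v = comb (r * p) u (r * q + s) v" for p q r s
    by (simp_all add: uv algebra_simps)
  show "act (g [^]\<^bsub>SL2Z\<^esub> m) u = comb (cheb_diff t m) u (d * k * cheb t m) v"
    using act_int_pow[OF g_in, of m u] unfolding tr cheb_diff_def cheb_rec
    by (simp add: g[symmetric] gu comb algebra_simps)
  show "act (g [^]\<^bsub>SL2Z\<^esub> m) v = comb (e * k * cheb t m) u (cheb_diff t (m - 1)) v"
    using act_int_pow[OF g_in, of m v] unfolding tr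
    by (simp add: g[symmetric] gv comb cheb_diff_def algebra_simps)
qed

lemma twist_transvections:
  fixes e d m :: int and u v :: "int \<times> int"
  assumes "e \<in> {1, -1}" "d \<in> {1, -1}"
  defines "k \<equiv> area u v"
  defines "t \<equiv> 2 + e * d * k\<^sup>2"
  shows "twist SL2Z (transvection e u) (transvection (- d) v) (2 * m + 1) =
      transvection e (comb (cheb_diff t m) u (d * k * cheb t m) v)"
    and "twist SL2Z (transvection e u) (transvection (- d) v) (2 * m) =
      transvection (- d) (comb (e * k * cheb t m) u (cheb_diff t (m - 1)) v)"
proof -
  define g where "g = (transvection e u \<otimes>\<^bsub>SL2Z\<^esub> transvection (- d) v) [^]\<^bsub>SL2Z\<^esub> m"
  have g: "g \<in> carrier SL2Z"
    unfolding g_def by (intro SL2Z.int_pow_closed SL2Z.m_closed transvection_in_SL2Z)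
  have "(2 * m + 1) div 2 = m" by simp
  then have "twist SL2Z (transvection e u) (transvection (- d) v) (2 * m + 1) =
      g \<otimes>\<^bsub>SL2Z\<^esub> transvection e u \<otimes>\<^bsub>SL2Z\<^esub> inv\<^bsub>SL2Z\<^esub> g"
    unfolding twist_def Let_def g_def by simp
  then show "twist SL2Z (transvection e u) (transvection (- d) v) (2 * m + 1) =
      transvection e (comb (cheb_diff t m) u (d * k * cheb t m) v)"
    unfolding conjugate_transvection[OF g] unfolding g_def act_pair_power(1)[OF assms(1,2)]
    unfolding k_def t_def .
  have "twist SL2Z (transvection e u) (transvection (- d) v) (2 * m) =
      g \<otimes>\<^bsub>SL2Z\<^esub> transvection (- d) v \<otimes>\<^bsub>SL2Z\<^esub> inv\<^bsub>SL2Z\<^esub> g"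
    unfolding twist_def Let_def g_def by simp
  then show "twist SL2Z (transvection e u) (transvection (- d) v) (2 * m) =
      transvection (- d) (comb (e * k * cheb t m) u (cheb_diff t (m - 1)) v)"
    unfolding conjugate_transvection[OF g] unfolding g_def act_pair_power(2)[OF assms(1,2)]
    unfolding k_def t_def .
qed

text \<open>Pair both sides with \<open>v\<close> and with \<open>u\<close>.\<close>

lemma combs_parallel:
  assumes s: "s \<in> {1, -1}" and eq: "comb A u B v = comb s (comb D v A' w) 0 z"
  shows "A * area u v = - s * A' * area v w"
    and "B * area u v = s * (D * area u v - A' * area w u)"
proof -
  obtain x y x' y' x'' y'' where v: "u = (x, y)" "v = (x', y')" "w = (x'', y'')"
    by (cases u, cases v, cases w) auto
  have *: "A * x + B * x' = s * (D * x' + A' * x'')" "A * y + B * y' = s * (D * y' + A' * y'')"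
    using eq by (cases z, simp add: v)+
  have "A * area u v = (A * x + B * x') * y' - (A * y + B * y') * x'"
    by (simp add: v algebra_simps)
  then show "A * area u v = - s * A' * area v w"
    unfolding * by (simp add: v algebra_simps)
  have "B * area u v = x * (A * y + B * y') - y * (A * x + B * x')"
    by (simp add: v algebra_simps)
  then show "B * area u v = s * (D * area u v - A' * area w u)"
    unfolding * by (simp add: v algebra_simps)
qed

section \<open>Triples of transvections that close up\<close>

lemma transvection_neq_one:
  assumes "e \<in> {1, -1}" "v \<noteq> (0, 0)"
  shows "transvection e v \<noteq> \<one>\<^bsub>SL2Z\<^esub>"
proof
  assume *: "transvection e v = \<one>\<^bsub>SL2Z\<^esub>"
  obtain x y where v: "v = (x, y)" by (cases v)
  have "e * x\<^sup>2 = 0" "e * y\<^sup>2 = 0" using * by (simp_all add: v SL2Z_one)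
  then show False using assms v by auto
qed

lemma twist_transvections_neq_one:
  assumes "e \<in> {1, -1}" "d \<in> {1, -1}" "u \<noteq> (0, 0)" "v \<noteq> (0, 0)"
  shows "twist SL2Z (transvection e u) (transvection (- d) v) n \<noteq> \<one>\<^bsub>SL2Z\<^esub>"
  using SL2Z.twist_eq_one[of "transvection e u" "transvection (- d) v" n]
    transvection_neq_one[OF assms(1,3)] transvection_neq_one[of "- d" v] assms
  by (auto split: if_splits)

text \<open>A transvection other than 1 determines its sign \<open>e\<close>, and its vector up to sign, so an equation between
transvections is one between vectors.\<close>

lemma closing_scalars:
  assumes ab: "a \<in> {1, -1}" "b \<in> {1, -1}"
    and eq: "transvection a (comb A v1 B v2) = inv\<^bsub>SL2Z\<^esub> transvection b (comb D v2 A' v3)"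
    and neq: "transvection a (comb A v1 B v2) \<noteq> \<one>\<^bsub>SL2Z\<^esub>"
  shows "b = - a"
    and "\<exists>s\<in>{1, -1}. A * area v1 v2 = - s * A' * area v2 v3 \<and>
      B * area v1 v2 = s * (D * area v1 v2 - A' * area v3 v1)"
proof -
  have eq': "transvection a (comb A v1 B v2) = transvection (- b) (comb D v2 A' v3)"
    using eq by simp
  have b': "- b \<in> {1, -1}" using ab by auto
  show "b = - a" using transvection_eqD(2)[OF ab(1) b' eq' neq] by simp
  obtain s where s: "s \<in> {1, -1}" "comb A v1 B v2 = comb s (comb D v2 A' v3) 0 (comb D v2 A' v3)"
    using transvection_eqD(1)[OF ab(1) b' eq'] by blast
  show "\<exists>s\<in>{1, -1}. A * area v1 v2 = - s * A' * area v2 v3 \<and>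
      B * area v1 v2 = s * (D * area v1 v2 - A' * area v3 v1)"
    using combs_parallel[OF s] s(1) by blast
qed

context
  fixes e1 e2 e3 :: int and v1 v2 v3 :: "int \<times> int" and k1 k2 k3 t1 t2 :: int
  assumes e: "e1 \<in> {1, -1}" "e2 \<in> {1, -1}" "e3 \<in> {1, -1}"
    and v: "v1 \<noteq> (0, 0)" "v2 \<noteq> (0, 0)" "v3 \<noteq> (0, 0)"
  defines "k1 \<equiv> area v1 v2" and "k2 \<equiv> area v2 v3" and "k3 \<equiv> area v3 v1"
    and "t1 \<equiv> 2 + e1 * e2 * k1\<^sup>2" and "t2 \<equiv> 2 + e2 * e3 * k2\<^sup>2"
begin

lemma minus_signs: "- e2 \<in> {1, -1}" "- e3 \<in> {1, -1}"
  using e by auto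

text \<open>In an odd region the right bottom meridian has the orientation of the left top one, in an even region
that of the right top one. This is where the signs \<open>e1\<close>, \<open>e2\<close>, \<open>e3\<close> of a triple that closes up get related.\<close>

lemma joins_odd_odd:
  assumes "joins SL2Z (transvection e1 v1) (2 * m + 1) (transvection e2 v2) (2 * n + 1) (transvection e3 v3)"
  shows "e1 = e3"
    and "\<exists>s\<in>{1, -1}. cheb_diff t1 m * k1 = - s * cheb_diff t2 n * k2 \<and>
      (e2 * k1 * cheb t1 m) * k1 = s * ((e2 * k2 * cheb t2 (n + 1)) * k1 - cheb_diff t2 n * k3)"
proof -
  have idx: "2 * n + 1 + 1 = 2 * (n + 1)" by simp
  have eq: "transvection e1 (comb (cheb_diff t1 m) v1 (e2 * k1 * cheb t1 m) v2) =
      inv\<^bsub>SL2Z\<^esub> transvection (- e3) (comb (e2 * k2 * cheb t2 (n + 1)) v2 (cheb_diff t2 n) v3)"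
    using assms unfolding joins_def transvection_inv idx
      twist_transvections(1)[OF e(1,2)] twist_transvections(2)[OF e(2,3)]
    by (simp add: k1_def k2_def t1_def t2_def)
  have neq: "transvection e1 (comb (cheb_diff t1 m) v1 (e2 * k1 * cheb t1 m) v2) \<noteq> \<one>\<^bsub>SL2Z\<^esub>"
    using twist_transvections_neq_one[OF e(1,2) v(1,2), of "2 * m + 1"]
      twist_transvections(1)[OF e(1,2), of v1 v2 m] by (simp add: k1_def t1_def)
  show "e1 = e3" using closing_scalars(1)[OF e(1) minus_signs(2) eq neq] by simp
  show "\<exists>s\<in>{1, -1}. cheb_diff t1 m * k1 = - s * cheb_diff t2 n * k2 \<and>
      (e2 * k1 * cheb t1 m) * k1 = s * ((e2 * k2 * cheb t2 (n + 1)) * k1 - cheb_diff t2 n * k3)"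
    using closing_scalars(2)[OF e(1) minus_signs(2) eq neq] unfolding k1_def k2_def k3_def .
qed

lemma joins_even_odd:
  assumes "joins SL2Z (transvection e1 v1) (2 * m) (transvection e2 v2) (2 * n + 1) (transvection e3 v3)"
  shows "e3 = - e2"
    and "\<exists>s\<in>{1, -1}. (e1 * k1 * cheb t1 m) * k1 = - s * cheb_diff t2 n * k2 \<and>
      cheb_diff t1 (m - 1) * k1 = s * ((e2 * k2 * cheb t2 (n + 1)) * k1 - cheb_diff t2 n * k3)"
proof -
  have idx: "2 * n + 1 + 1 = 2 * (n + 1)" by simp
  have eq: "transvection (- e2) (comb (e1 * k1 * cheb t1 m) v1 (cheb_diff t1 (m - 1)) v2) =
      inv\<^bsub>SL2Z\<^esub> transvection (- e3) (comb (e2 * k2 * cheb t2 (n + 1)) v2 (cheb_diff t2 n) v3)"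
    using assms unfolding joins_def transvection_inv idx
      twist_transvections(2)[OF e(1,2)] twist_transvections(2)[OF e(2,3)]
    by (simp add: k1_def k2_def t1_def t2_def)
  have neq: "transvection (- e2) (comb (e1 * k1 * cheb t1 m) v1 (cheb_diff t1 (m - 1)) v2) \<noteq> \<one>\<^bsub>SL2Z\<^esub>"
    using twist_transvections_neq_one[OF e(1,2) v(1,2), of "2 * m"]
      twist_transvections(2)[OF e(1,2), of v1 v2 m] by (simp add: k1_def t1_def)
  show "e3 = - e2" using closing_scalars(1)[OF minus_signs eq neq] by simp
  show "\<exists>s\<in>{1, -1}. (e1 * k1 * cheb t1 m) * k1 = - s * cheb_diff t2 n * k2 \<and>
      cheb_diff t1 (m - 1) * k1 = s * ((e2 * k2 * cheb t2 (n + 1)) * k1 - cheb_diff t2 n * k3)"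
    using closing_scalars(2)[OF minus_signs eq neq] unfolding k1_def k2_def k3_def .
qed

lemma joins_odd_even:
  assumes "joins SL2Z (transvection e1 v1) (2 * m + 1) (transvection e2 v2) (2 * n) (transvection e3 v3)"
  shows "\<exists>s\<in>{1, -1}. cheb_diff t1 m * k1 = - s * (e3 * k2 * cheb t2 n) * k2 \<and>
      (e2 * k1 * cheb t1 m) * k1 = s * (cheb_diff t2 n * k1 - (e3 * k2 * cheb t2 n) * k3)"
proof -
  have eq: "transvection e1 (comb (cheb_diff t1 m) v1 (e2 * k1 * cheb t1 m) v2) =
      inv\<^bsub>SL2Z\<^esub> transvection e2 (comb (cheb_diff t2 n) v2 (e3 * k2 * cheb t2 n) v3)"
    using assms twist_transvections(1)[OF e(1,2), of v1 v2 m]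
      twist_transvections(1)[OF e(2,3), of v2 v3 n]
    unfolding joins_def transvection_inv k1_def k2_def t1_def t2_def by simp
  have neq: "transvection e1 (comb (cheb_diff t1 m) v1 (e2 * k1 * cheb t1 m) v2) \<noteq> \<one>\<^bsub>SL2Z\<^esub>"
    using twist_transvections_neq_one[OF e(1,2) v(1,2), of "2 * m + 1"]
      twist_transvections(1)[OF e(1,2), of v1 v2 m] by (simp add: k1_def t1_def)
  show ?thesis
    using closing_scalars(2)[OF e(1,2) eq neq] unfolding k1_def k2_def k3_def .
qed

end

lemma transvections_close_up_odd:
  assumes e: "e1 \<in> {1, -1}" "e2 \<in> {1, -1}" "e3 \<in> {1, -1}"
    and v: "v1 \<noteq> (0, 0)" "v2 \<noteq> (0, 0)" "v3 \<noteq> (0, 0)"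
    and "odd p" "odd q" "odd r"
    and j: "joins SL2Z (transvection e1 v1) p (transvection e2 v2) q (transvection e3 v3)"
      "joins SL2Z (transvection e2 v2) q (transvection e3 v3) r (transvection e1 v1)"
      "joins SL2Z (transvection e3 v3) r (transvection e1 v1) p (transvection e2 v2)"
    and nontrivial: "area v1 v2 \<noteq> 0 \<or> area v2 v3 \<noteq> 0 \<or> area v3 v1 \<noteq> 0"
  shows "\<exists>\<sigma>\<in>{1, -1}. (\<sigma> * p, \<sigma> * q, \<sigma> * r) \<in> {(1, 1, 1), (3, 3, -1), (3, -1, 3), (-1, 3, 3)}"
proof -
  obtain m1 m2 m3 where m: "p = 2 * m1 + 1" "q = 2 * m2 + 1" "r = 2 * m3 + 1"
    using \<open>odd p\<close> \<open>odd q\<close> \<open>odd r\<close> by (meson oddE)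
  note join1 = joins_odd_odd[OF e v j(1)[unfolded m]]
    and join2 = joins_odd_odd[OF e(2,3,1) v(2,3,1) j(2)[unfolded m]]
    and join3 = joins_odd_odd[OF e(3,1,2) v(3,1,2) j(3)[unfolded m]]
  have ee: "e2 = e1" "e3 = e1" using join1(1) join2(1) by simp_all
  have sq: "e1 * e1 * x = x" for x using e by auto
  let ?k1 = "area v1 v2" and ?k2 = "area v2 v3" and ?k3 = "area v3 v1"
  obtain s1 s2 s3 where s: "s1 \<in> {1, -1}" "s2 \<in> {1, -1}" "s3 \<in> {1, -1}"
    and eqs: "cheb_diff (2 + ?k1\<^sup>2) m1 * ?k1 =
        - s1 * cheb_diff (2 + ?k2\<^sup>2) m2 * ?k2"
      "(e1 * ?k1 * cheb (2 + ?k1\<^sup>2) m1) * ?k1 =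
        s1 * ((e1 * ?k2 * cheb (2 + ?k2\<^sup>2) (m2 + 1)) * ?k1
          - cheb_diff (2 + ?k2\<^sup>2) m2 * ?k3)"
      "cheb_diff (2 + ?k2\<^sup>2) m2 * ?k2 =
        - s2 * cheb_diff (2 + ?k3\<^sup>2) m3 * ?k3"
      "(e1 * ?k2 * cheb (2 + ?k2\<^sup>2) m2) * ?k2 =
        s2 * ((e1 * ?k3 * cheb (2 + ?k3\<^sup>2) (m3 + 1)) * ?k2
          - cheb_diff (2 + ?k3\<^sup>2) m3 * ?k1)"
      "cheb_diff (2 + ?k3\<^sup>2) m3 * ?k3 =
        - s3 * cheb_diff (2 + ?k1\<^sup>2) m1 * ?k1"
      "(e1 * ?k3 * cheb (2 + ?k3\<^sup>2) m3) * ?k3 =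
        s3 * ((e1 * ?k1 * cheb (2 + ?k1\<^sup>2) (m1 + 1)) * ?k3
          - cheb_diff (2 + ?k1\<^sup>2) m1 * ?k2)"
    using join1(2) join2(2) join3(2) unfolding ee sq by blast
  show ?thesis unfolding m
    by (rule odd_closing_system[OF e(1) s eqs(1,3,5) eqs(2,4,6) nontrivial])
qed

lemma transvections_close_up_even:
  assumes e: "e1 \<in> {1, -1}" "e2 \<in> {1, -1}" "e3 \<in> {1, -1}"
    and v: "v1 \<noteq> (0, 0)" "v2 \<noteq> (0, 0)" "v3 \<noteq> (0, 0)"
    and "even p" "p \<noteq> 0" "odd q" "odd r"
    and j: "joins SL2Z (transvection e1 v1) p (transvection e2 v2) q (transvection e3 v3)"
      "joins SL2Z (transvection e2 v2) q (transvection e3 v3) r (transvection e1 v1)"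
      "joins SL2Z (transvection e3 v3) r (transvection e1 v1) p (transvection e2 v2)"
    and nontrivial: "odd (area v1 v2)"
  shows "\<exists>\<epsilon>\<in>{1, -1}. p = 2 * \<epsilon> \<and> [q = - \<epsilon>] (mod 6) \<and> [r = - \<epsilon>] (mod 6)"
proof -
  obtain n m2 m3 where m: "p = 2 * n" "q = 2 * m2 + 1" "r = 2 * m3 + 1"
    using \<open>even p\<close> \<open>odd q\<close> \<open>odd r\<close> by (meson oddE evenE)
  have "n \<noteq> 0" using m \<open>p \<noteq> 0\<close> by simp
  note join1 = joins_even_odd[OF e v j(1)[unfolded m]]
    and join2 = joins_odd_odd[OF e(2,3,1) v(2,3,1) j(2)[unfolded m]]
    and join3 = joins_odd_even[OF e(3,1,2) v(3,1,2) j(3)[unfolded m]]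
  have ee: "e2 = e1" "e3 = - e1" using join1(1) join2(1) by simp_all
  have sq: "2 + e1 * e1 * x = 2 + x" "2 + e1 * - e1 * x = 2 - x" "2 + - e1 * e1 * x = 2 - x" for x
    using e by auto
  let ?k1 = "area v1 v2" and ?k2 = "area v2 v3" and ?k3 = "area v3 v1"
  obtain s1 s2 s3 where s: "s1 \<in> {1, -1}" "s2 \<in> {1, -1}" "s3 \<in> {1, -1}"
    and eqs: "(e1 * ?k1 * cheb (2 + ?k1\<^sup>2) n) * ?k1 =
        - s1 * cheb_diff (2 - ?k2\<^sup>2) m2 * ?k2"
      "cheb_diff (2 + ?k1\<^sup>2) (n - 1) * ?k1 =
        s1 * ((e1 * ?k2 * cheb (2 - ?k2\<^sup>2) (m2 + 1)) * ?k1
          - cheb_diff (2 - ?k2\<^sup>2) m2 * ?k3)"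
      "cheb_diff (2 - ?k2\<^sup>2) m2 * ?k2 =
        - s2 * cheb_diff (2 - ?k3\<^sup>2) m3 * ?k3"
      "(- e1 * ?k2 * cheb (2 - ?k2\<^sup>2) m2) * ?k2 =
        s2 * ((- e1 * ?k3 * cheb (2 - ?k3\<^sup>2) (m3 + 1)) * ?k2
          - cheb_diff (2 - ?k3\<^sup>2) m3 * ?k1)"
      "cheb_diff (2 - ?k3\<^sup>2) m3 * ?k3 =
        - s3 * (e1 * ?k1 * cheb (2 + ?k1\<^sup>2) n) * ?k1"
      "(e1 * ?k3 * cheb (2 - ?k3\<^sup>2) m3) * ?k3 =
        s3 * (cheb_diff (2 + ?k1\<^sup>2) n * ?k3
          - (e1 * ?k1 * cheb (2 + ?k1\<^sup>2) n) * ?k2)"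
    using join1(2) join2(2) join3 unfolding ee sq by blast
  obtain \<epsilon> where "\<epsilon> \<in> {1, -1}" "n = \<epsilon>" "[2 * m2 + 1 = - \<epsilon>] (mod 6)" "[2 * m3 + 1 = - \<epsilon>] (mod 6)"
    using even_closing_system[OF e(1) s eqs(1,3,5) eqs(2,4,6) nontrivial \<open>n \<noteq> 0\<close>] by blast
  then show ?thesis unfolding m by blast
qed

section \<open>Transpositions as reflections of a triangle\<close>

text \<open>The reflection of the triangle with vertices 1, 2, 3 that fixes the vertex congruent to \<open>c\<close> modulo 3.\<close>

definition reflection :: "int \<Rightarrow> nat \<Rightarrow> nat" where
  "reflection c = (if c mod 3 = 0 then transpose 1 2 else if c mod 3 = 1 then transpose 2 3
    else transpose 1 3)"

lemma mod_3_cases: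
  fixes c :: int
  obtains "c mod 3 = 0" | "c mod 3 = 1" | "c mod 3 = 2"
proof -
  have "c mod 3 \<in> {0..<3}" by simp
  also have "{0..<3::int} = {0, 1, 2}" by auto
  finally show ?thesis using that by auto
qed

lemma group_S3: "group S3"
  by (rule sym_group_is_group)

interpretation S3: group S3 by (rule group_S3)

lemma reflection_in_S3 [simp]: "reflection c \<in> carrier S3"
  by (auto simp: reflection_def sym_group_carrier intro!: permutes_swap_id)

lemma reflection_cong: "[c = c'] (mod 3) \<Longrightarrow> reflection c = reflection c'"
  by (simp add: reflection_def cong_def)

lemma reflection_eq_iff: "reflection c = reflection c' \<longleftrightarrow> [c = c'] (mod 3)"
proof
  assume *: "reflection c = reflection c'"
  have "reflection c 1 = reflection c' 1" "reflection c 2 = reflection c' 2" using * by simp_all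
  then show "[c = c'] (mod 3)"
    by (cases c rule: mod_3_cases; cases c' rule: mod_3_cases)
      (simp_all add: reflection_def cong_def transpose_def)
qed (rule reflection_cong)

lemma range_reflection: "range reflection = transpositions3"
proof
  show "range reflection \<subseteq> transpositions3"
    by (force simp: reflection_def transpositions3_def)
  have "reflection 0 = transpose 1 2" "reflection 1 = transpose 2 3" "reflection 2 = transpose 1 3"
    by (simp_all add: reflection_def)
  moreover have "a \<in> {1..3} \<Longrightarrow> a = 1 \<or> a = 2 \<or> a = 3" for a :: nat by auto
  ultimately show "transpositions3 \<subseteq> range reflection"
    unfolding transpositions3_def
    by (smt (verit, best) mem_Collect_eq rangeI subsetI transpose_commute)
qed

lemma reflection_involution [simp]: "reflection c \<circ> reflection c = id"
  by (auto simp: reflection_def fun_eq_iff)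

lemma inv_reflection [simp]: "inv\<^bsub>S3\<^esub> reflection c = reflection c"
  by (rule S3.inv_equality) (simp_all add: sym_group_mult sym_group_one)

lemma reflection_conjugate: "reflection a \<circ> reflection b \<circ> reflection a = reflection (2 * a - b)"
proof -
  have "[2 * a - b = 2 * (a mod 3) - b mod 3] (mod 3)"
    by (intro cong_diff cong_mult) (simp_all add: cong_def)
  then have "(2 * a - b) mod 3 = (2 * (a mod 3) - b mod 3) mod 3" by (simp only: cong_def)
  then show ?thesis
    by (cases a rule: mod_3_cases; cases b rule: mod_3_cases)
      (auto simp: reflection_def fun_eq_iff transpose_def)
qed

lemma reflection_exchange: "reflection a \<circ> reflection b = reflection (2 * a - b) \<circ> reflection a"
  unfolding reflection_conjugate[symmetric] by (simp add: comp_assoc)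

text \<open>The strands of a region are labelled by an arithmetic progression modulo 3, as in Fox colorings.\<close>

lemma twist_reflections:
  "twist S3 (reflection a) (reflection b) n = reflection (b + n * (a - b))"
proof -
  define f where "f = (\<lambda>n. reflection (b + n * (a - b)))"
  have shift: "f (n + 1) \<circ> f n = f (n + 1 + 1) \<circ> f (n + 1)" for n
  proof -
    have "2 * (b + (n + 1) * (a - b)) - (b + n * (a - b)) = b + (n + 1 + 1) * (a - b)"
      by (simp add: algebra_simps)
    then show ?thesis unfolding f_def by (metis reflection_exchange)
  qed
  have "f (n + 1) \<circ> f n = reflection a \<circ> reflection b" for n
  proof (induction n rule: int_induct[where k = 0])
    case base
    then show ?case by (simp add: f_def)
  next
    case (step1 i)
    then show ?case using shift[of i] by simp
  next
    case (step2 i)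
    then show ?case using shift[of "i - 1"] by simp
  qed
  then have "twist S3 (reflection a) (reflection b) n = f n"
    by (intro S3.twist_eqI) (simp_all add: f_def sym_group_mult)
  then show ?thesis by (simp add: f_def)
qed

lemma joins_reflections:
  "joins S3 (reflection a) p (reflection b) q (reflection c) \<longleftrightarrow> [p * (a - b) = q * (b - c)] (mod 3)"
proof -
  have "b + p * (a - b) - (c + (q + 1) * (b - c)) = p * (a - b) - q * (b - c)"
    by (simp add: algebra_simps)
  then show ?thesis
    by (simp only: joins_def twist_reflections reflection_eq_iff cong_iff_dvd_diff inv_reflection)
qed

section \<open>The braid group on three strands\<close>

lemma group_B3: "group B3"
  by (simp add: B3_def group_presented_group)

interpretation B3: group B3 by (rule group_B3)

lemma artin_generator_in_B3 [simp]:
  "artin_generator (Suc 0) \<in> carrier B3" "artin_generator 1 \<in> carrier B3" "artin_generator 2 \<in> carrier B3"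
  by (simp_all add: artin_generator_def B3_def generator_in_carrier)

lemma braid_relation:
  "artin_generator 1 \<otimes>\<^bsub>B3\<^esub> artin_generator 2 \<otimes>\<^bsub>B3\<^esub> artin_generator 1 =
    artin_generator 2 \<otimes>\<^bsub>B3\<^esub> artin_generator 1 \<otimes>\<^bsub>B3\<^esub> artin_generator 2"
proof -
  have "([(1, True), (2, True), (1, True)], [(2, True), (1, True), (2, True)])
      \<in> word_equiv {1, 2} braid_relations3"
    using word_equiv.relation[of "[]" "{1, 2}" "[]" "[(1, True), (2, True), (1, True)]"
        "[(2, True), (1, True), (2, True)]" braid_relations3]
    by (simp add: braid_relations3_def)
  then show ?thesis
    using equiv_class_eq[OF equiv_word_equiv]
    by (simp add: B3_def artin_generator_def generator_def presented_group_mult_class)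
qed

lemma conjugates_pmI:
  "g \<in> carrier G \<Longrightarrow> y \<in> {x, inv\<^bsub>G\<^esub> x} \<Longrightarrow> g \<otimes>\<^bsub>G\<^esub> y \<otimes>\<^bsub>G\<^esub> inv\<^bsub>G\<^esub> g \<in> conjugates_pm G x"
  unfolding conjugates_pm_def by blast

lemma (in group) conjugates_pm_normal:
  assumes x: "x \<in> carrier G"
  shows "conjugates_pm G x \<subseteq> carrier G" "x \<in> conjugates_pm G x"
    "v \<in> conjugates_pm G x \<Longrightarrow> inv v \<in> conjugates_pm G x"
    "g \<in> carrier G \<Longrightarrow> v \<in> conjugates_pm G x \<Longrightarrow> g \<otimes> v \<otimes> inv g \<in> conjugates_pm G x"
proof -
  show "conjugates_pm G x \<subseteq> carrier G" using x by (auto simp: conjugates_pm_def)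
  show "x \<in> conjugates_pm G x" using conjugates_pmI[of \<one> G x x] x by simp
  show "inv v \<in> conjugates_pm G x" if v: "v \<in> conjugates_pm G x"
  proof -
    obtain g y where gy: "g \<in> carrier G" "y \<in> {x, inv x}" "v = g \<otimes> y \<otimes> inv g"
      using v unfolding conjugates_pm_def by blast
    then have "y \<in> carrier G" "inv y \<in> {x, inv x}" using x by auto
    then have "inv v = g \<otimes> inv y \<otimes> inv g" using gy by (simp add: inv_mult_group m_assoc)
    then show ?thesis using conjugates_pmI[OF gy(1) \<open>inv y \<in> {x, inv x}\<close>] by simp
  qed
  show "g \<otimes> v \<otimes> inv g \<in> conjugates_pm G x" if g: "g \<in> carrier G" and v: "v \<in> conjugates_pm G x"
  proof -
    obtain h y where hy: "h \<in> carrier G" "y \<in> {x, inv x}" "v = h \<otimes> y \<otimes> inv h"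
      using v unfolding conjugates_pm_def by blast
    then have "y \<in> carrier G" using x by auto
    then have "g \<otimes> v \<otimes> inv g = (g \<otimes> h) \<otimes> y \<otimes> inv (g \<otimes> h)"
      using hy g by (simp add: inv_mult_group m_assoc)
    then show ?thesis using conjugates_pmI[of "g \<otimes> h" G y x] hy g by simp
  qed
qed

abbreviation simple_braids :: "nat word set set" where
  "simple_braids \<equiv> conjugates_pm B3 (artin_generator 1)"

lemmas simple_braids = B3.conjugates_pm_normal[OF artin_generator_in_B3(2)]

section \<open>Images of the braid group\<close>

abbreviation artin_permutation :: "nat \<Rightarrow> nat \<Rightarrow> nat" where
  "artin_permutation \<equiv> \<lambda>i. transpose i (i + 1)"

definition artin_matrix :: "nat \<Rightarrow> int_matrix" where
  "artin_matrix i = transvection 1 (if i = 1 then (1, 0) else (0, 1))"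

definition braid_matrix :: "nat word set \<Rightarrow> int_matrix" where
  "braid_matrix C = the_elem (eval_word SL2Z artin_matrix ` C)"

lemma artin_permutation_reflection: "artin_permutation 1 = reflection 0" "artin_permutation 2 = reflection 1"
  by (simp_all add: reflection_def numeral_2_eq_2 numeral_3_eq_3)

lemma artin_permutation_in_S3: "artin_permutation \<in> {1, 2} \<rightarrow> carrier S3"
proof (rule Pi_I)
  fix i :: nat assume "i \<in> {1, 2}"
  then have "i = 1 \<or> i = 2" by auto
  then show "artin_permutation i \<in> carrier S3"
    using artin_permutation_reflection reflection_in_S3 by metis
qed

lemma artin_matrix_in_SL2Z: "artin_matrix \<in> {1, 2} \<rightarrow> carrier SL2Z"
  by (simp add: artin_matrix_def)

lemma artin_permutation_relations:
  assumes "(l, r) \<in> braid_relations3" "l \<in> words {1, 2}" "r \<in> words {1, 2}"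
  shows "eval_word S3 artin_permutation l = eval_word S3 artin_permutation r"
proof -
  have "reflection 0 \<circ> (reflection 1 \<circ> reflection 0) = reflection 1 \<circ> (reflection 0 \<circ> reflection 1)"
    using reflection_conjugate[of 0 1] reflection_conjugate[of 1 0] reflection_cong[of "-1" 2]
    by (simp add: comp_assoc cong_def)
  then show ?thesis
    using assms(1) artin_permutation_reflection
    by (simp add: braid_relations3_def sym_group_mult sym_group_one)
qed

lemma artin_matrix_relations:
  assumes "(l, r) \<in> braid_relations3" "l \<in> words {1, 2}" "r \<in> words {1, 2}"
  shows "eval_word SL2Z artin_matrix l = eval_word SL2Z artin_matrix r"
  using assms(1) by (simp add: braid_relations3_def artin_matrix_def SL2Z_one)

lemma braid_permutation_hom: "braid_permutation \<in> hom B3 S3"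
  unfolding B3_def braid_permutation_def
  by (rule S3.presented_hom[OF artin_permutation_in_S3 artin_permutation_relations])

lemma braid_matrix_hom: "braid_matrix \<in> hom B3 SL2Z"
  unfolding B3_def braid_matrix_def
  by (rule SL2Z.presented_hom[OF artin_matrix_in_SL2Z artin_matrix_relations])

lemma braid_permutation_class:
  "w \<in> words {1, 2} \<Longrightarrow> braid_permutation (word_equiv {1, 2} braid_relations3 `` {w}) =
    eval_word S3 artin_permutation w"
  unfolding braid_permutation_def
  by (rule S3.presented_hom_eval[OF artin_permutation_in_S3 artin_permutation_relations])

lemma braid_matrix_class:
  "w \<in> words {1, 2} \<Longrightarrow> braid_matrix (word_equiv {1, 2} braid_relations3 `` {w}) =
    eval_word SL2Z artin_matrix w"
  unfolding braid_matrix_def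
  by (rule SL2Z.presented_hom_eval[OF artin_matrix_in_SL2Z artin_matrix_relations])

lemma braid_permutation_artin:
  "braid_permutation (artin_generator 1) = reflection 0"
  "braid_permutation (artin_generator 2) = reflection 1"
  using braid_permutation_class[of "[(1, True)]"] braid_permutation_class[of "[(2, True)]"]
    artin_permutation_reflection
  by (simp_all add: artin_generator_def generator_def sym_group_mult sym_group_one)

lemma braid_matrix_artin: "braid_matrix (artin_generator 1) = transvection 1 (1, 0)"
  using braid_matrix_class[of "[(1, True)]"]
  by (simp add: artin_generator_def generator_def artin_matrix_def SL2Z_one)

fun parity :: "int \<times> int \<Rightarrow> int \<times> int" where
  "parity (x, y) = (x mod 2, y mod 2)"

text \<open>The bijection between the vertices of the triangle and the nonzero vectors modulo 2 that is equivariant for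
the actions of the braid group through \<open>S3\<close> and through \<open>SL2Z\<close>.\<close>

definition parity_vector :: "int \<Rightarrow> int \<times> int" where
  "parity_vector c = (if c mod 3 = 0 then (1, 0) else if c mod 3 = 1 then (0, 1) else (1, 1))"

lemma parity_act: "parity v = parity v' \<Longrightarrow> parity (act g v) = parity (act g v')"
  by (cases g, cases v, cases v') (clarsimp, intro conjI mod_add_cong mod_mult_cong; simp)

lemma parity_act_artin_matrix:
  assumes "e \<in> {1, -1}"
  shows "parity (act (transvection e (1, 0)) (parity_vector c)) = parity_vector (- c)"
    and "parity (act (transvection e (0, 1)) (parity_vector c)) = parity_vector (2 - c)"
proof -
  have "(- c) mod 3 = (- (c mod 3)) mod 3" "(2 - c) mod 3 = (2 - c mod 3) mod 3"
    by (simp_all add: mod_simps)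
  then show "parity (act (transvection e (1, 0)) (parity_vector c)) = parity_vector (- c)"
    "parity (act (transvection e (0, 1)) (parity_vector c)) = parity_vector (2 - c)"
    using assms by (cases c rule: mod_3_cases; auto simp: parity_vector_def)+
qed

text \<open>A braid permutes the reflections by conjugation and the nonzero vectors modulo 2 linearly, and
\<open>parity_vector\<close> intertwines the two actions since it does so for the generators.\<close>

lemma word_action_on_reflections:
  assumes "w \<in> words {1, 2}"
  shows "\<exists>c'. eval_word S3 artin_permutation w \<circ> reflection c =
      reflection c' \<circ> eval_word S3 artin_permutation w \<and>
    parity (act (eval_word SL2Z artin_matrix w) (parity_vector c)) = parity_vector c'"
  using assms
proof (induction w)
  case Nil
  have "parity (parity_vector c) = parity_vector c" by (simp add: parity_vector_def)
  then show ?case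
    by (intro exI[of _ c]) (cases "parity_vector c", simp add: sym_group_one SL2Z_one)
next
  case (Cons a w)
  obtain x b where a: "a = (x, b)" by (cases a)
  then have x: "x = 1 \<or> x = 2" and w: "w \<in> words {1, 2}" using Cons.prems by auto
  obtain c' where c': "eval_word S3 artin_permutation w \<circ> reflection c =
      reflection c' \<circ> eval_word S3 artin_permutation w"
    "parity (act (eval_word SL2Z artin_matrix w) (parity_vector c)) = parity_vector c'"
    using Cons.IH[OF w] by blast
  define i :: int where "i = (if x = 1 then 0 else 1)"
  define e :: int where "e = (if b then 1 else - 1)"
  define M where "M = transvection e (if x = 1 then (1, 0) else (0, 1))"
  have ev: "eval_word S3 artin_permutation (a # w) = reflection i \<circ> eval_word S3 artin_permutation w"
    "eval_word SL2Z artin_matrix (a # w) = M \<otimes>\<^bsub>SL2Z\<^esub> eval_word SL2Z artin_matrix w"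
  proof -
    have "artin_permutation x = reflection i" using x artin_permutation_reflection by (auto simp: i_def)
    then show "eval_word S3 artin_permutation (a # w) = reflection i \<circ> eval_word S3 artin_permutation w"
      by (simp only: a eval_word.simps inv_reflection if_cancel sym_group_mult)
    show "eval_word SL2Z artin_matrix (a # w) = M \<otimes>\<^bsub>SL2Z\<^esub> eval_word SL2Z artin_matrix w"
      by (simp add: a e_def M_def artin_matrix_def del: transvection.simps)
  qed
  have "eval_word S3 artin_permutation (a # w) \<circ> reflection c =
      reflection (2 * i - c') \<circ> eval_word S3 artin_permutation (a # w)"
    unfolding ev comp_assoc c'(1)
    unfolding comp_assoc[symmetric] reflection_exchange[of i c'] ..
  moreover have "parity (act (eval_word SL2Z artin_matrix (a # w)) (parity_vector c)) =
      parity_vector (2 * i - c')"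
  proof -
    have "parity (parity_vector c') = parity_vector c'" by (simp add: parity_vector_def)
    then have "parity (act M (act (eval_word SL2Z artin_matrix w) (parity_vector c))) =
        parity (act M (parity_vector c'))"
      using c'(2) by (intro parity_act) simp
    then show ?thesis
      unfolding ev act_mult using parity_act_artin_matrix[of e c'] x
      by (auto simp: M_def i_def e_def simp del: transvection.simps)
  qed
  ultimately show ?case by blast
qed

text \<open>Transport the statement from the first Artin generator, where it holds for \<open>(1, 0)\<close> and the label 0,
along a conjugation.\<close>

lemma simple_braid_images:
  assumes "\<beta> \<in> simple_braids"
  shows "\<exists>e\<in>{1, -1}. \<exists>v c. braid_matrix \<beta> = transvection e v \<and>
    braid_permutation \<beta> = reflection c \<and> parity v = parity_vector c"
proof -
  interpret P: group_hom B3 S3 braid_permutation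
    using braid_permutation_hom by (simp add: group_hom_def group_hom_axioms_def group_B3 group_S3)
  interpret M: group_hom B3 SL2Z braid_matrix
    using braid_matrix_hom by (simp add: group_hom_def group_hom_axioms_def group_B3 group_SL2Z)
  obtain g y where g: "g \<in> carrier B3" and y: "y \<in> {artin_generator 1, inv\<^bsub>B3\<^esub> artin_generator 1}"
    and \<beta>: "\<beta> = g \<otimes>\<^bsub>B3\<^esub> y \<otimes>\<^bsub>B3\<^esub> inv\<^bsub>B3\<^esub> g"
    using assms unfolding conjugates_pm_def by blast
  then have y_in: "y \<in> carrier B3" by auto
  obtain w where w: "w \<in> words {1, 2}" "g = word_equiv {1, 2} braid_relations3 `` {w}"
    using g by (auto simp: B3_def presented_group_def elim!: quotientE)
  obtain c where c: "braid_permutation g \<circ> reflection 0 = reflection c \<circ> braid_permutation g"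
    "parity (act (braid_matrix g) (parity_vector 0)) = parity_vector c"
    using word_action_on_reflections[OF w(1), of 0] braid_permutation_class[OF w(1)]
      braid_matrix_class[OF w(1)] w(2) by auto
  obtain e where e: "e \<in> {1, -1::int}" "braid_matrix y = transvection e (1, 0)"
  proof (cases "y = artin_generator 1")
    case True
    then show ?thesis using that[of 1] braid_matrix_artin by simp
  next
    case False
    then have "braid_matrix y = transvection (- 1) (1, 0)"
      using y braid_matrix_artin by (simp del: transvection.simps)
    then show ?thesis using that[of "- 1"] by simp
  qed
  have "braid_permutation y = reflection 0"
    using y braid_permutation_artin(1) by auto
  have perm: "braid_permutation \<beta> = reflection c"
  proof -
    have "braid_permutation \<beta> = braid_permutation g \<otimes>\<^bsub>S3\<^esub> reflection 0 \<otimes>\<^bsub>S3\<^esub> inv\<^bsub>S3\<^esub> braid_permutation g"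
      using g y_in \<beta> \<open>braid_permutation y = reflection 0\<close> by simp
    also have "braid_permutation g \<otimes>\<^bsub>S3\<^esub> reflection 0 = reflection c \<otimes>\<^bsub>S3\<^esub> braid_permutation g"
      using c(1) by (simp add: sym_group_mult)
    also have "\<dots> \<otimes>\<^bsub>S3\<^esub> inv\<^bsub>S3\<^esub> braid_permutation g = reflection c"
      using P.hom_closed[OF g] reflection_in_S3[of c]
      by (simp only: S3.m_assoc S3.r_inv S3.r_one S3.inv_closed)
    finally show ?thesis .
  qed
  have "braid_matrix \<beta> = transvection e (act (braid_matrix g) (1, 0))"
    using g y_in \<beta> e(2) conjugate_transvection[of "braid_matrix g" e "(1, 0)"]
    by (simp del: transvection.simps)
  moreover have "parity (act (braid_matrix g) (1, 0)) = parity_vector c"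
    using c(2) by (simp add: parity_vector_def)
  ultimately show ?thesis using e(1) perm by blast
qed

lemma simple_braid_matrix:
  assumes "\<beta> \<in> simple_braids" "braid_permutation \<beta> = reflection c"
  shows "\<exists>e\<in>{1, -1}. \<exists>v. braid_matrix \<beta> = transvection e v \<and> parity v = parity_vector c"
proof -
  have "parity_vector c' = parity_vector c" if "reflection c = reflection c'" for c'
    using that by (simp add: reflection_eq_iff cong_def parity_vector_def)
  then show ?thesis using simple_braid_images[OF assms(1)] assms(2) by metis
qed

lemma parity_vector_nonzero: "parity v = parity_vector c \<Longrightarrow> v \<noteq> (0, 0)"
  by (auto simp: parity_vector_def split: if_splits)

lemma odd_area:
  assumes "parity v = parity_vector c" "parity v' = parity_vector c'" "\<not> [c = c'] (mod 3)"
  shows "odd (area v v')"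
proof -
  obtain x y x' y' where v: "v = (x, y)" "v' = (x', y')" by (cases v, cases v') auto
  show ?thesis
    using assms unfolding v cong_def
    by (cases c rule: mod_3_cases; cases c' rule: mod_3_cases)
      (simp_all add: parity_vector_def mod2_eq_if split: if_splits)
qed

section \<open>Tricolorings and their lifts\<close>

lemma transpositions3_normal:
  shows "transpositions3 \<subseteq> carrier S3"
    and "t \<in> transpositions3 \<Longrightarrow> inv\<^bsub>S3\<^esub> t \<in> transpositions3"
    and "g \<in> carrier S3 \<Longrightarrow> t \<in> transpositions3 \<Longrightarrow> g \<otimes>\<^bsub>S3\<^esub> t \<otimes>\<^bsub>S3\<^esub> inv\<^bsub>S3\<^esub> g \<in> transpositions3"
proof -
  show "transpositions3 \<subseteq> carrier S3" by (auto simp: range_reflection[symmetric])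
  show "inv\<^bsub>S3\<^esub> t \<in> transpositions3" if "t \<in> transpositions3"
    using that by (auto simp: range_reflection[symmetric])
  show "g \<otimes>\<^bsub>S3\<^esub> t \<otimes>\<^bsub>S3\<^esub> inv\<^bsub>S3\<^esub> g \<in> transpositions3"
    if g: "g \<in> carrier S3" and t: "t \<in> transpositions3"
  proof -
    obtain a b where ab: "t = transpose a b" "a \<in> {1..3}" "b \<in> {1..3}" "a \<noteq> b"
      using t unfolding transpositions3_def by blast
    have perm: "g permutes {1..3}" using g by (simp add: sym_group_carrier)
    then have "inj g" by (rule permutes_inj)
    then have "g \<circ> t = transpose (g a) (g b) \<circ> g"
      by (auto simp: ab fun_eq_iff transpose_def inj_eq)
    moreover have tr: "transpose (g a) (g b) \<in> transpositions3"
    proof -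
      have "g a \<in> {1..3}" "g b \<in> {1..3}" "g a \<noteq> g b"
        using ab permutes_in_image[OF perm] \<open>inj g\<close> by (simp_all only: inj_eq not_False_eq_True)
      then show ?thesis unfolding transpositions3_def by blast
    qed
    moreover have "transpose (g a) (g b) \<in> carrier S3" using tr \<open>transpositions3 \<subseteq> _\<close> by blast
    moreover have "t \<in> carrier S3" using t \<open>transpositions3 \<subseteq> _\<close> by blast
    ultimately show ?thesis using g S3.inv_solve_right'
      by (metis S3.inv_closed S3.m_assoc S3.r_inv S3.r_one sym_group_mult)
  qed
qed

lemma top_meridian_in_meridians:
  assumes "i < length qs"
  shows "segment_meridian qs (i, 0, L) \<in> meridians qs"
proof -
  interpret P: group "pretzel_group qs" by (rule group_pretzel_group)
  have s: "(i, 0, L) \<in> segments qs" using assms by (simp add: segments_def)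
  then have "segment_meridian qs (i, 0, L) \<in> conjugates_pm (pretzel_group qs) (segment_meridian qs (i, 0, L))"
    by (intro P.conjugates_pm_normal segment_meridian_in_carrier)
  then show ?thesis unfolding meridians_def using s by blast
qed

lemma tricoloring_iff:
  "\<phi> \<in> tricolorings qs \<longleftrightarrow> \<phi> \<in> hom (pretzel_group qs) S3 \<and>
    (\<forall>i<length qs. top_values qs \<phi> i \<in> transpositions3)"
  using top_meridian_in_meridians
    hom_meridian_in_normal_set[OF group_S3 _ transpositions3_normal, of \<phi> qs]
  by (auto simp: tricolorings_def top_values_def)

text \<open>A lift of a tricoloring only has to lift the top meridians, because a homomorphism is determined by
its values there.\<close>

lemma lifts_to_B3_iff:
  assumes "\<phi> \<in> tricolorings qs"
  shows "lifts_to_B3 qs \<phi> \<longleftrightarrow> (\<exists>x. closes_up B3 qs x \<and>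
    (\<forall>i<length qs. x i \<in> simple_braids \<and> braid_permutation (x i) = top_values qs \<phi> i))"
proof
  assume "lifts_to_B3 qs \<phi>"
  then obtain \<rho> where \<rho>: "\<rho> \<in> hom (pretzel_group qs) B3" "\<And>m. m \<in> meridians qs \<Longrightarrow> \<rho> m \<in> simple_braids"
    and lift: "\<And>x. x \<in> carrier (pretzel_group qs) \<Longrightarrow> braid_permutation (\<rho> x) = \<phi> x"
    by (auto simp: lifts_to_B3_def simple_B3_colorings_def)
  have "segment_meridian qs (i, 0, L) \<in> carrier (pretzel_group qs)" if "i < length qs" for i
    using that by (intro segment_meridian_in_carrier) (simp add: segments_def)
  then show "\<exists>x. closes_up B3 qs x \<and>
      (\<forall>i<length qs. x i \<in> simple_braids \<and> braid_permutation (x i) = top_values qs \<phi> i)"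
    using hom_closes_up[OF group_B3 \<rho>(1)] top_meridian_in_meridians \<rho>(2) lift
    by (intro exI[of _ "top_values qs \<rho>"]) (simp add: top_values_def)
next
  assume "\<exists>x. closes_up B3 qs x \<and>
      (\<forall>i<length qs. x i \<in> simple_braids \<and> braid_permutation (x i) = top_values qs \<phi> i)"
  then obtain x where x: "closes_up B3 qs x" "\<And>i. i < length qs \<Longrightarrow> x i \<in> simple_braids"
    "\<And>i. i < length qs \<Longrightarrow> braid_permutation (x i) = top_values qs \<phi> i" by blast
  obtain \<rho> where \<rho>: "\<rho> \<in> hom (pretzel_group qs) B3" "\<And>i. i < length qs \<Longrightarrow> top_values qs \<rho> i = x i"
    using closes_up_hom_exists[OF group_B3 x(1)] by blast
  have "\<rho> m \<in> simple_braids" if "m \<in> meridians qs" for m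
    using that hom_meridian_in_normal_set[OF group_B3 \<rho>(1) simple_braids(1,3,4)] \<rho>(2) x(2) by simp
  then have "\<rho> \<in> simple_B3_colorings qs" using \<rho>(1) by (simp add: simple_B3_colorings_def)
  moreover have "braid_permutation (\<rho> g) = \<phi> g" if "g \<in> carrier (pretzel_group qs)" for g
  proof -
    have comp: "(\<lambda>g. braid_permutation (\<rho> g)) \<in> hom (pretzel_group qs) S3"
      using hom_compose[OF \<rho>(1) braid_permutation_hom] by (simp add: comp_def)
    have \<phi>: "\<phi> \<in> hom (pretzel_group qs) S3" using assms by (simp add: tricolorings_def)
    show ?thesis
      using pretzel_homs_eqI[OF group_S3 comp \<phi> _ that] x(3) \<rho>(2) by (simp add: top_values_def)
  qed
  ultimately show "lifts_to_B3 qs \<phi>" by (auto simp: lifts_to_B3_def)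
qed

lemma constant_on_region_iff:
  assumes \<phi>: "\<phi> \<in> tricolorings qs" and i: "i < length qs"
  shows "constant_on_region qs i \<phi> \<longleftrightarrow> top_values qs \<phi> i = top_values qs \<phi> (Suc i mod length qs)"
proof -
  define j where "j = Suc i mod length qs"
  have j: "j < length qs" using i unfolding j_def by (intro mod_less_divisor) auto
  have hom: "\<phi> \<in> hom (pretzel_group qs) S3" using \<phi> by (simp add: tricolorings_def)
  obtain a b where ab: "top_values qs \<phi> i = reflection a" "top_values qs \<phi> j = reflection b"
    using \<phi> i j by (fastforce simp: tricoloring_iff range_reflection[symmetric])
  have value_eq: "\<phi> (segment_meridian qs (i, k, s)) =
      reflection (b + segment_index qs (i, k, s) * (a - b))" if "(i, k, s) \<in> segments qs" for k s
    using hom_segment_meridian[OF group_S3 hom that] ab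
    by (simp add: pretzel_arc_def twist_reflections flip: j_def)
  show ?thesis unfolding j_def[symmetric]
  proof
    assume "constant_on_region qs i \<phi>"
    then have "\<phi> (segment_meridian qs (i, 0, L)) = \<phi> (segment_meridian qs (i, 0, R))"
      using i unfolding constant_on_region_def segments_def by (metis (no_types, lifting) case_prodI mem_Collect_eq zero_le)
    then show "top_values qs \<phi> i = top_values qs \<phi> j"
      using value_eq[of 0 L] value_eq[of 0 R] i ab by (simp add: segments_def segment_index_def)
  next
    assume "top_values qs \<phi> i = top_values qs \<phi> j"
    then have "[a = b] (mod 3)" using ab by (simp add: reflection_eq_iff)
    then have "reflection (b + n * (a - b)) = reflection b" for n
      by (simp add: reflection_eq_iff cong_iff_dvd_diff)
    then show "constant_on_region qs i \<phi>" unfolding constant_on_region_def using value_eq by auto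
  qed
qed

lemma tricoloring_labels:
  assumes \<phi>: "\<phi> \<in> tricolorings [p, q, r]"
  obtains a b c where "top_values [p, q, r] \<phi> 0 = reflection a" "top_values [p, q, r] \<phi> 1 = reflection b"
    "top_values [p, q, r] \<phi> 2 = reflection c"
    "[p * (a - b) = q * (b - c)] (mod 3)" "[q * (b - c) = r * (c - a)] (mod 3)"
    "[r * (c - a) = p * (a - b)] (mod 3)"
proof -
  have hom: "\<phi> \<in> hom (pretzel_group [p, q, r]) S3"
    and tr: "top_values [p, q, r] \<phi> i \<in> range reflection" if "i < 3" for i
    using \<phi> that by (auto simp: tricoloring_iff range_reflection)
  obtain a b c where abc: "top_values [p, q, r] \<phi> 0 = reflection a"
    "top_values [p, q, r] \<phi> 1 = reflection b" "top_values [p, q, r] \<phi> 2 = reflection c"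
    using tr[of 0] tr[of 1] tr[of 2] by auto
  show ?thesis
    using hom_closes_up[OF group_S3 hom[of 0]] that[OF abc]
    unfolding closes_up_three abc joins_reflections by simp
qed

lemma trivial_tricoloring_iff:
  assumes \<phi>: "\<phi> \<in> tricolorings [p, q, r]"
  shows "trivial_tricoloring [p, q, r] \<phi> \<longleftrightarrow>
    top_values [p, q, r] \<phi> 0 = top_values [p, q, r] \<phi> 1 \<and> top_values [p, q, r] \<phi> 1 = top_values [p, q, r] \<phi> 2"
proof
  assume "trivial_tricoloring [p, q, r] \<phi>"
  then obtain t where t: "\<And>s. s \<in> segments [p, q, r] \<Longrightarrow> \<phi> (segment_meridian [p, q, r] s) = t"
    unfolding trivial_tricoloring_def by blast
  have "top_values [p, q, r] \<phi> i = t" if "i < 3" for i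
    unfolding top_values_def using that by (intro t) (simp add: segments_def)
  then show "top_values [p, q, r] \<phi> 0 = top_values [p, q, r] \<phi> 1 \<and>
      top_values [p, q, r] \<phi> 1 = top_values [p, q, r] \<phi> 2" by simp
next
  assume eq: "top_values [p, q, r] \<phi> 0 = top_values [p, q, r] \<phi> 1 \<and>
      top_values [p, q, r] \<phi> 1 = top_values [p, q, r] \<phi> 2"
  have "\<phi> (segment_meridian [p, q, r] s) = top_values [p, q, r] \<phi> 0" if "s \<in> segments [p, q, r]" for s
  proof -
    obtain i k d where s: "s = (i, k, d)" by (cases s)
    then have i: "i < 3" using that by (simp add: segments_def)
    then have "constant_on_region [p, q, r] i \<phi>"
      using eq three_cases[OF i] by (auto simp: constant_on_region_iff[OF \<phi>] numeral_2_eq_2)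
    then obtain t where t: "\<And>k d. (i, k, d) \<in> segments [p, q, r] \<Longrightarrow>
        \<phi> (segment_meridian [p, q, r] (i, k, d)) = t" unfolding constant_on_region_def by blast
    have "\<phi> (segment_meridian [p, q, r] s) = top_values [p, q, r] \<phi> i"
      using t[of k d] t[of 0 L] that i unfolding s top_values_def by (simp add: segments_def)
    then show ?thesis using eq three_cases[OF i] by auto
  qed
  then show "trivial_tricoloring [p, q, r] \<phi>" unfolding trivial_tricoloring_def by blast
qed

text \<open>The existence of a lift for the tricoloring of the pretzel knot \<open>(p, q, r)\<close> with top labels \<open>a\<close>, \<open>b\<close>, \<open>c\<close>.\<close>

definition lifting_braids :: "int \<Rightarrow> int \<Rightarrow> int \<Rightarrow> int \<Rightarrow> int \<Rightarrow> int \<Rightarrow> bool" where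
  "lifting_braids p a q b r c \<longleftrightarrow> (\<exists>x\<in>simple_braids. \<exists>y\<in>simple_braids. \<exists>z\<in>simple_braids.
    braid_permutation x = reflection a \<and> braid_permutation y = reflection b \<and>
    braid_permutation z = reflection c \<and>
    joins B3 x p y q z \<and> joins B3 y q z r x \<and> joins B3 z r x p y)"

lemma lifting_braidsI:
  assumes "x \<in> simple_braids" "y \<in> simple_braids" "z \<in> simple_braids"
    "braid_permutation x = reflection a" "braid_permutation y = reflection b"
    "braid_permutation z = reflection c"
    "joins B3 x p y q z" "joins B3 y q z r x" "joins B3 z r x p y"
  shows "lifting_braids p a q b r c"
  using assms unfolding lifting_braids_def by blast

lemma lifting_braids_rotate: "lifting_braids p a q b r c \<Longrightarrow> lifting_braids q b r c p a"
  unfolding lifting_braids_def by blast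

lemma lifts_to_B3_labels:
  assumes \<phi>: "\<phi> \<in> tricolorings [p, q, r]" and top: "top_values [p, q, r] \<phi> 0 = reflection a"
    "top_values [p, q, r] \<phi> 1 = reflection b" "top_values [p, q, r] \<phi> 2 = reflection c"
  shows "lifts_to_B3 [p, q, r] \<phi> \<longleftrightarrow> lifting_braids p a q b r c"
proof -
  have len: "length [p, q, r] = 3" by simp
  show ?thesis unfolding lifts_to_B3_iff[OF \<phi>] len all_less_3 top closes_up_three
  proof
    assume "lifting_braids p a q b r c"
    then obtain x y z where xyz: "x \<in> simple_braids" "y \<in> simple_braids" "z \<in> simple_braids"
      "braid_permutation x = reflection a" "braid_permutation y = reflection b"
      "braid_permutation z = reflection c"
      "joins B3 x p y q z" "joins B3 y q z r x" "joins B3 z r x p y"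
      unfolding lifting_braids_def by blast
    define f where "f = (\<lambda>i::nat. if i = 0 then x else if i = 1 then y else z)"
    have f: "f 0 = x" "f 1 = y" "f 2 = z" by (simp_all add: f_def)
    show "\<exists>f::nat \<Rightarrow> _. ({f 0, f 1, f 2} \<subseteq> carrier B3 \<and> joins B3 (f 0) p (f 1) q (f 2) \<and>
        joins B3 (f 1) q (f 2) r (f 0) \<and> joins B3 (f 2) r (f 0) p (f 1)) \<and>
      (f 0 \<in> simple_braids \<and> braid_permutation (f 0) = reflection a) \<and>
      (f 1 \<in> simple_braids \<and> braid_permutation (f 1) = reflection b) \<and>
      f 2 \<in> simple_braids \<and> braid_permutation (f 2) = reflection c"
      by (rule exI[of _ f]) (use xyz simple_braids(1) in \<open>unfold f, blast\<close>)
  qed (unfold lifting_braids_def, blast)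
qed

text \<open>A pretzel link looks the same after a cyclic rotation of its regions, so any given region may be taken as
the first one.\<close>

lemma tricoloring_rotated_labels:
  assumes \<phi>: "\<phi> \<in> tricolorings [q0, q1, q2]" and i: "i < 3"
  obtains p q r a b c where "[q0, q1, q2] ! i = p"
    "\<forall>P. (\<forall>j<3. j \<noteq> i \<longrightarrow> P ([q0, q1, q2] ! j)) \<longleftrightarrow> P q \<and> P r"
    "[p * (a - b) = q * (b - c)] (mod 3)" "[r * (c - a) = p * (a - b)] (mod 3)"
    "lifts_to_B3 [q0, q1, q2] \<phi> \<longleftrightarrow> lifting_braids p a q b r c"
    "constant_on_region [q0, q1, q2] i \<phi> \<longleftrightarrow> [a = b] (mod 3)"
proof -
  obtain a b c where top: "top_values [q0, q1, q2] \<phi> 0 = reflection a"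
    "top_values [q0, q1, q2] \<phi> 1 = reflection b" "top_values [q0, q1, q2] \<phi> 2 = reflection c"
    and cong: "[q0 * (a - b) = q1 * (b - c)] (mod 3)" "[q1 * (b - c) = q2 * (c - a)] (mod 3)"
      "[q2 * (c - a) = q0 * (a - b)] (mod 3)"
    by (rule tricoloring_labels[OF \<phi>])
  note lifts = lifts_to_B3_labels[OF \<phi> top]
  have "lifting_braids q0 a q1 b q2 c \<longleftrightarrow> lifting_braids q1 b q2 c q0 a"
    "lifting_braids q0 a q1 b q2 c \<longleftrightarrow> lifting_braids q2 c q0 a q1 b"
    using lifting_braids_rotate by blast+
  note rotated = lifts lifts[unfolded this(1)] lifts[unfolded this(2)]
  have "Suc 0 mod 3 = 1" "Suc 1 mod 3 = 2" "Suc 2 mod 3 = 0" "i < length [q0, q1, q2]"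
    "length [q0, q1, q2] = 3" using i by simp_all
  note const = constant_on_region_iff[OF \<phi> this(4), unfolded this(5)] and mods = this(1-3)
  consider "i = 0" | "i = 1" | "i = 2" using three_cases[OF i] by blast
  then show ?thesis
  proof cases
    case 1
    show ?thesis
      by (rule that[OF _ _ cong(1,3) rotated(1)])
        (unfold const, unfold 1 mods top reflection_eq_iff all_less_3, auto)
  next
    case 2
    show ?thesis
      by (rule that[OF _ _ cong(2,1) rotated(2)])
        (unfold const, unfold 2 mods top reflection_eq_iff all_less_3, auto)
  next
    case 3
    show ?thesis
      by (rule that[OF _ _ cong(3,2) rotated(3)])
        (unfold const, unfold 3 mods top reflection_eq_iff all_less_3, auto)
  qed
qed

section \<open>Obstructions to lifting\<close>

lemma lifting_braids_transvections:
  assumes "lifting_braids p a q b r c"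
  obtains e1 e2 e3 u v w where
    "e1 \<in> {1, -1}" "e2 \<in> {1, -1}" "e3 \<in> {1, -1}"
    "parity u = parity_vector a" "parity v = parity_vector b" "parity w = parity_vector c"
    "joins SL2Z (transvection e1 u) p (transvection e2 v) q (transvection e3 w)"
    "joins SL2Z (transvection e2 v) q (transvection e3 w) r (transvection e1 u)"
    "joins SL2Z (transvection e3 w) r (transvection e1 u) p (transvection e2 v)"
proof -
  obtain x y z where xyz: "x \<in> simple_braids" "y \<in> simple_braids" "z \<in> simple_braids"
    and perm: "braid_permutation x = reflection a" "braid_permutation y = reflection b"
      "braid_permutation z = reflection c"
    and j: "joins B3 x p y q z" "joins B3 y q z r x" "joins B3 z r x p y"
    using assms unfolding lifting_braids_def by blast
  obtain e1 u where 1: "e1 \<in> {1, -1}" "braid_matrix x = transvection e1 u" "parity u = parity_vector a"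
    using simple_braid_matrix[OF xyz(1) perm(1)] by blast
  obtain e2 v where 2: "e2 \<in> {1, -1}" "braid_matrix y = transvection e2 v" "parity v = parity_vector b"
    using simple_braid_matrix[OF xyz(2) perm(2)] by blast
  obtain e3 w where 3: "e3 \<in> {1, -1}" "braid_matrix z = transvection e3 w" "parity w = parity_vector c"
    using simple_braid_matrix[OF xyz(3) perm(3)] by blast
  have carr: "x \<in> carrier B3" "y \<in> carrier B3" "z \<in> carrier B3" using xyz simple_braids(1) by blast+
  note hom = hom_joins[OF group_B3 group_SL2Z braid_matrix_hom]
  show ?thesis
    by (rule that[OF 1(1) 2(1) 3(1) 1(3) 2(3) 3(3)])
      (use hom[OF carr j(1)] hom[OF carr(2,3,1) j(2)] hom[OF carr(3,1,2) j(3)] in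
        \<open>simp_all only: 1(2) 2(2) 3(2)\<close>)
qed

lemma lifting_braids_odd_necessary:
  assumes lift: "lifting_braids p a q b r c" and pqr: "odd p" "odd q" "odd r"
    and neq: "\<not> ([a = b] (mod 3) \<and> [b = c] (mod 3))"
  shows "\<exists>\<sigma>\<in>{1, -1}. (\<sigma> * p, \<sigma> * q, \<sigma> * r) \<in> {(1, 1, 1), (3, 3, -1), (3, -1, 3), (-1, 3, 3)}"
proof -
  obtain e1 e2 e3 u v w where e: "e1 \<in> {1, -1}" "e2 \<in> {1, -1}" "e3 \<in> {1, -1}"
    and par: "parity u = parity_vector a" "parity v = parity_vector b" "parity w = parity_vector c"
    and j: "joins SL2Z (transvection e1 u) p (transvection e2 v) q (transvection e3 w)"
      "joins SL2Z (transvection e2 v) q (transvection e3 w) r (transvection e1 u)"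
      "joins SL2Z (transvection e3 w) r (transvection e1 u) p (transvection e2 v)"
    by (rule lifting_braids_transvections[OF lift])
  have "odd (area u v) \<or> odd (area v w)" using odd_area par neq by blast
  then have "area u v \<noteq> 0 \<or> area v w \<noteq> 0 \<or> area w u \<noteq> 0" by auto
  then show ?thesis
    by (rule transvections_close_up_odd[OF e par[THEN parity_vector_nonzero] pqr j])
qed

lemma lifting_braids_even_necessary:
  assumes lift: "lifting_braids p a q b r c" and pqr: "even p" "p \<noteq> 0" "odd q" "odd r"
    and neq: "\<not> [a = b] (mod 3)"
  shows "\<exists>\<epsilon>\<in>{1, -1}. p = 2 * \<epsilon> \<and> [q = - \<epsilon>] (mod 6) \<and> [r = - \<epsilon>] (mod 6)"
proof -
  obtain e1 e2 e3 u v w where e: "e1 \<in> {1, -1}" "e2 \<in> {1, -1}" "e3 \<in> {1, -1}"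
    and par: "parity u = parity_vector a" "parity v = parity_vector b" "parity w = parity_vector c"
    and j: "joins SL2Z (transvection e1 u) p (transvection e2 v) q (transvection e3 w)"
      "joins SL2Z (transvection e2 v) q (transvection e3 w) r (transvection e1 u)"
      "joins SL2Z (transvection e3 w) r (transvection e1 u) p (transvection e2 v)"
    by (rule lifting_braids_transvections[OF lift])
  show ?thesis
    by (rule transvections_close_up_even[OF e par[THEN parity_vector_nonzero] pqr j
          odd_area[OF par(1,2) neq]])
qed

section \<open>Construction of lifts\<close>

definition braided :: "('a, 'b) monoid_scheme \<Rightarrow> 'a \<Rightarrow> 'a \<Rightarrow> bool" where
  "braided G a b \<longleftrightarrow> a \<otimes>\<^bsub>G\<^esub> b \<otimes>\<^bsub>G\<^esub> a = b \<otimes>\<^bsub>G\<^esub> a \<otimes>\<^bsub>G\<^esub> b"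

lemma braided_sym: "braided G a b \<Longrightarrow> braided G b a"
  by (simp add: braided_def)

context group
begin

lemma braided_conjugate:
  assumes [simp]: "a \<in> carrier G" "b \<in> carrier G" "g \<in> carrier G" and "braided G a b"
  shows "braided G (g \<otimes> a \<otimes> inv g) (g \<otimes> b \<otimes> inv g)"
proof -
  have conj: "(g \<otimes> x \<otimes> inv g) \<otimes> (g \<otimes> y \<otimes> inv g) \<otimes> (g \<otimes> x \<otimes> inv g) = g \<otimes> (x \<otimes> y \<otimes> x) \<otimes> inv g"
    if "x \<in> carrier G" "y \<in> carrier G" for x y
    using that by (simp add: m_assoc)
  show ?thesis using assms(4) unfolding braided_def by (simp only: conj assms)
qed

lemma braided_conjugations:
  assumes [simp]: "a \<in> carrier G" "b \<in> carrier G" and ab: "braided G a b"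
  shows "a \<otimes> b \<otimes> inv a = inv b \<otimes> a \<otimes> b"
proof -
  have "b \<otimes> (a \<otimes> b \<otimes> inv a) = (b \<otimes> a \<otimes> b) \<otimes> inv a" by (simp add: m_assoc)
  also have "\<dots> = a \<otimes> b" unfolding ab[unfolded braided_def, symmetric] by (simp add: m_assoc)
  finally show ?thesis by (metis inv_solve_left assms(1,2) inv_closed m_assoc m_closed)
qed

lemma twist_small:
  assumes [simp]: "l \<in> carrier G" "r \<in> carrier G"
  shows "twist G l r 2 = l \<otimes> r \<otimes> inv l"
    "twist G l r 3 = l \<otimes> r \<otimes> l \<otimes> inv r \<otimes> inv l"
    "twist G l r 4 = l \<otimes> r \<otimes> l \<otimes> r \<otimes> inv l \<otimes> inv r \<otimes> inv l"
    "twist G l r (-1) = inv r \<otimes> l \<otimes> r"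
    "twist G l r (-2) = inv r \<otimes> inv l \<otimes> r \<otimes> l \<otimes> r"
    "twist G l r (-3) = inv r \<otimes> inv l \<otimes> inv r \<otimes> l \<otimes> r \<otimes> l \<otimes> r"
proof -
  show 2: "twist G l r 2 = l \<otimes> r \<otimes> inv l"
    using twist_next[of l r 1] by simp
  show 3: "twist G l r 3 = l \<otimes> r \<otimes> l \<otimes> inv r \<otimes> inv l"
    using twist_next[of l r 2] 2 by (simp add: m_assoc inv_mult_group)
  show "twist G l r 4 = l \<otimes> r \<otimes> l \<otimes> r \<otimes> inv l \<otimes> inv r \<otimes> inv l"
    using twist_next[of l r 3] 2 3 by (simp add: m_assoc inv_mult_group)
  show 1: "twist G l r (-1) = inv r \<otimes> l \<otimes> r"
    using twist_prev[of l r 0] by simp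
  show 2: "twist G l r (-2) = inv r \<otimes> inv l \<otimes> r \<otimes> l \<otimes> r"
    using twist_prev[of l r "-1"] 1 by (simp add: m_assoc inv_mult_group)
  show "twist G l r (-3) = inv r \<otimes> inv l \<otimes> inv r \<otimes> l \<otimes> r \<otimes> l \<otimes> r"
    using twist_prev[of l r "-2"] 1 2 by (simp add: m_assoc inv_mult_group)
qed

lemma twist_constant: "a \<in> carrier G \<Longrightarrow> twist G a a n = a"
  by (intro twist_eqI) simp_all

lemma twist_inverse_even:
  assumes [simp]: "a \<in> carrier G"
  shows "twist G a (inv a) n = (if even n then inv a else a)"
  by (rule twist_eqI) auto

lemma twist_inverses:
  assumes [simp]: "a \<in> carrier G" "b \<in> carrier G"
  shows "twist G (inv b) (inv a) n = inv twist G a b (1 - n)"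
proof (rule twist_eqI)
  show "inv twist G a b (1 - (n + 1)) \<otimes> inv twist G a b (1 - n) = inv b \<otimes> inv a" for n
    using twist_product[of a b "- n"] by (simp add: inv_mult_group[symmetric])
qed simp_all

text \<open>Three half twists return a braided pair to itself since \<open>a \<otimes> b \<otimes> a \<otimes> inv b \<otimes> inv a = b\<close>.\<close>

lemma twist_braided_period:
  assumes [simp]: "a \<in> carrier G" "b \<in> carrier G" and ab: "braided G a b"
  shows "twist G a b (n + 3) = twist G a b n"
proof -
  have 3: "twist G a b 3 = b"
  proof -
    have "twist G a b 3 = (a \<otimes> b \<otimes> a) \<otimes> (inv b \<otimes> inv a)" by (simp add: twist_small m_assoc)
    also have "\<dots> = b" unfolding ab[unfolded braided_def] by (simp add: m_assoc)
    finally show ?thesis .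
  qed
  have "twist G a b (3 + 1) \<otimes> b = a \<otimes> b" using twist_product[of a b 3] 3 by simp
  then have 4: "twist G a b 4 = a" by simp
  have "twist G a b n = twist G a b (n + 3)" for n
  proof (rule twist_eqI)
    show "twist G a b (n + 1 + 3) \<otimes> twist G a b (n + 3) = a \<otimes> b" for n
      using twist_product[of a b "n + 3"] by (simp add: algebra_simps)
  qed (simp_all add: 3 4)
  then show ?thesis by simp
qed

lemma twist_braided_multiple_of_3:
  assumes [simp]: "a \<in> carrier G" "b \<in> carrier G" and ab: "braided G a b" and "3 dvd n"
  shows "twist G a b (m + n) = twist G a b m"
proof -
  obtain k where k: "n = 3 * k" using \<open>3 dvd n\<close> by blast
  have "twist G a b (m + 3 * k) = twist G a b m" for k
  proof (induction k rule: int_induct[where k = 0])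
    case (step1 i)
    then show ?case using twist_braided_period[OF assms(1-3), of "m + 3 * i"] by (simp add: algebra_simps)
  next
    case (step2 i)
    then show ?case using twist_braided_period[OF assms(1-3), of "m + 3 * (i - 1)"] by (simp add: algebra_simps)
  qed simp
  then show ?thesis by (simp add: k)
qed

text \<open>With equal left top meridians \<open>a\<close> the even region carries only \<open>a\<close> and its inverse, and the sequence of the
third region is the inverted sequence of the second one read backwards (\<open>twist_inverses\<close>).\<close>

lemma joins_trivial_even_region:
  assumes [simp]: "a \<in> carrier G" "b \<in> carrier G"
    and ab: "a = b \<or> braided G a b \<and> 3 dvd q \<and> 3 dvd r" and "even p"
  shows "joins G a p a q (inv b)" "joins G a q (inv b) r a" "joins G (inv b) r a p a"
proof -
  have tw: "twist G a b (1 + q) = a" "twist G a b (1 - r) = a" "twist G a b q = twist G a b (- r)"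
  proof -
    have "twist G a b (m + q) = twist G a b m \<and> twist G a b (m - r) = twist G a b m" for m
    proof (cases "a = b")
      case True
      then show ?thesis by (simp add: twist_constant)
    next
      case False
      then show ?thesis
        using ab twist_braided_multiple_of_3[of a b q m] twist_braided_multiple_of_3[of a b "- r" m] by simp
    qed
    from this[of 0] this[of 1]
    show "twist G a b (1 + q) = a" "twist G a b (1 - r) = a" "twist G a b q = twist G a b (- r)" by simp_all
  qed
  show "joins G a p a q (inv b)" "joins G a q (inv b) r a" "joins G (inv b) r a p a"
    using tw \<open>even p\<close> by (simp_all add: joins_def twist_inverse_even twist_inverses add.commute)
qed

lemma joins_one:
  assumes [simp]: "x \<in> carrier G" "y \<in> carrier G" "z \<in> carrier G"
  shows "joins G x 1 y 1 z \<longleftrightarrow> x \<otimes> y = y \<otimes> z"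
proof -
  have "joins G x 1 y 1 z \<longleftrightarrow> x = y \<otimes> z \<otimes> inv y"
    by (simp add: joins_def twist_small inv_mult_group m_assoc)
  then show ?thesis by (auto simp: inv_solve_right)
qed

lemma joins_minus_one:
  assumes [simp]: "x \<in> carrier G" "y \<in> carrier G" "z \<in> carrier G"
  shows "joins G x (-1) y (-1) z \<longleftrightarrow> y \<otimes> x = z \<otimes> y"
proof -
  have "joins G x (-1) y (-1) z \<longleftrightarrow> y \<otimes> x \<otimes> inv y = z"
    by (simp add: joins_def twist_small)
  also have "\<dots> \<longleftrightarrow> y \<otimes> x = z \<otimes> y" using inv_solve_right'[of z "y \<otimes> x" y] by auto
  finally show ?thesis .
qed

text \<open>With one half twist in each region the bottom relations say that the products of consecutive meridians
agree, taken in one or the other order. Given \<open>a\<close> and \<open>b\<close>, the first relation determines the third meridian.\<close>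

lemma joins_trefoil:
  assumes [simp]: "a \<in> carrier G" "b \<in> carrier G" and ab: "braided G a b"
  defines "c \<equiv> inv b \<otimes> a \<otimes> b" and "d \<equiv> b \<otimes> a \<otimes> inv b"
  shows "joins G a 1 b 1 c" "joins G b 1 c 1 a" "joins G c 1 a 1 b"
    and "joins G a (-1) b (-1) d" "joins G b (-1) d (-1) a" "joins G d (-1) a (-1) b"
proof -
  have [simp]: "c \<in> carrier G" "d \<in> carrier G" by (simp_all add: c_def d_def)
  have c: "b \<otimes> c = a \<otimes> b" "c \<otimes> a = a \<otimes> b"
  proof -
    show "b \<otimes> c = a \<otimes> b" by (simp add: c_def m_assoc)
    have "c \<otimes> a = inv b \<otimes> (a \<otimes> b \<otimes> a)" by (simp add: c_def m_assoc)
    also have "\<dots> = a \<otimes> b" unfolding ab[unfolded braided_def] by (simp add: m_assoc)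
    finally show "c \<otimes> a = a \<otimes> b" .
  qed
  have d: "d \<otimes> b = b \<otimes> a" "a \<otimes> d = b \<otimes> a"
  proof -
    show "d \<otimes> b = b \<otimes> a" by (simp add: d_def m_assoc)
    have "a \<otimes> d = (a \<otimes> b \<otimes> a) \<otimes> inv b" by (simp add: d_def m_assoc)
    also have "\<dots> = b \<otimes> a" unfolding ab[unfolded braided_def] by (simp add: m_assoc)
    finally show "a \<otimes> d = b \<otimes> a" .
  qed
  show "joins G a 1 b 1 c" "joins G b 1 c 1 a" "joins G c 1 a 1 b"
    by (simp_all add: joins_one c)
  show "joins G a (-1) b (-1) d" "joins G b (-1) d (-1) a" "joins G d (-1) a (-1) b"
    by (simp_all add: joins_minus_one d)
qed

text \<open>The value of \<open>x\<close> is forced by the second relation, which reads \<open>twist G b (inv c) 3 = x\<close>. The other two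
follow from \<open>xb\<close>, an identity between conjugates of a braided pair.\<close>

lemma joins_3_3_minus_1:
  assumes [simp]: "b \<in> carrier G" "c \<in> carrier G" and bc: "braided G b c"
  defines "x \<equiv> b \<otimes> b \<otimes> c \<otimes> inv b \<otimes> inv b"
  shows "joins G x 3 b 3 c" "joins G b 3 c (-1) x" "joins G c (-1) x 3 b"
proof -
  have x_conj: "x = b \<otimes> (b \<otimes> c \<otimes> inv b) \<otimes> inv b" by (simp add: x_def m_assoc)
  have [simp]: "x \<in> carrier G" by (simp add: x_def)
  have x: "x = b \<otimes> inv c \<otimes> b \<otimes> c \<otimes> inv b"
    unfolding x_conj braided_conjugations[OF assms(1,2) bc] by (simp add: m_assoc)
  have "braided G x b"
    using braided_conjugate[OF assms(2,1), of "b \<otimes> b"] bc braided_sym[OF bc]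
    by (simp add: x_def m_assoc inv_mult_group)
  from braided_conjugations[OF _ _ this]
  have xb: "x \<otimes> b \<otimes> inv x = b \<otimes> c \<otimes> inv b" by (simp add: x_def m_assoc)
  have "twist G x (inv b) 3 = x \<otimes> inv b \<otimes> (x \<otimes> b \<otimes> inv x)" by (simp add: twist_small m_assoc)
  also have "\<dots> = x \<otimes> c \<otimes> inv b" unfolding xb by (simp add: m_assoc)
  also have "\<dots> = inv twist G b (inv c) 4"
    unfolding x by (simp add: twist_small inv_mult_group m_assoc)
  finally show "joins G x 3 b 3 c" by (simp add: joins_def)
  show "joins G b 3 c (-1) x" unfolding joins_def by (simp add: twist_small x)
  have "inv twist G x (inv b) 4 = x \<otimes> (inv b \<otimes> (x \<otimes> b \<otimes> inv x) \<otimes> b) \<otimes> inv x"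
    by (simp add: twist_small inv_mult_group m_assoc)
  also have "\<dots> = x \<otimes> c \<otimes> inv x" unfolding xb by (simp add: m_assoc)
  finally show "joins G c (-1) x 3 b" by (simp add: joins_def twist_small)
qed

text \<open>The mirror image of \<open>joins_3_3_minus_1\<close>; now the third relation forces \<open>z\<close>.\<close>

lemma joins_minus_3_minus_3_1:
  assumes [simp]: "a \<in> carrier G" "b \<in> carrier G" and ab: "braided G a b"
  defines "z \<equiv> b \<otimes> b \<otimes> a \<otimes> inv b \<otimes> inv b"
  shows "joins G a (-3) b (-3) z" "joins G b (-3) z 1 a" "joins G z 1 a (-3) b"
proof -
  have z_conj: "z = b \<otimes> (b \<otimes> a \<otimes> inv b) \<otimes> inv b" by (simp add: z_def m_assoc)
  have [simp]: "z \<in> carrier G" by (simp add: z_def)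
  have z: "z = b \<otimes> inv a \<otimes> b \<otimes> a \<otimes> inv b"
    unfolding z_conj braided_conjugations[OF assms(2,1) braided_sym[OF ab]] by (simp add: m_assoc)
  have "braided G z b"
    using braided_conjugate[OF assms(1,2), of "b \<otimes> b"] ab
    by (simp add: z_def m_assoc inv_mult_group)
  from braided_conjugations[OF _ _ this]
  have zb: "z \<otimes> b \<otimes> inv z = b \<otimes> a \<otimes> inv b" by (simp add: z_def m_assoc)
  have "inv twist G b (inv z) (-2) = z \<otimes> inv b \<otimes> (z \<otimes> b \<otimes> inv z)"
    by (simp add: twist_small inv_mult_group m_assoc)
  also have "\<dots> = z \<otimes> a \<otimes> inv b" unfolding zb by (simp add: m_assoc)
  also have "\<dots> = twist G a (inv b) (-3)"
    unfolding z by (simp add: twist_small inv_mult_group m_assoc)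
  finally show "joins G a (-3) b (-3) z" by (simp add: joins_def)
  have "twist G b (inv z) (-3) = z \<otimes> (inv b \<otimes> (z \<otimes> b \<otimes> inv z) \<otimes> b) \<otimes> inv z"
    by (simp add: twist_small inv_mult_group m_assoc)
  also have "\<dots> = z \<otimes> a \<otimes> inv z" unfolding zb by (simp add: m_assoc)
  finally show "joins G b (-3) z 1 a" by (simp add: joins_def twist_small inv_mult_group m_assoc)
  show "joins G z 1 a (-3) b"
    unfolding joins_def by (simp add: twist_small z inv_mult_group m_assoc)
qed

end

text \<open>The three band generators \<open>s1\<close>, \<open>s2\<close> and \<open>s3\<close> of the braid group lie over the three transpositions, and any
two of them are braided.\<close>

lemma braided_simple_braids_exist:
  assumes "\<not> [c = c'] (mod 3)"
  obtains a b where "a \<in> simple_braids" "b \<in> simple_braids" "braided B3 a b"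
    "braid_permutation a = reflection c" "braid_permutation b = reflection c'"
proof -
  interpret P: group_hom B3 S3 braid_permutation
    using braid_permutation_hom by (simp add: group_hom_def group_hom_axioms_def group_B3 group_S3)
  define s1 s2 where "s1 = artin_generator 1" and "s2 = artin_generator 2"
  define s3 where "s3 = s1 \<otimes>\<^bsub>B3\<^esub> s2 \<otimes>\<^bsub>B3\<^esub> inv\<^bsub>B3\<^esub> s1"
  have [simp]: "s1 \<in> carrier B3" "s2 \<in> carrier B3" by (simp_all add: s1_def s2_def)
  have [simp]: "s3 \<in> carrier B3" by (simp add: s3_def)
  have b12: "braided B3 s1 s2" using braid_relation by (simp add: braided_def s1_def s2_def)
  have s3': "s3 = inv\<^bsub>B3\<^esub> s2 \<otimes>\<^bsub>B3\<^esub> s1 \<otimes>\<^bsub>B3\<^esub> s2"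
    unfolding s3_def by (rule B3.braided_conjugations) (simp_all add: b12)
  have b13: "braided B3 s1 s3"
    using B3.braided_conjugate[of s1 s2 s1] b12 by (simp add: s3_def B3.m_assoc)
  have b23: "braided B3 s2 s3"
    using B3.braided_conjugate[of s2 s1 "inv\<^bsub>B3\<^esub> s2"] braided_sym[OF b12] by (simp add: s3' B3.m_assoc)
  have s1: "s1 \<in> simple_braids" unfolding s1_def by (rule simple_braids(2))
  have "s2 = (s1 \<otimes>\<^bsub>B3\<^esub> s2) \<otimes>\<^bsub>B3\<^esub> s1 \<otimes>\<^bsub>B3\<^esub> inv\<^bsub>B3\<^esub> (s1 \<otimes>\<^bsub>B3\<^esub> s2)"
    using b12 by (simp add: braided_def B3.m_assoc B3.inv_mult_group flip: B3.m_assoc)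
      (simp add: B3.m_assoc)
  then have s2: "s2 \<in> simple_braids" using simple_braids(4)[OF _ s1, of "s1 \<otimes>\<^bsub>B3\<^esub> s2"] by simp
  have s3: "s3 \<in> simple_braids" unfolding s3_def by (intro simple_braids(4) s2) simp
  have perm: "braid_permutation s1 = reflection 0" "braid_permutation s2 = reflection 1"
    using braid_permutation_artin by (simp_all add: s1_def s2_def)
  have perm3: "braid_permutation s3 = reflection 2"
  proof -
    have "braid_permutation s3 = reflection 0 \<circ> reflection 1 \<circ> reflection 0"
      by (simp add: s3_def perm sym_group_mult del: P.hom_inv) (simp add: perm P.hom_inv)
    also have "\<dots> = reflection 2" unfolding reflection_conjugate by (rule reflection_cong) (simp add: cong_def)
    finally show ?thesis .
  qed
  define f where "f = (\<lambda>c::int. if c mod 3 = 0 then s1 else if c mod 3 = 1 then s2 else s3)"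
  have f: "f c \<in> simple_braids" "braid_permutation (f c) = reflection c" for c :: int
    using s1 s2 s3 perm perm3 reflection_cong[of 0 c] reflection_cong[of 1 c] reflection_cong[of 2 c]
    by (cases c rule: mod_3_cases; simp add: f_def cong_def)+
  have "braided B3 (f c) (f c')"
    using assms b12 b13 b23 braided_sym
    by (cases c rule: mod_3_cases; cases c' rule: mod_3_cases) (auto simp: f_def cong_def)
  then show ?thesis using that f by blast
qed

lemma simple_braid_exists:
  obtains a where "a \<in> simple_braids" "braid_permutation a = reflection c"
proof -
  have "\<not> [c = c + 1] (mod 3)" by (simp add: cong_iff_dvd_diff)
  then show ?thesis using that braided_simple_braids_exist by metis
qed

lemma braid_permutation_conjugate:
  assumes "g \<in> carrier B3" "a \<in> carrier B3" "braid_permutation g = reflection d"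
    "braid_permutation a = reflection c"
  shows "braid_permutation (g \<otimes>\<^bsub>B3\<^esub> a \<otimes>\<^bsub>B3\<^esub> inv\<^bsub>B3\<^esub> g) = reflection (2 * d - c)"
    "braid_permutation (inv\<^bsub>B3\<^esub> g \<otimes>\<^bsub>B3\<^esub> a \<otimes>\<^bsub>B3\<^esub> g) = reflection (2 * d - c)"
proof -
  interpret P: group_hom B3 S3 braid_permutation
    using braid_permutation_hom by (simp add: group_hom_def group_hom_axioms_def group_B3 group_S3)
  have inv: "braid_permutation (inv\<^bsub>B3\<^esub> g) = reflection d"
    using P.hom_inv[OF assms(1)] unfolding assms(3) inv_reflection .
  show "braid_permutation (g \<otimes>\<^bsub>B3\<^esub> a \<otimes>\<^bsub>B3\<^esub> inv\<^bsub>B3\<^esub> g) = reflection (2 * d - c)"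
    "braid_permutation (inv\<^bsub>B3\<^esub> g \<otimes>\<^bsub>B3\<^esub> a \<otimes>\<^bsub>B3\<^esub> g) = reflection (2 * d - c)"
    using P.hom_mult B3.m_closed B3.inv_closed assms inv reflection_conjugate[of d c]
    by (metis sym_group_mult)+
qed

lemma lifting_braids_constant_region:
  assumes "even p" "[a = b] (mod 3)" "[a = c] (mod 3) \<or> 3 dvd q \<and> 3 dvd r"
  shows "lifting_braids p a q b r c"
proof -
  interpret P: group_hom B3 S3 braid_permutation
    using braid_permutation_hom by (simp add: group_hom_def group_hom_axioms_def group_B3 group_S3)
  obtain x y where xy: "x \<in> simple_braids" "y \<in> simple_braids"
    "braid_permutation x = reflection a" "braid_permutation y = reflection c"
    "x = y \<or> braided B3 x y \<and> 3 dvd q \<and> 3 dvd r"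
  proof (cases "[a = c] (mod 3)")
    case True
    obtain x where "x \<in> simple_braids" "braid_permutation x = reflection a"
      by (rule simple_braid_exists)
    then show ?thesis using that[of x x] reflection_cong[OF True] by simp
  next
    case False
    then show ?thesis using that assms(3) by (metis braided_simple_braids_exist)
  qed
  have carr: "x \<in> carrier B3" "y \<in> carrier B3" using xy(1,2) simple_braids(1) by blast+
  show ?thesis
  proof (rule lifting_braidsI[OF xy(1,1) simple_braids(3)[OF xy(2)] xy(3)])
    show "braid_permutation x = reflection b" using xy(3) reflection_cong[OF assms(2)] by simp
    show "braid_permutation (inv\<^bsub>B3\<^esub> y) = reflection c"
      using P.hom_inv[OF carr(2)] unfolding xy(4) inv_reflection .
  qed (rule B3.joins_trivial_even_region[OF carr xy(5) assms(1)])+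
qed

lemma lifting_braids_trefoil:
  assumes "\<not> [a = b] (mod 3)" "[a - b = b - c] (mod 3)" "\<sigma> \<in> {1, -1}"
  shows "lifting_braids \<sigma> a \<sigma> b \<sigma> c"
proof -
  obtain x y where xy: "x \<in> simple_braids" "y \<in> simple_braids" "braided B3 x y"
    "braid_permutation x = reflection a" "braid_permutation y = reflection b"
    using braided_simple_braids_exist[OF assms(1)] .
  have carr: "x \<in> carrier B3" "y \<in> carrier B3" using xy simple_braids(1) by blast+
  have third: "reflection (2 * b - a) = reflection c"
  proof (rule reflection_cong)
    have "2 * b - a - c = - (a - b - (b - c))" by simp
    then show "[2 * b - a = c] (mod 3)" using assms(2) unfolding cong_iff_dvd_diff by (metis dvd_minus_iff)
  qed
  note perm = braid_permutation_conjugate[OF carr(2,1) xy(5,4), unfolded third]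
  have z: "inv\<^bsub>B3\<^esub> y \<otimes>\<^bsub>B3\<^esub> x \<otimes>\<^bsub>B3\<^esub> y \<in> simple_braids" "y \<otimes>\<^bsub>B3\<^esub> x \<otimes>\<^bsub>B3\<^esub> inv\<^bsub>B3\<^esub> y \<in> simple_braids"
    using simple_braids(4)[OF _ xy(1), of "inv\<^bsub>B3\<^esub> y"] simple_braids(4)[OF carr(2) xy(1)] carr by simp_all
  note joins = B3.joins_trefoil[OF carr xy(3)]
  show ?thesis
    using lifting_braidsI[OF xy(1,2) z(1) xy(4,5) perm(2) joins(1-3)]
      lifting_braidsI[OF xy(1,2) z(2) xy(4,5) perm(1) joins(4-6)] assms(3) by auto
qed

lemma lifting_braids_3_3_minus_1:
  assumes "\<not> [a = b] (mod 3)" "[c = a] (mod 3)" "\<sigma> \<in> {1, -1}"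
  shows "lifting_braids (\<sigma> * 3) a (\<sigma> * 3) b (- \<sigma>) c"
proof -
  obtain x y where xy: "x \<in> simple_braids" "y \<in> simple_braids" "braided B3 x y"
    "braid_permutation x = reflection a" "braid_permutation y = reflection b"
    using braided_simple_braids_exist[OF assms(1)] .
  have carr: "x \<in> carrier B3" "y \<in> carrier B3" using xy simple_braids(1) by blast+
  have c: "reflection c = reflection a" by (rule reflection_cong[OF assms(2)])
  define z where "z = y \<otimes>\<^bsub>B3\<^esub> y \<otimes>\<^bsub>B3\<^esub> x \<otimes>\<^bsub>B3\<^esub> inv\<^bsub>B3\<^esub> y \<otimes>\<^bsub>B3\<^esub> inv\<^bsub>B3\<^esub> y"
  have z_conj: "z = y \<otimes>\<^bsub>B3\<^esub> (y \<otimes>\<^bsub>B3\<^esub> x \<otimes>\<^bsub>B3\<^esub> inv\<^bsub>B3\<^esub> y) \<otimes>\<^bsub>B3\<^esub> inv\<^bsub>B3\<^esub> y"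
    using carr by (simp add: z_def B3.m_assoc)
  have z: "z \<in> simple_braids" unfolding z_conj by (intro simple_braids(4) xy carr)
  have "braid_permutation z = reflection (2 * b - (2 * b - a))"
    unfolding z_conj using carr xy
    by (intro braid_permutation_conjugate(1)) (simp_all add: braid_permutation_conjugate(1))
  then have perm: "braid_permutation z = reflection a" by simp
  consider "\<sigma> = 1" | "\<sigma> = -1" using assms(3) by auto
  then show ?thesis
  proof cases
    case 1
    have "lifting_braids 3 a 3 b (-1) c"
      by (rule lifting_braidsI[OF z xy(2,1) perm xy(5)])
        (use B3.joins_3_3_minus_1[OF carr(2,1) braided_sym[OF xy(3)], folded z_def] xy c in simp_all)
    then show ?thesis using 1 by simp
  next
    case 2
    have "lifting_braids (-3) a (-3) b 1 c"
      by (rule lifting_braidsI[OF xy(1,2) z xy(4,5)])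
        (use B3.joins_minus_3_minus_3_1[OF carr xy(3), folded z_def] perm c in simp_all)
    then show ?thesis using 2 by simp
  qed
qed

lemma dvd_third:
  fixes x y z d :: int
  assumes "x + y + z = 0" "d dvd x" "d dvd y"
  shows "d dvd z"
proof -
  have "z = - (x + y)" using assms(1) by simp
  then show ?thesis using assms(2,3) by simp
qed

lemma three_dvd_cancel:
  fixes \<sigma> x y :: int
  assumes "\<sigma> \<in> {1, -1}" "3 dvd \<sigma> * 3 * x - - \<sigma> * y"
  shows "3 dvd y"
proof -
  have "\<sigma> * 3 * x - - \<sigma> * y = 3 * (\<sigma> * x) + \<sigma> * y" by simp
  then have "3 dvd \<sigma> * y" using assms(2) by (metis dvd_add_right_iff dvd_triv_left)
  then show ?thesis using assms(1) by auto
qed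

lemma lifting_braids_odd_sufficient:
  assumes cong: "[p * (a - b) = q * (b - c)] (mod 3)" "[q * (b - c) = r * (c - a)] (mod 3)"
      "[r * (c - a) = p * (a - b)] (mod 3)"
    and neq: "\<not> ([a = b] (mod 3) \<and> [b = c] (mod 3))" and \<sigma>: "\<sigma> \<in> {1, -1}"
    and pqr: "(\<sigma> * p, \<sigma> * q, \<sigma> * r) \<in> {(1, 1, 1), (3, 3, -1), (3, -1, 3), (-1, 3, 3)}"
  shows "lifting_braids p a q b r c"
proof -
  note dvd = cong[unfolded cong_iff_dvd_diff] and neq' = neq[unfolded cong_iff_dvd_diff]
  have \<sigma>_dvd: "3 dvd \<sigma> * x \<longleftrightarrow> 3 dvd x" for x using \<sigma> by auto
  have solve: "x = \<sigma> * y" if "\<sigma> * x = y" for x y using \<sigma> that by auto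
  consider "\<sigma> * p = 1" "\<sigma> * q = 1" "\<sigma> * r = 1" | "\<sigma> * p = 3" "\<sigma> * q = 3" "\<sigma> * r = -1"
    | "\<sigma> * p = 3" "\<sigma> * q = -1" "\<sigma> * r = 3" | "\<sigma> * p = -1" "\<sigma> * q = 3" "\<sigma> * r = 3"
    using pqr by auto
  then show ?thesis
  proof cases
    case 1
    have pqr: "p = \<sigma>" "q = \<sigma>" "r = \<sigma>"
      using solve[OF 1(1)] solve[OF 1(2)] solve[OF 1(3)] by simp_all
    have "3 dvd a - b - (b - c)"
      using dvd(1) unfolding pqr right_diff_distrib[symmetric] \<sigma>_dvd .
    moreover have "\<not> 3 dvd a - b"
    proof
      assume ab: "3 dvd a - b"
      have "3 dvd (a - b) - (a - b - (b - c))" by (rule dvd_diff[OF ab \<open>3 dvd a - b - (b - c)\<close>])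
      then have "3 dvd b - c" by simp
      then show False using neq' ab by blast
    qed
    ultimately show ?thesis unfolding pqr
      by (intro lifting_braids_trefoil[OF _ _ \<sigma>]) (simp_all add: cong_iff_dvd_diff)
  next
    case 2
    have pqr: "p = \<sigma> * 3" "q = \<sigma> * 3" "r = - \<sigma>"
      using solve[OF 2(1)] solve[OF 2(2)] solve[OF 2(3)] by simp_all
    have d: "3 dvd c - a" using dvd(2) unfolding pqr by (rule three_dvd_cancel[OF \<sigma>])
    have "\<not> 3 dvd a - b"
    proof
      assume h: "3 dvd a - b"
      have "3 dvd b - c" by (rule dvd_third[OF _ d h]) simp
      then show False using neq' d h by blast
    qed
    with d show ?thesis unfolding pqr
      by (intro lifting_braids_3_3_minus_1[OF _ _ \<sigma>]) (simp_all add: cong_iff_dvd_diff)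
  next
    case 3
    have pqr: "p = \<sigma> * 3" "q = - \<sigma>" "r = \<sigma> * 3"
      using solve[OF 3(1)] solve[OF 3(2)] solve[OF 3(3)] by simp_all
    have d: "3 dvd b - c" using dvd(1) unfolding pqr by (rule three_dvd_cancel[OF \<sigma>])
    have "\<not> 3 dvd c - a"
    proof
      assume h: "3 dvd c - a"
      have "3 dvd a - b" by (rule dvd_third[OF _ d h]) simp
      then show False using neq' d h by blast
    qed
    with d have "lifting_braids (\<sigma> * 3) c (\<sigma> * 3) a (- \<sigma>) b"
      by (intro lifting_braids_3_3_minus_1[OF _ _ \<sigma>]) (simp_all add: cong_iff_dvd_diff)
    then show ?thesis unfolding pqr by (rule lifting_braids_rotate)
  next
    case 4
    have pqr: "p = - \<sigma>" "q = \<sigma> * 3" "r = \<sigma> * 3"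
      using solve[OF 4(1)] solve[OF 4(2)] solve[OF 4(3)] by simp_all
    have d: "3 dvd a - b" using dvd(3) unfolding pqr by (rule three_dvd_cancel[OF \<sigma>])
    have "\<not> 3 dvd b - c" using neq' d by blast
    with d have "lifting_braids (\<sigma> * 3) b (\<sigma> * 3) c (- \<sigma>) a"
      by (intro lifting_braids_3_3_minus_1[OF _ _ \<sigma>]) (simp_all add: cong_iff_dvd_diff)
    then show ?thesis unfolding pqr by (rule lifting_braids_rotate[OF lifting_braids_rotate])
  qed
qed

text \<open>Equal labels at the first region make the other two differences of labels opposite, so that either all labels
agree or 3 divides both other lengths.\<close>

lemma lifting_braids_constant_labels:
  assumes "even p" "[a = b] (mod 3)" "[p * (a - b) = q * (b - c)] (mod 3)" "[r * (c - a) = p * (a - b)] (mod 3)"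
  shows "lifting_braids p a q b r c"
proof (rule lifting_braids_constant_region[OF assms(1,2)])
  have ab: "3 dvd a - b" using assms(2) by (simp add: cong_iff_dvd_diff)
  have q: "3 dvd q * (b - c)"
    using assms(3) ab by (metis cong_dvd_iff dvd_mult)
  have r: "3 dvd r * (c - a)"
    using assms(4) ab by (metis cong_dvd_iff dvd_mult)
  have prime: "prime (3::int)" by simp
  show "[a = c] (mod 3) \<or> 3 dvd q \<and> 3 dvd r"
  proof (cases "[a = c] (mod 3)")
    case False
    then have "\<not> 3 dvd c - a" by (metis cong_iff_dvd_diff cong_sym)
    moreover from this have "\<not> 3 dvd b - c" using dvd_third[OF _ ab, of "b - c" "c - a"] by fastforce
    ultimately show ?thesis using q r prime_dvd_mult_iff[OF prime] by blast
  qed simp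
qed

section \<open>Counting tricolorings up to conjugation\<close>

definition color_pattern :: "int list \<Rightarrow> (segment word set \<Rightarrow> nat \<Rightarrow> nat) \<Rightarrow> bool \<times> bool \<times> bool" where
  "color_pattern qs \<phi> = (top_values qs \<phi> 0 = top_values qs \<phi> 1, top_values qs \<phi> 1 = top_values qs \<phi> 2,
    top_values qs \<phi> 2 = top_values qs \<phi> 0)"

lemma (in group) conjugates_eq_iff:
  assumes "g \<in> carrier G" "x \<in> carrier G" "y \<in> carrier G"
  shows "g \<otimes> x \<otimes> inv g = g \<otimes> y \<otimes> inv g \<longleftrightarrow> x = y"
  using assms by simp

text \<open>Conjugation by a reflection maps \<open>c\<close> to \<open>2 * d - c\<close> for some \<open>d\<close>, and products of two of them are translations.\<close>

lemma affine_reflection_conjugation: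
  assumes "s \<in> {1, -1}"
  shows "\<exists>g\<in>carrier S3. \<forall>c. g \<otimes>\<^bsub>S3\<^esub> reflection c \<otimes>\<^bsub>S3\<^esub> inv\<^bsub>S3\<^esub> g = reflection (s * c + t)"
proof -
  consider "s = 1" | "s = -1" using assms by auto
  then show ?thesis
  proof cases
    case 1
    define g where "g = reflection (2 * t) \<otimes>\<^bsub>S3\<^esub> reflection 0"
    have g: "g \<in> carrier S3" by (simp add: g_def)
    have "g \<otimes>\<^bsub>S3\<^esub> reflection c \<otimes>\<^bsub>S3\<^esub> inv\<^bsub>S3\<^esub> g = reflection (c + t)" for c
    proof -
      have "inv\<^bsub>S3\<^esub> g = reflection 0 \<otimes>\<^bsub>S3\<^esub> reflection (2 * t)"
        unfolding g_def using S3.inv_mult_group[OF reflection_in_S3 reflection_in_S3] by (simp only: inv_reflection)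
      then have "g \<otimes>\<^bsub>S3\<^esub> reflection c \<otimes>\<^bsub>S3\<^esub> inv\<^bsub>S3\<^esub> g =
          reflection (2 * t) \<circ> (reflection 0 \<circ> reflection c \<circ> reflection 0) \<circ> reflection (2 * t)"
        by (simp only: g_def sym_group_mult comp_assoc)
      also have "\<dots> = reflection (2 * (2 * t) - (2 * 0 - c))" unfolding reflection_conjugate ..
      also have "\<dots> = reflection (c + t)" by (rule reflection_cong) (simp add: cong_iff_dvd_diff)
      finally show ?thesis .
    qed
    then show ?thesis using g 1 by (intro bexI[of _ g]) simp_all
  next
    case 2
    have "reflection (2 * t) \<otimes>\<^bsub>S3\<^esub> reflection c \<otimes>\<^bsub>S3\<^esub> inv\<^bsub>S3\<^esub> reflection (2 * t) = reflection (t - c)" for c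
    proof -
      have "reflection (2 * t) \<otimes>\<^bsub>S3\<^esub> reflection c \<otimes>\<^bsub>S3\<^esub> inv\<^bsub>S3\<^esub> reflection (2 * t) =
          reflection (2 * (2 * t) - c)"
        by (simp only: inv_reflection sym_group_mult reflection_conjugate)
      also have "\<dots> = reflection (t - c)" by (rule reflection_cong) (simp add: cong_iff_dvd_diff)
      finally show ?thesis .
    qed
    then show ?thesis using 2 by (intro bexI[of _ "reflection (2 * t)"]) simp_all
  qed
qed

text \<open>Three residues modulo 3 are determined up to an affine bijection by the pairs of them that agree.\<close>

lemma same_pattern_affine:
  fixes a b c a' b' c' :: int
  assumes ab: "[a = b] (mod 3) \<longleftrightarrow> [a' = b'] (mod 3)" and bc: "[b = c] (mod 3) \<longleftrightarrow> [b' = c'] (mod 3)"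
    and ca: "[c = a] (mod 3) \<longleftrightarrow> [c' = a'] (mod 3)"
  shows "\<exists>s\<in>{1, -1}. \<exists>t. [s * a + t = a'] (mod 3) \<and> [s * b + t = b'] (mod 3) \<and> [s * c + t = c'] (mod 3)"
proof -
  define u v u' v' where "u = a - b" and "v = b - c" and "u' = a' - b'" and "v' = b' - c'"
  have zero_iff: "[x = y] (mod 3) \<longleftrightarrow> (x - y) mod 3 = 0" for x y :: int
    unfolding cong_iff_dvd_diff by (rule dvd_eq_mod_eq_0)
  have "a - c = u + v" "a' - c' = u' + v'" by (simp_all add: u_def v_def u'_def v'_def)
  moreover have "[a = c] (mod 3) \<longleftrightarrow> [a' = c'] (mod 3)" using ca by (simp only: cong_sym_eq)
  ultimately have "(u + v) mod 3 = 0 \<longleftrightarrow> (u' + v') mod 3 = 0" by (simp only: zero_iff)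
  then have zero: "u mod 3 = 0 \<longleftrightarrow> u' mod 3 = 0" "v mod 3 = 0 \<longleftrightarrow> v' mod 3 = 0"
    "(u mod 3 + v mod 3) mod 3 = 0 \<longleftrightarrow> (u' mod 3 + v' mod 3) mod 3 = 0"
    using ab bc unfolding u_def v_def u'_def v'_def by (simp_all only: zero_iff mod_add_eq)
  have "(u' mod 3 = u mod 3 \<and> v' mod 3 = v mod 3) \<or>
      (u' mod 3 = (- (u mod 3)) mod 3 \<and> v' mod 3 = (- (v mod 3)) mod 3)"
  proof -
    have check: "\<forall>U\<in>{0, 1, 2::int}. \<forall>V\<in>{0, 1, 2}. \<forall>U'\<in>{0, 1, 2}. \<forall>V'\<in>{0, 1, 2}.
        (U = 0 \<longleftrightarrow> U' = 0) \<longrightarrow> (V = 0 \<longleftrightarrow> V' = 0) \<longrightarrow>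
        ((U + V) mod 3 = 0 \<longleftrightarrow> (U' + V') mod 3 = 0) \<longrightarrow>
        (U' = U \<and> V' = V) \<or> (U' = (- U) mod 3 \<and> V' = (- V) mod 3)"
      by simp
    have residue: "x mod 3 \<in> {0, 1, 2}" for x :: int by (cases x rule: mod_3_cases) simp_all
    show ?thesis
      by (rule check[THEN bspec, THEN bspec, THEN bspec, THEN bspec, THEN mp, THEN mp, THEN mp,
            OF residue residue residue residue zero])
  qed
  then have "([u' = 1 * u] (mod 3) \<and> [v' = 1 * v] (mod 3)) \<or> ([u' = -1 * u] (mod 3) \<and> [v' = -1 * v] (mod 3))"
    by (simp only: cong_def mod_minus_eq mult_1 mult_minus1)
  then obtain s where s: "s \<in> {1, -1}" "[u' = s * u] (mod 3)" "[v' = s * v] (mod 3)" by blast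
  have "[s * a + (b' - s * b) = a'] (mod 3)"
  proof -
    have "s * a + (b' - s * b) - a' = - (u' - s * u)" by (simp add: u_def u'_def algebra_simps)
    then show ?thesis using s(2) by (simp only: cong_iff_dvd_diff dvd_minus_iff)
  qed
  moreover have "[s * b + (b' - s * b) = b'] (mod 3)" by simp
  moreover have "[s * c + (b' - s * b) = c'] (mod 3)"
  proof -
    have "s * c + (b' - s * b) - c' = v' - s * v" by (simp add: v_def v'_def algebra_simps)
    then show ?thesis using s(3) by (simp only: cong_iff_dvd_diff)
  qed
  ultimately show ?thesis using s(1) by blast
qed

lemma tricoloring_equiv_iff:
  assumes \<phi>: "\<phi> \<in> tricolorings [p, q, r]" and \<psi>: "\<psi> \<in> tricolorings [p, q, r]"
  shows "(\<phi>, \<psi>) \<in> tricoloring_equiv [p, q, r] \<longleftrightarrow> color_pattern [p, q, r] \<phi> = color_pattern [p, q, r] \<psi>"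
proof
  assume "(\<phi>, \<psi>) \<in> tricoloring_equiv [p, q, r]"
  then obtain g where g: "g \<in> carrier S3"
    and conj: "\<And>x. x \<in> carrier (pretzel_group [p, q, r]) \<Longrightarrow> \<psi> x = g \<otimes>\<^bsub>S3\<^esub> \<phi> x \<otimes>\<^bsub>S3\<^esub> inv\<^bsub>S3\<^esub> g"
    unfolding tricoloring_equiv_def by blast
  have top: "top_values [p, q, r] \<psi> i = g \<otimes>\<^bsub>S3\<^esub> top_values [p, q, r] \<phi> i \<otimes>\<^bsub>S3\<^esub> inv\<^bsub>S3\<^esub> g"
    "top_values [p, q, r] \<phi> i \<in> carrier S3" if "i < 3" for i
  proof -
    have m: "segment_meridian [p, q, r] (i, 0, L) \<in> carrier (pretzel_group [p, q, r])"
      using that by (intro segment_meridian_in_carrier) (simp add: segments_def)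
    show "top_values [p, q, r] \<psi> i = g \<otimes>\<^bsub>S3\<^esub> top_values [p, q, r] \<phi> i \<otimes>\<^bsub>S3\<^esub> inv\<^bsub>S3\<^esub> g"
      using conj[OF m] by (simp add: top_values_def)
    show "top_values [p, q, r] \<phi> i \<in> carrier S3"
      using m \<phi> by (auto simp: top_values_def tricolorings_def hom_def)
  qed
  have "top_values [p, q, r] \<psi> i = top_values [p, q, r] \<psi> j \<longleftrightarrow>
      top_values [p, q, r] \<phi> i = top_values [p, q, r] \<phi> j" if "i < 3" "j < 3" for i j
    unfolding top(1)[OF that(1)] top(1)[OF that(2)]
    by (rule S3.conjugates_eq_iff[OF g top(2)[OF that(1)] top(2)[OF that(2)]])
  then show "color_pattern [p, q, r] \<phi> = color_pattern [p, q, r] \<psi>"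
    by (simp add: color_pattern_def)
next
  assume pattern: "color_pattern [p, q, r] \<phi> = color_pattern [p, q, r] \<psi>"
  obtain a b c where top: "top_values [p, q, r] \<phi> 0 = reflection a"
    "top_values [p, q, r] \<phi> 1 = reflection b" "top_values [p, q, r] \<phi> 2 = reflection c"
    by (rule tricoloring_labels[OF \<phi>])
  obtain a' b' c' where top': "top_values [p, q, r] \<psi> 0 = reflection a'"
    "top_values [p, q, r] \<psi> 1 = reflection b'" "top_values [p, q, r] \<psi> 2 = reflection c'"
    by (rule tricoloring_labels[OF \<psi>])
  have iffs: "[a = b] (mod 3) \<longleftrightarrow> [a' = b'] (mod 3)" "[b = c] (mod 3) \<longleftrightarrow> [b' = c'] (mod 3)"
    "[c = a] (mod 3) \<longleftrightarrow> [c' = a'] (mod 3)"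
    using pattern unfolding color_pattern_def top top' reflection_eq_iff by simp_all
  obtain s t where s: "s \<in> {1, -1}" and st: "[s * a + t = a'] (mod 3)" "[s * b + t = b'] (mod 3)"
    "[s * c + t = c'] (mod 3)" using same_pattern_affine[OF iffs] by blast
  obtain g where g: "g \<in> carrier S3"
    and conj: "\<And>c. g \<otimes>\<^bsub>S3\<^esub> reflection c \<otimes>\<^bsub>S3\<^esub> inv\<^bsub>S3\<^esub> g = reflection (s * c + t)"
    using affine_reflection_conjugation[OF s] by blast
  have hom: "\<phi> \<in> hom (pretzel_group [p, q, r]) S3" "\<psi> \<in> hom (pretzel_group [p, q, r]) S3"
    using \<phi> \<psi> by (simp_all add: tricolorings_def)
  have hom': "(\<lambda>x. g \<otimes>\<^bsub>S3\<^esub> \<phi> x \<otimes>\<^bsub>S3\<^esub> inv\<^bsub>S3\<^esub> g) \<in> hom (pretzel_group [p, q, r]) S3"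
  proof (rule homI)
    fix x y assume xy: "x \<in> carrier (pretzel_group [p, q, r])" "y \<in> carrier (pretzel_group [p, q, r])"
    then have in_S3: "\<phi> x \<in> carrier S3" "\<phi> y \<in> carrier S3" using hom(1) by (auto simp: hom_def)
    then show "g \<otimes>\<^bsub>S3\<^esub> \<phi> x \<otimes>\<^bsub>S3\<^esub> inv\<^bsub>S3\<^esub> g \<in> carrier S3" using g S3.m_closed S3.inv_closed by metis
    have "\<phi> (x \<otimes>\<^bsub>pretzel_group [p, q, r]\<^esub> y) = \<phi> x \<otimes>\<^bsub>S3\<^esub> \<phi> y" using hom(1) xy by (simp add: hom_def)
    moreover have "inv\<^bsub>S3\<^esub> g \<otimes>\<^bsub>S3\<^esub> (g \<otimes>\<^bsub>S3\<^esub> z) = z" if "z \<in> carrier S3" for z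
      using S3.cancel_left(2)[OF g that] .
    ultimately show "g \<otimes>\<^bsub>S3\<^esub> \<phi> (x \<otimes>\<^bsub>pretzel_group [p, q, r]\<^esub> y) \<otimes>\<^bsub>S3\<^esub> inv\<^bsub>S3\<^esub> g =
        g \<otimes>\<^bsub>S3\<^esub> \<phi> x \<otimes>\<^bsub>S3\<^esub> inv\<^bsub>S3\<^esub> g \<otimes>\<^bsub>S3\<^esub> (g \<otimes>\<^bsub>S3\<^esub> \<phi> y \<otimes>\<^bsub>S3\<^esub> inv\<^bsub>S3\<^esub> g)"
      using in_S3 g by (simp only: S3.m_assoc S3.m_closed S3.inv_closed)
  qed
  have "\<psi> x = g \<otimes>\<^bsub>S3\<^esub> \<phi> x \<otimes>\<^bsub>S3\<^esub> inv\<^bsub>S3\<^esub> g" if "x \<in> carrier (pretzel_group [p, q, r])" for x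
  proof (rule pretzel_homs_eqI[OF group_S3 hom(2) hom' _ that])
    fix i assume "i < length [p, q, r]"
    then consider "i = 0" | "i = 1" | "i = 2" using three_cases[of i] by auto
    then show "top_values [p, q, r] \<psi> i =
        top_values [p, q, r] (\<lambda>x. g \<otimes>\<^bsub>S3\<^esub> \<phi> x \<otimes>\<^bsub>S3\<^esub> inv\<^bsub>S3\<^esub> g) i"
      using top top' conj st reflection_cong unfolding top_values_def by cases metis+
  qed
  then show "(\<phi>, \<psi>) \<in> tricoloring_equiv [p, q, r]"
    using \<phi> \<psi> g unfolding tricoloring_equiv_def by blast
qed

lemma nontrivial_iff_pattern:
  assumes "\<phi> \<in> tricolorings [p, q, r]"
  shows "trivial_tricoloring [p, q, r] \<phi> \<longleftrightarrow> color_pattern [p, q, r] \<phi> = (True, True, True)"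
  unfolding trivial_tricoloring_iff[OF assms] color_pattern_def by auto

lemma nontrivial_tricoloring_classes_eq:
  "nontrivial_tricoloring_classes [p, q, r] =
    (\<lambda>P. {\<psi> \<in> nontrivial_tricolorings [p, q, r]. color_pattern [p, q, r] \<psi> = P}) `
      color_pattern [p, q, r] ` nontrivial_tricolorings [p, q, r]"
proof -
  have "tricoloring_equiv [p, q, r] `` {\<phi>} =
      {\<psi> \<in> nontrivial_tricolorings [p, q, r]. color_pattern [p, q, r] \<psi> = color_pattern [p, q, r] \<phi>}"
    if \<phi>: "\<phi> \<in> nontrivial_tricolorings [p, q, r]" for \<phi>
  proof -
    have \<phi>': "\<phi> \<in> tricolorings [p, q, r]" "color_pattern [p, q, r] \<phi> \<noteq> (True, True, True)"
      using \<phi> nontrivial_iff_pattern by (auto simp: nontrivial_tricolorings_def)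
    have "(\<phi>, \<psi>) \<in> tricoloring_equiv [p, q, r] \<longleftrightarrow> \<psi> \<in> tricolorings [p, q, r] \<and>
        color_pattern [p, q, r] \<phi> = color_pattern [p, q, r] \<psi>" for \<psi>
      using tricoloring_equiv_iff[OF \<phi>'(1)] by (auto simp: tricoloring_equiv_def)
    then show ?thesis using \<phi>' nontrivial_iff_pattern by (auto simp: nontrivial_tricolorings_def)
  qed
  then show ?thesis
    unfolding nontrivial_tricoloring_classes_def quotient_def image_image by blast
qed

lemma tricoloring_with_labels_exists:
  assumes "3 dvd p" "3 dvd q" "3 dvd r"
  shows "\<exists>\<phi>\<in>tricolorings [p, q, r]. top_values [p, q, r] \<phi> 0 = reflection a \<and>
    top_values [p, q, r] \<phi> 1 = reflection b \<and> top_values [p, q, r] \<phi> 2 = reflection c"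
proof -
  define x where "x = (\<lambda>i::nat. reflection (if i = 0 then a else if i = 1 then b else c))"
  have x: "x 0 = reflection a" "x 1 = reflection b" "x 2 = reflection c" by (simp_all add: x_def)
  have "[u * y = v * z] (mod 3)" if "3 dvd u" "3 dvd v" for u v y z :: int
    using that by (simp add: cong_iff_dvd_diff)
  then have "closes_up S3 [p, q, r] x"
    unfolding closes_up_three x joins_reflections using assms by simp
  then obtain \<phi> where \<phi>: "\<phi> \<in> hom (pretzel_group [p, q, r]) S3"
    "\<And>i. i < length [p, q, r] \<Longrightarrow> top_values [p, q, r] \<phi> i = x i"
    using closes_up_hom_exists[OF group_S3] by blast
  have "\<phi> \<in> tricolorings [p, q, r]"
    using \<phi> range_reflection unfolding tricoloring_iff x_def by (metis rangeI)
  moreover have "top_values [p, q, r] \<phi> 0 = reflection a" "top_values [p, q, r] \<phi> 1 = reflection b"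
    "top_values [p, q, r] \<phi> 2 = reflection c"
    using \<phi>(2)[of 0] \<phi>(2)[of 1] \<phi>(2)[of 2] x by simp_all
  ultimately show ?thesis by blast
qed

text \<open>If 3 divides all three lengths, the bottom relations hold for arbitrary labels.\<close>

lemma color_patterns:
  assumes "3 dvd p" "3 dvd q" "3 dvd r"
  shows "color_pattern [p, q, r] ` nontrivial_tricolorings [p, q, r] =
    {(True, False, False), (False, True, False), (False, False, True), (False, False, False)}"
    (is "?A = ?P")
proof
  show "?A \<subseteq> ?P"
  proof
    fix P assume "P \<in> ?A"
    then obtain \<phi> where \<phi>: "\<phi> \<in> tricolorings [p, q, r]" "\<not> trivial_tricoloring [p, q, r] \<phi>"
      "P = color_pattern [p, q, r] \<phi>" by (auto simp: nontrivial_tricolorings_def)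
    then show "P \<in> ?P"
      unfolding trivial_tricoloring_iff[OF \<phi>(1)] color_pattern_def by auto
  qed
  have pattern: "([a = b] (mod 3), [b = c] (mod 3), [c = a] (mod 3)) \<in> ?A"
    if "\<not> ([a = b] (mod 3) \<and> [b = c] (mod 3))" for a b c :: int
  proof -
    obtain \<phi> where \<phi>: "\<phi> \<in> tricolorings [p, q, r]" and top: "top_values [p, q, r] \<phi> 0 = reflection a"
      "top_values [p, q, r] \<phi> 1 = reflection b" "top_values [p, q, r] \<phi> 2 = reflection c"
      using tricoloring_with_labels_exists[OF assms] by blast
    have "color_pattern [p, q, r] \<phi> = ([a = b] (mod 3), [b = c] (mod 3), [c = a] (mod 3))"
      unfolding color_pattern_def top reflection_eq_iff ..
    moreover have "\<phi> \<in> nontrivial_tricolorings [p, q, r]"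
      using \<phi> that unfolding nontrivial_tricolorings_def
      by (simp add: trivial_tricoloring_iff top[simplified] reflection_eq_iff)
    ultimately show ?thesis by (metis imageI)
  qed
  show "?P \<subseteq> ?A"
    using pattern[of 0 0 1] pattern[of 1 0 0] pattern[of 0 1 0] pattern[of 0 1 2]
    by (simp add: cong_def)
qed

lemma four_classes_one_lifts:
  assumes i: "i < 3" "6 dvd [p, q, r] ! i"
    and others: "\<And>j. j < 3 \<Longrightarrow> j \<noteq> i \<Longrightarrow> odd ([p, q, r] ! j) \<and> 3 dvd [p, q, r] ! j"
    and nonzero: "[p, q, r] ! i \<noteq> 0"
  shows "card (nontrivial_tricoloring_classes [p, q, r]) = 4 \<and>
    (\<exists>C\<in>nontrivial_tricoloring_classes [p, q, r]. \<forall>D\<in>nontrivial_tricoloring_classes [p, q, r].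
      \<forall>\<phi>\<in>D. lifts_to_B3 [p, q, r] \<phi> \<longleftrightarrow> D = C)"
proof -
  let ?A = "nontrivial_tricolorings [p, q, r]" and ?pat = "color_pattern [p, q, r]"
  define cls where "cls = (\<lambda>P. {\<psi> \<in> ?A. ?pat \<psi> = P})"
  have "3 dvd [p, q, r] ! j" if "j < 3" for j
    using that others i dvd_trans[of 3 6] by (cases "j = i") auto
  from this[of 0] this[of 1] this[of 2] have dvd: "3 dvd p" "3 dvd q" "3 dvd r" by simp_all
  note patterns = color_patterns[OF dvd]
  have classes: "nontrivial_tricoloring_classes [p, q, r] = cls ` ?pat ` ?A"
    unfolding cls_def by (rule nontrivial_tricoloring_classes_eq)
  have inj: "inj_on cls (?pat ` ?A)" by (auto simp: inj_on_def cls_def)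
  have "card (nontrivial_tricoloring_classes [p, q, r]) = 4"
    unfolding classes card_image[OF inj] unfolding patterns by simp
  moreover define P where "P = (i = 0, i = 1, i = 2)"
  have P: "P \<in> ?pat ` ?A" using three_cases[OF i(1)] unfolding patterns P_def by auto
  have lifts: "lifts_to_B3 [p, q, r] \<phi> \<longleftrightarrow> ?pat \<phi> = P" if "\<phi> \<in> ?A" for \<phi>
  proof -
    have \<phi>: "\<phi> \<in> tricolorings [p, q, r]" using that by (simp add: nontrivial_tricolorings_def)
    obtain u v w a b c where labels: "[p, q, r] ! i = u"
      "\<forall>P. (\<forall>j<3. j \<noteq> i \<longrightarrow> P ([p, q, r] ! j)) \<longleftrightarrow> P v \<and> P w"
      "[u * (a - b) = v * (b - c)] (mod 3)" "[w * (c - a) = u * (a - b)] (mod 3)"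
      "lifts_to_B3 [p, q, r] \<phi> \<longleftrightarrow> lifting_braids u a v b w c"
      "constant_on_region [p, q, r] i \<phi> \<longleftrightarrow> [a = b] (mod 3)"
      by (rule tricoloring_rotated_labels[OF \<phi> i(1)])
    have "odd v" "odd w" using others spec[OF labels(2), of odd] by blast+
    have u: "even u" "u \<noteq> 0" "6 dvd u" using i(2) nonzero by (auto simp: labels(1))
    have "lifts_to_B3 [p, q, r] \<phi> \<longleftrightarrow> constant_on_region [p, q, r] i \<phi>"
      unfolding labels(5,6)
    proof
      assume lift: "lifting_braids u a v b w c"
      show "[a = b] (mod 3)"
      proof (rule ccontr)
        assume "\<not> [a = b] (mod 3)"
        \<comment> \<open>The only other tricolorings that can lift belong to an even region of length 2 or -2.\<close>
        then obtain \<epsilon> where "\<epsilon> \<in> {1, -1}" "u = 2 * \<epsilon>"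
          using lifting_braids_even_necessary[OF lift u(1,2) \<open>odd v\<close> \<open>odd w\<close>] by blast
        then show False using u(3) by auto
      qed
    qed (rule lifting_braids_constant_labels[OF u(1) _ labels(3,4)])
    also have "\<dots> \<longleftrightarrow> top_values [p, q, r] \<phi> i = top_values [p, q, r] \<phi> (Suc i mod 3)"
      using constant_on_region_iff[OF \<phi>, of i] i(1) by simp
    also have "\<dots> \<longleftrightarrow> ?pat \<phi> = P"
      using imageI[OF that, of ?pat] three_cases[OF i(1)] unfolding patterns P_def color_pattern_def
      by (auto simp: numeral_2_eq_2)
    finally show ?thesis .
  qed
  have "\<forall>D\<in>nontrivial_tricoloring_classes [p, q, r]. \<forall>\<phi>\<in>D. lifts_to_B3 [p, q, r] \<phi> \<longleftrightarrow> D = cls P"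
  proof (intro ballI)
    fix D \<phi> assume "D \<in> nontrivial_tricoloring_classes [p, q, r]" "\<phi> \<in> D"
    then obtain P' where P': "P' \<in> ?pat ` ?A" "D = cls P'" "\<phi> \<in> ?A" "?pat \<phi> = P'"
      unfolding classes by (auto simp: cls_def)
    then show "lifts_to_B3 [p, q, r] \<phi> \<longleftrightarrow> D = cls P"
      using lifts[OF P'(3)] inj_on_eq_iff[OF inj P'(1) P] by simp
  qed
  moreover have "cls P \<in> nontrivial_tricoloring_classes [p, q, r]" unfolding classes using P by blast
  ultimately show ?thesis by blast
qed

theorem theorem1p3p8:
  fixes p q r :: int
  assumes three_stranded: "p \<noteq> 0" "q \<noteq> 0" "r \<noteq> 0"
  shows
    "(odd p \<and> odd q \<and> odd r \<longrightarrow>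
       (\<forall>\<phi>\<in>nontrivial_tricolorings [p, q, r].
          lifts_to_B3 [p, q, r] \<phi> \<longleftrightarrow>
            (p, q, r) \<in> {(1, 1, 1), (3, 3, -1), (3, -1, 3), (-1, 3, 3)} \<or>
            (-p, -q, -r) \<in> {(1, 1, 1), (3, 3, -1), (3, -1, 3), (-1, 3, 3)}))
     \<and>
     (\<forall>i<3. even ([p, q, r] ! i) \<and> (\<forall>j<3. j \<noteq> i \<longrightarrow> odd ([p, q, r] ! j)) \<longrightarrow>
       (\<forall>\<phi>\<in>tricolorings [p, q, r].
          (constant_on_region [p, q, r] i \<phi> \<longrightarrow> lifts_to_B3 [p, q, r] \<phi>) \<and>
          (lifts_to_B3 [p, q, r] \<phi> \<longrightarrow> constant_on_region [p, q, r] i \<phi> \<or>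
            (\<exists>e\<in>{1, -1}. [p, q, r] ! i = 2 * e \<and>
               (\<forall>j<3. j \<noteq> i \<longrightarrow> [[p, q, r] ! j = - e] (mod 6))))))
     \<and>
     ((\<exists>i<3. 6 dvd [p, q, r] ! i \<and> (\<forall>j<3. j \<noteq> i \<longrightarrow> odd ([p, q, r] ! j) \<and> 3 dvd [p, q, r] ! j)) \<longrightarrow>
       card (nontrivial_tricoloring_classes [p, q, r]) = 4 \<and>
       (\<exists>C\<in>nontrivial_tricoloring_classes [p, q, r].
          \<forall>D\<in>nontrivial_tricoloring_classes [p, q, r]. \<forall>\<phi>\<in>D.
            lifts_to_B3 [p, q, r] \<phi> \<longleftrightarrow> D = C))"
proof (intro conjI impI)
  have nonzero: "[p, q, r] ! i \<noteq> 0" if "i < 3" for i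
    using three_cases[OF that] three_stranded by auto
  show "\<forall>\<phi>\<in>nontrivial_tricolorings [p, q, r]. lifts_to_B3 [p, q, r] \<phi> \<longleftrightarrow>
      (p, q, r) \<in> {(1, 1, 1), (3, 3, -1), (3, -1, 3), (-1, 3, 3)} \<or>
      (-p, -q, -r) \<in> {(1, 1, 1), (3, 3, -1), (3, -1, 3), (-1, 3, 3)}"
    if odd: "odd p \<and> odd q \<and> odd r"
  proof
    fix \<phi> assume "\<phi> \<in> nontrivial_tricolorings [p, q, r]"
    then have \<phi>: "\<phi> \<in> tricolorings [p, q, r]" "\<not> trivial_tricoloring [p, q, r] \<phi>"
      by (simp_all add: nontrivial_tricolorings_def)
    obtain a b c where top: "top_values [p, q, r] \<phi> 0 = reflection a"
      "top_values [p, q, r] \<phi> 1 = reflection b" "top_values [p, q, r] \<phi> 2 = reflection c"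
      and cong: "[p * (a - b) = q * (b - c)] (mod 3)" "[q * (b - c) = r * (c - a)] (mod 3)"
        "[r * (c - a) = p * (a - b)] (mod 3)"
      by (rule tricoloring_labels[OF \<phi>(1)])
    have neq: "\<not> ([a = b] (mod 3) \<and> [b = c] (mod 3))"
      using \<phi>(2) unfolding trivial_tricoloring_iff[OF \<phi>(1)] top reflection_eq_iff .
    note sufficient = lifting_braids_odd_sufficient[OF cong neq]
    show "lifts_to_B3 [p, q, r] \<phi> \<longleftrightarrow>
      (p, q, r) \<in> {(1, 1, 1), (3, 3, -1), (3, -1, 3), (-1, 3, 3)} \<or>
      (-p, -q, -r) \<in> {(1, 1, 1), (3, 3, -1), (3, -1, 3), (-1, 3, 3)}" (is "_ \<longleftrightarrow> ?exceptional")
      unfolding lifts_to_B3_labels[OF \<phi>(1) top]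
    proof
      assume lift: "lifting_braids p a q b r c"
      have "odd p" "odd q" "odd r" using odd by auto
      from lifting_braids_odd_necessary[OF lift this neq] obtain \<sigma> where "\<sigma> \<in> {1, -1}"
        and list: "(\<sigma> * p, \<sigma> * q, \<sigma> * r) \<in> {(1, 1, 1), (3, 3, -1), (3, -1, 3), (-1, 3, 3)}"
        by (elim bexE)
      then consider "\<sigma> = 1" | "\<sigma> = -1" by auto
      then show ?exceptional
      proof cases
        case 1
        show ?thesis using list unfolding 1 mult_1 by (rule disjI1)
      next
        case 2
        show ?thesis using list unfolding 2 mult_minus1 by (rule disjI2)
      qed
    next
      assume ?exceptional
      then show "lifting_braids p a q b r c"
        using sufficient[of 1, unfolded mult_1] sufficient[of "-1", unfolded mult_minus1]
        by (elim disjE) (simp_all only: insert_iff simp_thms)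
    qed
  qed
  show "\<forall>i<3. even ([p, q, r] ! i) \<and> (\<forall>j<3. j \<noteq> i \<longrightarrow> odd ([p, q, r] ! j)) \<longrightarrow>
       (\<forall>\<phi>\<in>tricolorings [p, q, r].
          (constant_on_region [p, q, r] i \<phi> \<longrightarrow> lifts_to_B3 [p, q, r] \<phi>) \<and>
          (lifts_to_B3 [p, q, r] \<phi> \<longrightarrow> constant_on_region [p, q, r] i \<phi> \<or>
            (\<exists>e\<in>{1, -1}. [p, q, r] ! i = 2 * e \<and>
               (\<forall>j<3. j \<noteq> i \<longrightarrow> [[p, q, r] ! j = - e] (mod 6)))))"
  proof (intro allI impI ballI)
    fix i :: nat and \<phi>
    assume i: "i < 3" and parity: "even ([p, q, r] ! i) \<and> (\<forall>j<3. j \<noteq> i \<longrightarrow> odd ([p, q, r] ! j))"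
      and \<phi>: "\<phi> \<in> tricolorings [p, q, r]"
    obtain u v w a b c where labels: "[p, q, r] ! i = u"
      "\<forall>P. (\<forall>j<3. j \<noteq> i \<longrightarrow> P ([p, q, r] ! j)) \<longleftrightarrow> P v \<and> P w"
      "[u * (a - b) = v * (b - c)] (mod 3)" "[w * (c - a) = u * (a - b)] (mod 3)"
      "lifts_to_B3 [p, q, r] \<phi> \<longleftrightarrow> lifting_braids u a v b w c"
      "constant_on_region [p, q, r] i \<phi> \<longleftrightarrow> [a = b] (mod 3)"
      by (rule tricoloring_rotated_labels[OF \<phi> i])
    have odd: "odd v" "odd w" using parity unfolding spec[OF labels(2), of odd] by blast+
    have u: "even u" "u \<noteq> 0" using parity nonzero[OF i] by (simp_all add: labels(1))
    show "(constant_on_region [p, q, r] i \<phi> \<longrightarrow> lifts_to_B3 [p, q, r] \<phi>) \<and>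
        (lifts_to_B3 [p, q, r] \<phi> \<longrightarrow> constant_on_region [p, q, r] i \<phi> \<or>
          (\<exists>e\<in>{1, -1}. [p, q, r] ! i = 2 * e \<and>
            (\<forall>j<3. j \<noteq> i \<longrightarrow> [[p, q, r] ! j = - e] (mod 6))))"
      unfolding labels(1,5,6) spec[OF labels(2), of "\<lambda>x. [x = - e] (mod 6)" for e]
      using lifting_braids_constant_labels[OF u(1) _ labels(3,4)]
        lifting_braids_even_necessary[OF _ u odd] by blast
  qed
  assume "\<exists>i<3. 6 dvd [p, q, r] ! i \<and> (\<forall>j<3. j \<noteq> i \<longrightarrow> odd ([p, q, r] ! j) \<and> 3 dvd [p, q, r] ! j)"
  then obtain i where i: "i < 3" "6 dvd [p, q, r] ! i"
    "\<And>j. j < 3 \<Longrightarrow> j \<noteq> i \<Longrightarrow> odd ([p, q, r] ! j) \<and> 3 dvd [p, q, r] ! j" by blast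
  note four = four_classes_one_lifts[OF i nonzero[OF i(1)]]
  show "card (nontrivial_tricoloring_classes [p, q, r]) = 4" using four by blast
  show "\<exists>C\<in>nontrivial_tricoloring_classes [p, q, r]. \<forall>D\<in>nontrivial_tricoloring_classes [p, q, r].
      \<forall>\<phi>\<in>D. lifts_to_B3 [p, q, r] \<phi> \<longleftrightarrow> D = C" using four by blast
qed

end
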